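(* Let $X=L\cup J\cup R$ belong to the class $\mathcal{C}$. (1) If $R$ is a singleton and $L$ is nondegenerate such that $R\subset L$, then $$\mathcal{M}(X)=\bigcup\left\{\mathcal{M}(L\cup A)\colon A\text{ is an arc},\ R\subseteq A\subset R\cup J\right\}.$$ (2) If $R$ is a singleton and $L$ is nondegenerate such that $L\cap R=\emptyset$, then $$\mathcal{M}(X)=\mathcal{M}(L)\sqcup\mathcal{M}(J\cup R).$$ (3) If $L,R$ are nondegenerate such that $L\cap R\neq\emptyset$, then $$\mathcal{M}(X)=\mathcal{M}(L\cup R)\sqcup\mathcal{M}(J).$$ (4) If $L,R$ are nondegenerate such that $L\cap R=\emptyset$, then (a) $\mathcal{M}(X)\subseteq\mathcal{M}(J)\sqcup\mathcal{M}(L)\sqcup\mathcal{M}(R)\sqcup\mathcal{M}^*(L;R)$, and (b) $\mathcal{M}(X)\supseteq\mathcal{M}(J)\sqcup\mathcal{M}(L)\sqcup\mathcal{M}(R)$.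
   Context: A continuum is a nonempty compact connected metrizable space; it is nondegenerate if it has more than one point. An arc is a space homeomorphic to $[0,1]$. A ray is a space homeomorphic to $[0,\infty)$. A free interval in a space is an open subset homeomorphic to $(0,1)$. The class $\mathcal{C}$ consists of all continua $X$ that can be written as $X=L\cup J\cup R$, where $J$ is a free interval dense in $X$, and $L,R$ are (nowhere dense) locally connected continua (possibly singletons) disjoint from $J$ such that, for some rays $J_L,J_R$ with $J=J_L\cup J_R$, the set $L\cup J_L$ is a compactification of $J_L$ (with remainder $L$) and $R\cup J_R$ is a compactification of $J_R$ (with remainder $R$). Writing "$X=L\cup J\cup R$ belongs to $\mathcal{C}$" means that $L,J,R$ are as in this definition. A continuous map $g\colon M\to M$ of a nonempty compact metrizable space $M$ is minimal (and $(M,g)$ is a minimal dynamical system) if no nonempty proper closed subset $N\subseteq M$ satisfies $g(N)\subseteq N$. For a metrizable (not necessarily compact) space $Y$, $\mathcal{M}(Y)$ denotes the system of all (nonempty) compact sets $M\subseteq Y$ for which there is a continuous map $f\colon Y\to Y$ with $f(M)=M$ and $(M,f|_M)$ a minimal dynamical system. For disjoint metrizable spaces $Y,Z$, $\mathcal{M}^*(Y;Z)$ denotes the system of all $M\in\mathcal{M}(Y\sqcup Z)$ such that $M\cap Y$ and $M\cap Z$ have the same cardinality (here $Y\sqcup Z$ is the disjoint union; for disjoint compact $L,R\subseteq X$ it is the subspace $L\cup R$). The symbol $\sqcup$ between systems of sets denotes a union of pairwise disjoint systems. *)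

theory Defs
  imports "HOL-Analysis.Analysis"
begin

definition continuum :: "'a topology \<Rightarrow> bool" where
  "continuum T \<longleftrightarrow>
     topspace T \<noteq> {} \<and> compact_space T \<and> connected_space T \<and> metrizable_space T"

definition nondegenerate :: "'a set \<Rightarrow> bool" where
  "nondegenerate S \<longleftrightarrow> (\<exists>x\<in>S. \<exists>y\<in>S. x \<noteq> y)"

definition arc_in :: "'a topology \<Rightarrow> 'a set \<Rightarrow> bool" where
  "arc_in T A \<longleftrightarrow>
     A \<subseteq> topspace T \<and> subtopology T A homeomorphic_space top_of_set {0..1::real}"

definition ray_in :: "'a topology \<Rightarrow> 'a set \<Rightarrow> bool" where
  "ray_in T A \<longleftrightarrow>
     A \<subseteq> topspace T \<and> subtopology T A homeomorphic_space top_of_set {0::real..}"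

definition free_interval :: "'a topology \<Rightarrow> 'a set \<Rightarrow> bool" where
  "free_interval T J \<longleftrightarrow>
     openin T J \<and> subtopology T J homeomorphic_space top_of_set {0<..<1::real}"

definition dense_in :: "'a topology \<Rightarrow> 'a set \<Rightarrow> bool" where
  "dense_in T S \<longleftrightarrow> S \<subseteq> topspace T \<and> T closure_of S = topspace T"

definition nowhere_dense_in :: "'a topology \<Rightarrow> 'a set \<Rightarrow> bool" where
  "nowhere_dense_in T S \<longleftrightarrow> S \<subseteq> topspace T \<and> T interior_of (T closure_of S) = {}"

definition compactification_with_remainder ::
    "'a topology \<Rightarrow> 'a set \<Rightarrow> 'a set \<Rightarrow> bool" where
  "compactification_with_remainder K S Z \<longleftrightarrow>
     compact_space K \<and> Hausdorff_space K \<and> dense_in K S \<and> Z = topspace K - S"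

text \<open>The sets \<open>L\<close> and \<open>R\<close> are disjoint from \<open>J\<close> but may intersect each other.\<close>

definition class_C :: "'a topology \<Rightarrow> 'a set \<Rightarrow> 'a set \<Rightarrow> 'a set \<Rightarrow> bool" where
  "class_C X L J R \<longleftrightarrow>
     continuum X \<and> topspace X = L \<union> J \<union> R \<and>
     free_interval X J \<and> dense_in X J \<and>
     (\<forall>K\<in>{L, R}. nowhere_dense_in X K \<and> continuum (subtopology X K) \<and>
                 locally_connected_space (subtopology X K) \<and> disjnt K J) \<and>
     (\<exists>JL JR. ray_in X JL \<and> ray_in X JR \<and> J = JL \<union> JR \<and>
        compactification_with_remainder (subtopology X (L \<union> JL)) JL L \<and>
        compactification_with_remainder (subtopology X (R \<union> JR)) JR R)"

definition minimal_system :: "'a topology \<Rightarrow> ('a \<Rightarrow> 'a) \<Rightarrow> bool" where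
  "minimal_system T g \<longleftrightarrow>
     topspace T \<noteq> {} \<and> compact_space T \<and> metrizable_space T \<and> continuous_map T T g \<and>
     \<not> (\<exists>N. closedin T N \<and> N \<noteq> {} \<and> N \<noteq> topspace T \<and> g ` N \<subseteq> N)"

definition minimal_sets :: "'a topology \<Rightarrow> 'a set set" where
  "minimal_sets Y =
     {M. M \<noteq> {} \<and> compactin Y M \<and>
         (\<exists>f. continuous_map Y Y f \<and> f ` M = M \<and> minimal_system (subtopology Y M) f)}"

text \<open>
  The topological disjoint union of two spaces whose underlying sets are already disjoint
  subsets of one type; unlike for \<^const>\<open>sum_topology\<close>, the points need not be tagged.
\<close>

definition disjoint_union_topology :: "'a topology \<Rightarrow> 'a topology \<Rightarrow> 'a topology" where
  "disjoint_union_topology Y Z =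
     topology (\<lambda>U. U \<subseteq> topspace Y \<union> topspace Z \<and>
                   openin Y (U \<inter> topspace Y) \<and> openin Z (U \<inter> topspace Z))"

lemma openin_disjoint_union_topology:
  "openin (disjoint_union_topology Y Z) U \<longleftrightarrow>
     U \<subseteq> topspace Y \<union> topspace Z \<and>
     openin Y (U \<inter> topspace Y) \<and> openin Z (U \<inter> topspace Z)"
proof -
  have "istopology (\<lambda>U. U \<subseteq> topspace Y \<union> topspace Z \<and>
          openin Y (U \<inter> topspace Y) \<and> openin Z (U \<inter> topspace Z))"
    unfolding istopology_def
  proof (intro conjI allI impI)
    fix S T
    assume S: "S \<subseteq> topspace Y \<union> topspace Z \<and> openin Y (S \<inter> topspace Y) \<and> openin Z (S \<inter> topspace Z)"
      and T: "T \<subseteq> topspace Y \<union> topspace Z \<and> openin Y (T \<inter> topspace Y) \<and> openin Z (T \<inter> topspace Z)"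
    show "S \<inter> T \<subseteq> topspace Y \<union> topspace Z"
      using S by blast
    have "S \<inter> T \<inter> topspace W = (S \<inter> topspace W) \<inter> (T \<inter> topspace W)" for W
      by blast
    then show "openin Y (S \<inter> T \<inter> topspace Y)" "openin Z (S \<inter> T \<inter> topspace Z)"
      using S T by (simp_all only: openin_Int)
  next
    fix \<K>
    assume K: "\<forall>K\<in>\<K>. K \<subseteq> topspace Y \<union> topspace Z \<and>
                 openin Y (K \<inter> topspace Y) \<and> openin Z (K \<inter> topspace Z)"
    then show "\<Union>\<K> \<subseteq> topspace Y \<union> topspace Z"
      by blast
    have eq: "\<Union>\<K> \<inter> topspace W = (\<Union>K\<in>\<K>. K \<inter> topspace W)" for W
      by blast
    show "openin Y (\<Union>\<K> \<inter> topspace Y)"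
      unfolding eq by (rule openin_Union) (use K in blast)
    show "openin Z (\<Union>\<K> \<inter> topspace Z)"
      unfolding eq by (rule openin_Union) (use K in blast)
  qed
  then show ?thesis
    by (simp add: disjoint_union_topology_def)
qed

lemma topspace_disjoint_union_topology [simp]:
  "topspace (disjoint_union_topology Y Z) = topspace Y \<union> topspace Z"
proof -
  have eqs: "(topspace Y \<union> topspace Z) \<inter> topspace Y = topspace Y"
    "(topspace Y \<union> topspace Z) \<inter> topspace Z = topspace Z"
    by auto
  show ?thesis
  proof
    show "topspace (disjoint_union_topology Y Z) \<subseteq> topspace Y \<union> topspace Z"
      using openin_topspace[of "disjoint_union_topology Y Z"]
      unfolding openin_disjoint_union_topology by (rule conjunct1)
    have "openin (disjoint_union_topology Y Z) (topspace Y \<union> topspace Z)"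
      by (simp add: openin_disjoint_union_topology eqs)
    then show "topspace Y \<union> topspace Z \<subseteq> topspace (disjoint_union_topology Y Z)"
      by (rule openin_subset)
  qed
qed

lemma disjoint_union_topology_subtopology:
  assumes "closedin X L" "closedin X R" "disjnt L R"
  shows "disjoint_union_topology (subtopology X L) (subtopology X R) = subtopology X (L \<union> R)"
proof -
  have L: "L \<subseteq> topspace X" and R: "R \<subseteq> topspace X"
    using assms(1,2) by (simp_all add: closedin_subset)
  have ts: "topspace (subtopology X L) = L" "topspace (subtopology X R) = R"
    using L R by (simp_all add: Int_absorb1)
  have "openin (disjoint_union_topology (subtopology X L) (subtopology X R)) U
          \<longleftrightarrow> openin (subtopology X (L \<union> R)) U" for U
  proof
    assume "openin (disjoint_union_topology (subtopology X L) (subtopology X R)) U"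
    then have U: "U \<subseteq> L \<union> R" and "openin (subtopology X L) (U \<inter> L)"
      and "openin (subtopology X R) (U \<inter> R)"
      unfolding openin_disjoint_union_topology ts by simp_all
    then obtain A B where A: "openin X A" "U \<inter> L = A \<inter> L" and B: "openin X B" "U \<inter> R = B \<inter> R"
      unfolding openin_subtopology by metis
    have "openin X ((A - R) \<union> (B - L))"
      by (rule openin_Un; rule openin_diff; fact)
    moreover have "U = ((A - R) \<union> (B - L)) \<inter> (L \<union> R)"
      using U A(2) B(2) assms(3) unfolding disjnt_def by blast
    ultimately show "openin (subtopology X (L \<union> R)) U"
      unfolding openin_subtopology by blast
  next
    assume "openin (subtopology X (L \<union> R)) U"
    then obtain T where T: "openin X T" "U = T \<inter> (L \<union> R)"
      unfolding openin_subtopology by blast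
    have "U \<inter> L = T \<inter> L" "U \<inter> R = T \<inter> R" "U \<subseteq> L \<union> R"
      using T(2) by blast+
    with T(1) show "openin (disjoint_union_topology (subtopology X L) (subtopology X R)) U"
      unfolding openin_disjoint_union_topology ts openin_subtopology by blast
  qed
  then show ?thesis
    by (simp add: topology_eq)
qed

text \<open>
  Only meaningful for \<open>Y\<close>, \<open>Z\<close> with disjoint underlying sets. Cardinalities are compared by
  equipollence, because \<^const>\<open>card\<close> does not distinguish infinite cardinalities.
\<close>

definition minimal_sets_star :: "'a topology \<Rightarrow> 'a topology \<Rightarrow> 'a set set" where
  "minimal_sets_star Y Z =
     {M \<in> minimal_sets (disjoint_union_topology Y Z).
        (M \<inter> topspace Y) \<approx> (M \<inter> topspace Z)}"

end

theory Submission
  imports Defs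
begin

text \<open>
  Let \<open>h\<close> parametrise \<open>J\<close> by \<open>(0, 1)\<close>, the left end accumulating exactly on \<open>L\<close> and the right end
  on \<open>R\<close>. A path that leaves \<open>J\<close> through the left end sweeps out a whole tail of \<open>J\<close>, so its exit point
  is the only point of \<open>L\<close>. Hence \<open>J\<close> is a path component of \<open>X\<close> when both remainders are nondegenerate,
  and \<open>J \<union> R\<close> is one when \<open>R\<close> is a point outside \<open>L\<close>. A continuous self-map sends path components into path
  components. Together with the density of \<open>J\<close> and the fact that a minimal set meeting an invariant closed
  set lies in it, this shows that every minimal set of \<open>X\<close> is of one of the kinds in (2), (3), (4).

  The opposite inclusions need extensions of self-maps. A Peano continuum is uniformly locally
  path-connected. So a map from \<open>L\<close> into a Peano continuum \<open>P\<close> extends over \<open>L \<union> h ` {0<..a}\<close>: at a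
  sequence of parameters tending to \<open>0\<close>, so fine that \<open>h\<close> moves little between consecutive ones, one takes
  the value at a nearest point of \<open>L\<close>, and joins consecutive values by short paths.

  In (1) the same extension gives retractions of \<open>X\<close> onto \<open>L \<union> A\<close>; the remaining point is that a minimal set
  misses a left tail of \<open>J\<close>. A continuous image of a Peano continuum always does so, because a short path
  from deep inside the left end to \<open>L\<close> would have to run through all of the rest of \<open>J\<close>. If the minimal
  set met every left tail, a left tail would be mapped into a left tail, so \<open>f ` L \<subseteq> L\<close>,
  contradicting minimality.
\<close>

subsection \<open>Peano continua are uniformly locally path-connected\<close>

text \<open>The arguments about paths and nearest points need a metric, whereas \<open>X\<close> is
  an abstract topology. A compact metrizable space is embedded in
  \<open>nat \<Rightarrow> real\<close>, and minimal sets are carried along by conjugation. The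
  class C supplies its two rays only up to homeomorphism. Each is closed in \<open>J\<close>, hence
  a tail at one end of \<open>(0, 1)\<close>; as together they cover \<open>J\<close>, they sit at
  different ends. Reversing the parameter exchanges \<open>L\<close> and \<open>R\<close>, so a
  statement about one end yields the other. An extension over all of \<open>J\<close> must respect
  both ends. If \<open>L\<close> and \<open>R\<close> meet, \<open>L \<union> R\<close> is itself a
  Peano continuum and can serve as the target. If they are disjoint, a map exchanging them would
  have to reverse \<open>J\<close> with prescribed behaviour at both ends, which filling by short
  paths does not give; so \<open>minimal_sets_star\<close> occurs only in the upper bound of (4).
  The equal cardinalities there come from such an exchange: each of \<open>M \<inter> L\<close> and
  \<open>M \<inter> R\<close> lies in the image of the other.\<close>

definition uniformly_locally_path_connected :: "'b::metric_space set \<Rightarrow> bool" where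
  "uniformly_locally_path_connected S \<longleftrightarrow> (\<forall>e>0. \<exists>d>0. \<forall>x\<in>S. \<forall>y\<in>S. dist x y < d \<longrightarrow>
     (\<exists>g. path g \<and> path_image g \<subseteq> S \<inter> ball x e \<and> pathstart g = x \<and> pathfinish g = y))"

text \<open>The sets \<open>Q z\<close> are open, cover \<open>S\<close> and have small connected
  traces on \<open>S\<close>; a Lebesgue number of this cover is the required \<open>d\<close>. The
  radius \<open>e/2\<close> around \<open>z\<close> becomes \<open>e\<close> around
  \<open>x\<close>.\<close>

lemma uniformly_locally_connected:
  fixes S :: "'b::metric_space set"
  assumes S: "compact S" and lc: "locally_connected_space (top_of_set S)" and e: "e > 0"
  obtains d where "d > 0"
    "\<And>x y. x \<in> S \<Longrightarrow> y \<in> S \<Longrightarrow> dist x y < d \<Longrightarrow>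
       \<exists>C. connected C \<and> C \<subseteq> S \<inter> ball x e \<and> x \<in> C \<and> y \<in> C"
proof -
  have "\<exists>O'. open O' \<and> z \<in> O' \<and> connected (S \<inter> O') \<and> S \<inter> O' \<subseteq> ball z (e/2)" if "z \<in> S" for z
  proof -
    have op: "openin (top_of_set S) (S \<inter> ball z (e/2))"
      by (simp add: openin_open_Int)
    have "z \<in> S \<inter> ball z (e/2)"
      using that e by simp
    with lc op obtain U V where UV: "openin (top_of_set S) U" "connectedin (top_of_set S) V" "z \<in> U"
        "U \<subseteq> V" "V \<subseteq> S \<inter> ball z (e/2)" "openin (top_of_set S) V"
      unfolding locally_connected_space_alt neighbourhood_base_of by metis
    then obtain O' where "open O'" "V = S \<inter> O'"
      by (auto simp: openin_open)
    with UV show ?thesis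
      by (metis Int_iff connectedin_subtopology connectedin_iff_connected le_inf_iff subsetD)
  qed
  then obtain Q where Q: "\<And>z. z \<in> S \<Longrightarrow> open (Q z) \<and> z \<in> Q z \<and> connected (S \<inter> Q z) \<and> S \<inter> Q z \<subseteq> ball z (e/2)"
    by metis
  obtain d where d: "d > 0" "\<And>x. x \<in> S \<Longrightarrow> \<exists>G\<in>Q ` S. ball x d \<subseteq> G"
    by (rule Heine_Borel_lemma[OF S, of "Q ` S"]) (use Q in auto)
  show thesis
  proof
    fix x y assume xy: "x \<in> S" "y \<in> S" "dist x y < d"
    obtain z where z: "z \<in> S" "ball x d \<subseteq> Q z"
      using d(2)[OF xy(1)] by auto
    have "x \<in> S \<inter> Q z" "y \<in> S \<inter> Q z"
      using z(2) xy d(1) by auto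
    moreover have "S \<inter> Q z \<subseteq> ball x e"
    proof
      fix w assume "w \<in> S \<inter> Q z"
      then have "dist z w < e/2" "dist z x < e/2"
        using Q[OF z(1)] \<open>x \<in> S \<inter> Q z\<close> by auto
      then show "w \<in> ball x e"
        using dist_triangle_half_r[of z x e w] by simp
    qed
    ultimately show "\<exists>C. connected C \<and> C \<subseteq> S \<inter> ball x e \<and> x \<in> C \<and> y \<in> C"
      using Q[OF z(1)] by (intro exI[of _ "S \<inter> Q z"]) auto
  qed (rule d(1))
qed

text \<open>Being joined by an \<open>e\<close>-chain is an equivalence relation on \<open>C\<close>
  with open classes, so there is only one class. Chains are sequences that end up constant, so they
  can be padded to any larger length.\<close>

lemma connected_chain:
  fixes C :: "'b::metric_space set"
  assumes "connected C" "x \<in> C" "y \<in> C" "e > 0"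
  shows "\<exists>p N. p 0 = x \<and> (\<forall>i\<ge>N. p i = y) \<and> (\<forall>i::nat. p i \<in> C \<and> dist (p i) (p (Suc i)) < e)"
proof -
  define R where "R = (\<lambda>u v. u \<in> C \<and> v \<in> C \<and> dist u v < e)"
  have "R\<^sup>*\<^sup>* x y"
  proof (rule connected_equivalence_relation[OF assms(1-3)])
    show "R\<^sup>*\<^sup>* b a" if "R\<^sup>*\<^sup>* a b" for a b
    proof -
      have "symp R" by (auto simp: symp_def R_def dist_commute)
      then show ?thesis using that by (meson symp_rtranclp sympD)
    qed
    show "\<exists>T. openin (top_of_set C) T \<and> a \<in> T \<and> (\<forall>x\<in>T. R\<^sup>*\<^sup>* a x)" if "a \<in> C" for a
      using that assms(4)
      by (intro exI[of _ "C \<inter> ball a e"]) (auto simp: openin_open_Int R_def)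
  qed auto
  then show ?thesis
  proof (induction rule: rtranclp_induct)
    case base
    show ?case
      by (rule exI[of _ "\<lambda>_. x"]) (use assms in auto)
  next
    case (step y z)
    then obtain p N where p: "p 0 = x" "\<And>i::nat. i \<ge> N \<Longrightarrow> p i = y"
      "\<And>i. p i \<in> C \<and> dist (p i) (p (Suc i)) < e"
      by metis
    have "dist y z < e" "z \<in> C" using step by (auto simp: R_def)
    let ?q = "\<lambda>i. if i \<le> N then p i else z"
    have "dist (?q i) (?q (Suc i)) < e" for i
    proof (cases "i = N")
      case True then show ?thesis using p(2)[of N] \<open>dist y z < e\<close> by simp
    next
      case False then show ?thesis using p(3)[of i] assms(4) by auto
    qed
    then show ?case
      using p \<open>z \<in> C\<close> by (intro exI[of _ ?q] exI[of _ "Suc N"]) auto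
  qed
qed

text \<open>The steps from \<open>k\<close> onwards sum to at most \<open>2 * c * (1/2)^k\<close>.
  Compactness supplies a limit of a subsequence, and the tail bound makes it serve for the whole
  sequence.\<close>

lemma geometric_Cauchy_limit:
  fixes a :: "nat \<Rightarrow> 'b::metric_space"
  assumes "compact S" "\<And>k. a k \<in> S" "\<And>k. dist (a k) (a (Suc k)) \<le> c * (1/2)^k"
  shows "\<exists>l\<in>S. \<forall>k. dist (a k) l \<le> 2 * c * (1/2)^k"
proof -
  have *: "dist (a k) (a (k + m)) \<le> 2 * c * (1/2)^k - 2 * c * (1/2)^(k+m)" for k m
  proof (induction m)
    case (Suc m)
    have "dist (a k) (a (k + Suc m)) \<le> dist (a k) (a (k + m)) + dist (a (k+m)) (a (Suc (k + m)))"
      by (metis add_Suc_right dist_triangle)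
    also have "\<dots> \<le> 2 * c * (1/2)^k - 2 * c * (1/2)^(k+m) + c * (1/2)^(k+m)"
      using Suc assms(3)[of "k+m"] by linarith
    finally show ?case by (simp add: algebra_simps)
  qed simp
  have c: "c \<ge> 0"
    using assms(3)[of 0] zero_le_dist[of "a 0" "a 1"] by (simp del: zero_le_dist)
  obtain l r where l: "l \<in> S" "strict_mono r" "(a \<circ> r) \<longlonglongrightarrow> l"
    using assms(1,2) unfolding compact_def by meson
  have "dist (a k) l \<le> 2 * c * (1/2)^k" for k
  proof (rule tendsto_upperbound)
    show "(\<lambda>n. dist (a k) ((a \<circ> r) n)) \<longlonglongrightarrow> dist (a k) l"
      using l(3) by (intro tendsto_intros)
    have "dist (a k) ((a \<circ> r) n) \<le> 2 * c * (1/2)^k" if "n \<ge> k" for n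
    proof -
      have "r n \<ge> k" using that seq_suble[OF l(2), of n] by linarith
      then obtain m where "r n = k + m" using le_Suc_ex by blast
      have "0 \<le> 2 * c * (1/2)^(k+m)" using c by simp
      then show ?thesis using *[of k m] \<open>r n = k + m\<close> by (simp del: power_add)
    qed
    then show "\<forall>\<^sub>F n in sequentially. dist (a k) ((a \<circ> r) n) \<le> 2 * c * (1/2)^k"
      by (rule eventually_sequentiallyI)
  qed auto
  with l(1) show ?thesis by blast
qed

text \<open>Each link is replaced by a finer chain inside a small connected set. All replacements
  are padded to the same length \<open>2^m\<close>, so that entry \<open>j\<close> of the new chain
  belongs to link \<open>j div 2^m\<close> and both chains can be read off at the same dyadic
  time.\<close>

lemma chain_refinement:
  fixes S :: "'b::metric_space set"
  assumes sub: "\<And>x y. x \<in> S \<Longrightarrow> y \<in> S \<Longrightarrow> dist x y < \<delta> \<Longrightarrow>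
       \<exists>C. connected C \<and> C \<subseteq> S \<inter> ball x e \<and> x \<in> C \<and> y \<in> C"
    and "e > 0" "\<delta>' > 0"
    and p: "p 0 = x" "\<And>i. i \<ge> 2^n \<Longrightarrow> p i = y" "\<And>i::nat. p i \<in> S \<and> dist (p i) (p (Suc i)) < \<delta>"
  shows "\<exists>p' m. p' 0 = x \<and> (\<forall>i\<ge>2^(n+m). p' i = y) \<and>
     (\<forall>i. p' i \<in> S \<and> dist (p' i) (p' (Suc i)) < \<delta>') \<and> (\<forall>j. dist (p' j) (p (j div 2^m)) < e)"
proof -
  have "\<exists>c N. c 0 = p i \<and> (\<forall>j\<ge>N. c j = p (Suc i)) \<and>
      (\<forall>j::nat. c j \<in> S \<inter> ball (p i) e \<and> dist (c j) (c (Suc j)) < \<delta>')" for i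
  proof -
    obtain C where "connected C" "C \<subseteq> S \<inter> ball (p i) e" "p i \<in> C" "p (Suc i) \<in> C"
      using sub p(3) by meson
    with connected_chain[of C "p i" "p (Suc i)" \<delta>'] \<open>\<delta>' > 0\<close> show ?thesis
      by (meson subsetD)
  qed
  then obtain c N where c: "\<And>i. c i 0 = p i" "\<And>i j. j \<ge> N i \<Longrightarrow> c i j = p (Suc i)"
      "\<And>i j. c i j \<in> S \<inter> ball (p i) e" "\<And>i j. dist (c i j) (c i (Suc j)) < \<delta>'"
    by metis
  define m where "m = (\<Sum>i<2^n. N i)"
  have Nm: "N i \<le> 2^m" if "i < 2^n" for i
  proof -
    have "N i \<le> m" unfolding m_def using that by (intro member_le_sum) auto
    also have "m \<le> 2^m" by (simp add: less_imp_le)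
    finally show ?thesis .
  qed
  define p' where "p' j = (if j div 2^m < 2^n then c (j div 2^m) (j mod 2^m) else y)" for j
  have fin: "p' i = y" if "i \<ge> 2^(n+m)" for i
  proof -
    have "i div 2^m \<ge> 2^n" using that div_le_mono[of "2^(n+m)" i "2^m"]
      by (simp add: power_add)
    then show ?thesis by (simp add: p'_def)
  qed
  have "y \<in> S" using p(2)[of "2^n"] p(3)[of "2^n"] by simp
  have "p' i \<in> S" for i using c(3) \<open>y \<in> S\<close> by (auto simp: p'_def)
  moreover have "dist (p' i) (p' (Suc i)) < \<delta>'" for i
  \<comment> \<open>Only the last entry of a block needs care: the following entry starts the next
    block, but it is also entry \<open>2^m\<close> of the current padded chain, so the step bound
    still applies.\<close>
  proof (cases "Suc (i mod 2^m) = 2^m")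
    case True
    then have s: "Suc i div 2^m = Suc (i div 2^m)" "Suc i mod 2^m = 0"
      by (simp_all add: div_Suc mod_Suc)
    have "p' (Suc i) = p (Suc (i div 2^m))"
      by (auto simp: p'_def s c(1) p(2))
    moreover have "p' i = c (i div 2^m) (i mod 2^m)" if "i div 2^m < 2^n"
      using that by (simp add: p'_def)
    moreover have "c (i div 2^m) (2^m) = p (Suc (i div 2^m))" if "i div 2^m < 2^n"
      using that Nm c(2) by blast
    moreover have "p' i = y \<and> p' (Suc i) = y" if "\<not> i div 2^m < 2^n"
      using that by (simp add: p'_def s)
    ultimately show ?thesis
      using c(4)[of "i div 2^m" "i mod 2^m"] True \<open>\<delta>' > 0\<close>
      by (cases "i div 2^m < 2^n") auto
  next
    case False
    then have s: "Suc i div 2^m = i div 2^m" "Suc i mod 2^m = Suc (i mod 2^m)"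
      by (simp_all add: div_Suc mod_Suc)
    show ?thesis using c(4) \<open>\<delta>' > 0\<close> by (simp add: p'_def s)
  qed
  moreover have "dist (p' j) (p (j div 2^m)) < e" for j
    using c(3)[of "j div 2^m" "j mod 2^m"] p(2)[of "j div 2^m"] \<open>e > 0\<close>
    by (auto simp: p'_def dist_commute)
  moreover have "p' 0 = x" by (simp add: p'_def c(1) p(1))
  ultimately show ?thesis using fin by blast
qed

lemma floor_step_le:
  fixes s t :: real
  assumes "0 \<le> s" "s \<le> t" "t < s + 1"
  shows "nat \<lfloor>t\<rfloor> = nat \<lfloor>s\<rfloor> \<or> nat \<lfloor>t\<rfloor> = Suc (nat \<lfloor>s\<rfloor>)"
proof -
  have "\<lfloor>s\<rfloor> \<le> \<lfloor>t\<rfloor>" "\<lfloor>t\<rfloor> \<le> \<lfloor>s\<rfloor> + 1" "0 \<le> \<lfloor>s\<rfloor>"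
    using assms by (auto simp: floor_mono) linarith
  then show ?thesis by linarith
qed

lemma nat_floor_dyadic_div:
  fixes t :: real
  assumes "t \<ge> 0"
  shows "nat \<lfloor>t * 2^(n+m)\<rfloor> div 2^m = nat \<lfloor>t * 2^n\<rfloor>"
proof -
  have "\<lfloor>t * 2^n\<rfloor> = \<lfloor>(t * 2^(n+m)) / real_of_int (2^m)\<rfloor>"
    by (simp add: power_add)
  also have "\<dots> = \<lfloor>t * 2^(n+m)\<rfloor> div 2^m"
    by (rule floor_divide_real_eq_div) simp
  finally show ?thesis
    using assms by (simp add: nat_div_distrib nat_power_eq)
qed

text \<open>The path is a uniform limit of step functions. Stage \<open>k\<close> is a chain from
  \<open>x\<close> to \<open>y\<close> with links shorter than \<open>D k\<close>, run through at
  constant speed; refining it moves every value by less than \<open>e k\<close>. The limit is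
  continuous although the stages jump.\<close>

proposition compact_locally_connected_imp_uniformly_locally_path_connected:
  fixes S :: "'b::metric_space set"
  assumes S: "compact S" and lc: "locally_connected_space (top_of_set S)"
  shows "uniformly_locally_path_connected S"
  unfolding uniformly_locally_path_connected_def
proof (intro allI impI)
  fix \<epsilon> :: real assume "\<epsilon> > 0"
  \<comment> \<open>The bounds \<open>e k\<close> sum to \<open>2 * e 0\<close>, and the first stage
    is within \<open>e 0\<close> of \<open>x\<close>; so the path stays within
    \<open>3 * e 0 < \<epsilon>\<close>.\<close>
  define e where "e k = \<epsilon>/8 * (1/2)^k" for k :: nat
  have e: "e k > 0" for k using \<open>\<epsilon> > 0\<close> by (simp add: e_def)
  have "\<exists>d>0. d \<le> e k \<and> (\<forall>x\<in>S. \<forall>y\<in>S. dist x y < d \<longrightarrow>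
       (\<exists>C. connected C \<and> C \<subseteq> S \<inter> ball x (e k) \<and> x \<in> C \<and> y \<in> C))" for k
  proof -
    obtain d where "d > 0" "\<And>x y. x \<in> S \<Longrightarrow> y \<in> S \<Longrightarrow> dist x y < d \<Longrightarrow>
       \<exists>C. connected C \<and> C \<subseteq> S \<inter> ball x (e k) \<and> x \<in> C \<and> y \<in> C"
      by (rule uniformly_locally_connected[OF S lc e[of k]], blast)
    then show ?thesis using e[of k] by (intro exI[of _ "min d (e k)"]) auto
  qed
  then obtain D where D: "\<And>k. D k > 0" "\<And>k. D k \<le> e k"
      "\<And>k x y. x \<in> S \<Longrightarrow> y \<in> S \<Longrightarrow> dist x y < D k \<Longrightarrow>
         \<exists>C. connected C \<and> C \<subseteq> S \<inter> ball x (e k) \<and> x \<in> C \<and> y \<in> C"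
    by metis
  show "\<exists>d>0. \<forall>x\<in>S. \<forall>y\<in>S. dist x y < d \<longrightarrow>
     (\<exists>g. path g \<and> path_image g \<subseteq> S \<inter> ball x \<epsilon> \<and> pathstart g = x \<and> pathfinish g = y)"
  proof (intro exI[of _ "D 0"] conjI ballI impI D(1))
    fix x y assume xy: "x \<in> S" "y \<in> S" "dist x y < D 0"
    \<comment> \<open>A state is a chain with an exponent: the chain has reached \<open>y\<close> at
      index \<open>2^snd \<sigma>\<close>, which corresponds to time 1.\<close>
    define P where "P k \<sigma> \<longleftrightarrow> fst \<sigma> 0 = x \<and> (\<forall>i\<ge>2^snd \<sigma>. fst \<sigma> i = y) \<and>
        (\<forall>i. fst \<sigma> i \<in> S \<and> dist (fst \<sigma> i) (fst \<sigma> (Suc i)) < D k)"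
      for k and \<sigma> :: "(nat \<Rightarrow> 'b) \<times> nat"
    define Q where "Q k \<sigma> \<tau> \<longleftrightarrow> (\<exists>m. snd \<tau> = snd \<sigma> + m \<and>
        (\<forall>j. dist (fst \<tau> j) (fst \<sigma> (j div 2^m)) < e k))"
      for k and \<sigma> \<tau> :: "(nat \<Rightarrow> 'b) \<times> nat"
    have "\<exists>\<tau>. P (Suc k) \<tau> \<and> Q k \<sigma> \<tau>" if "P k \<sigma>" for k \<sigma>
    proof -
      have "\<exists>p' m. p' 0 = x \<and> (\<forall>i\<ge>2^(snd \<sigma>+m). p' i = y) \<and>
         (\<forall>i. p' i \<in> S \<and> dist (p' i) (p' (Suc i)) < D (Suc k)) \<and>
         (\<forall>j. dist (p' j) (fst \<sigma> (j div 2^m)) < e k)"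
        by (rule chain_refinement[where \<delta> = "D k"]) (use that D e in \<open>auto simp: P_def\<close>)
      then obtain p' m where pm: "p' 0 = x" "\<forall>i\<ge>2^(snd \<sigma>+m). p' i = y"
         "\<forall>i. p' i \<in> S \<and> dist (p' i) (p' (Suc i)) < D (Suc k)"
         "\<forall>j. dist (p' j) (fst \<sigma> (j div 2^m)) < e k"
        by blast
      show ?thesis
        by (rule exI[of _ "(p', snd \<sigma> + m)"]) (use pm in \<open>auto simp: P_def Q_def\<close>)
    qed
    moreover have "P 0 ((\<lambda>i. if i = 0 then x else y), 0)"
      using xy D(1)[of 0] by (auto simp: P_def)
    \<comment> \<open>The clause for \<open>k = 0\<close> fixes the starting state, the chain that
      jumps from \<open>x\<close> to \<open>y\<close> at once.\<close>
    ultimately obtain \<sigma> where "\<sigma> 0 = ((\<lambda>i. if i = 0 then x else y), 0)" "\<And>k. P k (\<sigma> k)" "\<And>k. Q k (\<sigma> k) (\<sigma> (Suc k))"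
      using dependent_nat_choice[of "\<lambda>k s. P k s \<and> (k = 0 \<longrightarrow> s = ((\<lambda>i. if i = 0 then x else y), 0))" Q]
      by (metis (no_types, lifting) nat.distinct(1))
    note \<sigma> = this
    define q where "q k t = fst (\<sigma> k) (nat \<lfloor>t * 2^snd (\<sigma> k)\<rfloor>)" for k and t :: real
    have qS: "q k t \<in> S" for k t using \<sigma>(2) by (auto simp: q_def P_def)
    have qstep: "dist (q k t) (q (Suc k) t) \<le> \<epsilon>/8 * (1/2)^k" if "t \<ge> 0" for k t
    proof -
      obtain m where m: "snd (\<sigma> (Suc k)) = snd (\<sigma> k) + m"
         "\<And>j. dist (fst (\<sigma> (Suc k)) j) (fst (\<sigma> k) (j div 2^m)) < e k"
        using \<sigma>(3)[of k] by (auto simp: Q_def)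
      show ?thesis
        using m(2)[of "nat \<lfloor>t * 2^(snd (\<sigma> k) + m)\<rfloor>"] nat_floor_dyadic_div[OF that, of "snd (\<sigma> k)" m]
        by (simp add: q_def m(1) dist_commute less_imp_le e_def)
    qed
    have "\<exists>l\<in>S. \<forall>k. dist (q k t) l \<le> 2 * (\<epsilon>/8) * (1/2)^k" if "t \<ge> 0" for t
      by (rule geometric_Cauchy_limit[OF S qS qstep[OF that]])
    then obtain g where g: "\<And>t. t \<ge> 0 \<Longrightarrow> g t \<in> S" "\<And>t k. t \<ge> 0 \<Longrightarrow> dist (q k t) (g t) \<le> 2 * e k"
      unfolding e_def by (metis mult.assoc)
    \<comment> \<open>In less than one dyadic time unit the index advances by at most one, so a
      stage moves by at most one link, and \<open>D k \<le> e k\<close>.\<close>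
    have qcont: "dist (q k s) (q k t) < e k" if "0 \<le> s" "s \<le> t" "t < s + 1 / 2^snd (\<sigma> k)" for k s t
    proof -
      have "s * 2^snd (\<sigma> k) \<ge> 0" "s * 2^snd (\<sigma> k) \<le> t * 2^snd (\<sigma> k)" "t * 2^snd (\<sigma> k) < s * 2^snd (\<sigma> k) + 1"
        using that by (simp_all add: field_simps)
      note fl = floor_step_le[OF this]
      have "dist (fst (\<sigma> k) i) (fst (\<sigma> k) (Suc i)) < e k" for i
        using \<sigma>(2)[of k] D(2)[of k] by (auto simp: P_def intro: less_le_trans)
      with fl e[of k] show ?thesis
        unfolding q_def by (metis dist_self)
    qed
    have gcont: "dist (g s) (g t) < 5 * e k" if "0 \<le> s" "s \<le> t" "t < s + 1 / 2^snd (\<sigma> k)" for k s t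
    proof -
      have "dist (g s) (g t) \<le> dist (q k s) (g s) + dist (q k s) (q k t) + dist (q k t) (g t)"
        using dist_triangle[of "g s" "g t" "q k s"] dist_triangle[of "q k s" "g t" "q k t"]
        by (simp add: dist_commute)
      then show ?thesis using g(2)[of s k] g(2)[of t k] qcont[OF that] that by linarith
    qed
    have "continuous_on {0..1} g"
      unfolding continuous_on_iff
    proof (intro ballI allI impI)
      fix s r :: real assume s: "s \<in> {0..1}" and "r > 0"
      have "(\<lambda>k. 5 * e k) \<longlonglongrightarrow> 5 * (\<epsilon>/8 * 0)"
        unfolding e_def by (intro tendsto_intros LIMSEQ_power_zero) auto
      then have "\<forall>\<^sub>F k in sequentially. 5 * e k < r"
        using \<open>r > 0\<close> by (intro order_tendstoD) auto
      then obtain k where k: "5 * e k < r"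
        by (auto simp: eventually_sequentially)
      show "\<exists>d>0. \<forall>t\<in>{0..1}. dist t s < d \<longrightarrow> dist (g t) (g s) < r"
      proof (intro exI[of _ "1 / 2^snd (\<sigma> k)"] conjI ballI impI)
        fix t :: real assume t: "t \<in> {0..1}" "dist t s < 1 / 2^snd (\<sigma> k)"
        then show "dist (g t) (g s) < r"
          using gcont[of s t k] gcont[of t s k] s k by (cases "s \<le> t") (auto simp: dist_real_def dist_commute)
      qed simp
    qed
    moreover have "g 0 = x" "g 1 = y"
    proof -
      have lim: "g t = z" if "\<And>k. q k t = z" "t \<ge> 0" for t z
      proof -
        have "(\<lambda>k. 2 * e k) \<longlonglongrightarrow> 2 * (\<epsilon>/8 * 0)"
          unfolding e_def by (intro tendsto_intros LIMSEQ_power_zero) auto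
        then have "dist z (g t) \<le> 2 * (\<epsilon>/8 * 0)"
          using g(2)[OF that(2)] that(1) by (intro LIMSEQ_le_const[of "\<lambda>k. 2 * e k"]) simp_all
        then show ?thesis by simp
      qed
      show "g 0 = x" by (rule lim) (use \<sigma>(2) in \<open>auto simp: q_def P_def\<close>)
      have "nat \<lfloor>(2::real) ^ n\<rfloor> = 2^n" for n
        by (metis floor_of_nat nat_int of_nat_numeral of_nat_power)
      then show "g 1 = y" by (intro lim) (use \<sigma>(2) in \<open>auto simp: q_def P_def\<close>)
    qed
    moreover have "g t \<in> S \<inter> ball x \<epsilon>" if "t \<in> {0..1}" for t
    proof -
      have "q 0 t \<in> {x, y}" by (auto simp: q_def \<sigma>(1))
      then have "dist x (q 0 t) < e 0" using xy(3) D(2)[of 0] e[of 0] by auto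
      then have "dist x (g t) < 3 * e 0"
        using g(2)[of t 0] that dist_triangle[of x "g t" "q 0 t"] by simp
      then show ?thesis using g(1) that \<open>\<epsilon> > 0\<close> by (auto simp: e_def)
    qed
    ultimately show "\<exists>g. path g \<and> path_image g \<subseteq> S \<inter> ball x \<epsilon> \<and> pathstart g = x \<and> pathfinish g = y"
      by (intro exI[of _ g]) (auto simp: path_def path_image_def pathstart_def pathfinish_def)
  qed
qed

lemma uniformly_locally_path_connected_connected_imp_path_connected:
  assumes "uniformly_locally_path_connected S" "connected S"
  shows "path_connected S"
proof -
  have "path_component S x y" if "x \<in> S" "y \<in> S" for x y
  proof (rule connected_equivalence_relation[OF assms(2) that])
    obtain d where d: "d > 0" "\<And>x y. x \<in> S \<Longrightarrow> y \<in> S \<Longrightarrow> dist x y < d \<Longrightarrow>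
        \<exists>g. path g \<and> path_image g \<subseteq> S \<inter> ball x 1 \<and> pathstart g = x \<and> pathfinish g = y"
      using assms(1) unfolding uniformly_locally_path_connected_def by (metis zero_less_one)
    show "\<exists>T. openin (top_of_set S) T \<and> a \<in> T \<and> (\<forall>x\<in>T. path_component S a x)" if "a \<in> S" for a
      using that d
      by (intro exI[of _ "S \<inter> ball a d"])
        (auto simp: openin_open_Int path_component_def; meson le_inf_iff)
  qed (auto intro: path_component_sym path_component_trans)
  then show ?thesis by (simp add: path_connected_component)
qed

text \<open>Close points of \<open>S\<close> and \<open>T\<close> are both close to a common point
  of \<open>S \<inter> T\<close>, because counterexamples at distances tending to 0 would accumulate
  at one. The path is led through that point.\<close>

lemma uniformly_locally_path_connected_Un:
  fixes S T :: "'b::metric_space set"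
  assumes S: "compact S" "uniformly_locally_path_connected S" and T: "compact T" "uniformly_locally_path_connected T"
  shows "uniformly_locally_path_connected (S \<union> T)"
proof -
  \<comment> \<open>If \<open>S\<close> and \<open>T\<close> are disjoint, this says that they have
    positive distance.\<close>
  have *: "\<exists>d>0. \<forall>x\<in>S. \<forall>y\<in>T. dist x y < d \<longrightarrow> (\<exists>z\<in>S \<inter> T. dist x z < e \<and> dist y z < e)"
    if "e > 0" for e
  proof (rule ccontr)
    assume no: "\<not> ?thesis"
    have "\<exists>x y. x \<in> S \<and> y \<in> T \<and> dist x y < inverse (real (Suc n)) \<and>
        (\<forall>z\<in>S \<inter> T. \<not> (dist x z < e \<and> dist y z < e))" for n
      using no by (metis inverse_positive_iff_positive of_nat_0_less_iff zero_less_Suc)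
    then obtain x y where xy: "\<And>n. x n \<in> S" "\<And>n. y n \<in> T" "\<And>n. dist (x n) (y n) < inverse (real (Suc n))"
        "\<And>n z. z \<in> S \<inter> T \<Longrightarrow> \<not> (dist (x n) z < e \<and> dist (y n) z < e)"
      by metis
    obtain l r where l: "l \<in> S" "strict_mono r" "(x \<circ> r) \<longlonglongrightarrow> l"
      using S(1) xy(1) unfolding compact_def by meson
    have "(\<lambda>n. dist (x n) (y n)) \<longlonglongrightarrow> 0"
      by (rule tendsto_sandwich[OF _ _ tendsto_const LIMSEQ_inverse_real_of_nat])
        (use xy(3) in \<open>auto intro: always_eventually less_imp_le\<close>)
    then have "((\<lambda>n. dist (x n) (y n)) \<circ> r) \<longlonglongrightarrow> 0"
      by (rule LIMSEQ_subseq_LIMSEQ[OF _ l(2)])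
    then have "(\<lambda>n. dist ((x \<circ> r) n) ((y \<circ> r) n) + dist ((x \<circ> r) n) l) \<longlonglongrightarrow> 0 + 0"
      using l(3)[THEN tendsto_dist_iff[THEN iffD1]] by (intro tendsto_add) (simp_all add: comp_def)
    moreover have "dist ((y \<circ> r) n) l \<le> dist ((x \<circ> r) n) ((y \<circ> r) n) + dist ((x \<circ> r) n) l" for n
      by (metis dist_commute dist_triangle)
    ultimately have yl: "(y \<circ> r) \<longlonglongrightarrow> l"
      by (subst tendsto_dist_iff,
          intro tendsto_sandwich[of "\<lambda>_. 0" "\<lambda>n. dist ((y \<circ> r) n) l" _
            "\<lambda>n. dist ((x \<circ> r) n) ((y \<circ> r) n) + dist ((x \<circ> r) n) l"] always_eventually)
        auto
    then have "l \<in> T"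
      using closed_sequentially[OF compact_imp_closed[OF T(1)]] xy(2) by (metis comp_def)
    have "\<forall>\<^sub>F n in sequentially. dist ((x \<circ> r) n) l < e" "\<forall>\<^sub>F n in sequentially. dist ((y \<circ> r) n) l < e"
      using l(3) yl \<open>e > 0\<close> by (simp_all add: tendsto_iff)
    then have "\<forall>\<^sub>F n in sequentially. dist ((x \<circ> r) n) l < e \<and> dist ((y \<circ> r) n) l < e"
      by eventually_elim auto
    then show False
      using xy(4)[of l] l(1) \<open>l \<in> T\<close> by (auto simp: eventually_sequentially)
  qed
  show ?thesis
    unfolding uniformly_locally_path_connected_def
  proof (intro allI impI)
    fix e :: real assume "e > 0"
    let ?Q = "\<lambda>A x y. \<exists>g. path g \<and> path_image g \<subseteq> A \<inter> ball x (e/2) \<and> pathstart g = x \<and> pathfinish g = y"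
    obtain d1 where d1: "d1 > 0" "\<And>x y. x \<in> S \<Longrightarrow> y \<in> S \<Longrightarrow> dist x y < d1 \<Longrightarrow> ?Q S x y"
      using S(2)[unfolded uniformly_locally_path_connected_def, rule_format, of "e/2"] \<open>e > 0\<close> by auto
    obtain d2 where d2: "d2 > 0" "\<And>x y. x \<in> T \<Longrightarrow> y \<in> T \<Longrightarrow> dist x y < d2 \<Longrightarrow> ?Q T x y"
      using T(2)[unfolded uniformly_locally_path_connected_def, rule_format, of "e/2"] \<open>e > 0\<close> by auto
    obtain d3 where d3: "d3 > 0" "\<And>x y. x \<in> S \<Longrightarrow> y \<in> T \<Longrightarrow> dist x y < d3 \<Longrightarrow>
        \<exists>z\<in>S \<inter> T. dist x z < min d1 d2 \<and> dist y z < min d1 d2"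
      using *[of "min d1 d2"] d1(1) d2(1) by (metis min_less_iff_conj)
    have join: "\<exists>g. path g \<and> path_image g \<subseteq> (S \<union> T) \<inter> ball x e \<and> pathstart g = x \<and> pathfinish g = y"
      if q: "?Q A x z" "?Q B z y" and AB: "A \<subseteq> S \<union> T" "B \<subseteq> S \<union> T" for A B x y z
    proof -
      obtain g1 where g1: "path g1" "path_image g1 \<subseteq> A \<inter> ball x (e/2)" "pathstart g1 = x" "pathfinish g1 = z"
        using q(1) by blast
      obtain g2 where g2: "path g2" "path_image g2 \<subseteq> B \<inter> ball z (e/2)" "pathstart g2 = z" "pathfinish g2 = y"
        using q(2) by blast
      have "dist x z < e/2" using g1 by (metis Int_iff mem_ball pathfinish_in_path_image subsetD)
      have "ball z (e/2) \<subseteq> ball x e"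
      proof
        fix w assume "w \<in> ball z (e/2)"
        then show "w \<in> ball x e" using \<open>dist x z < e/2\<close> dist_triangle[of x w z] by simp
      qed
      moreover have "ball x (e/2) \<subseteq> ball x e" using \<open>e > 0\<close> by (simp add: subset_ball)
      moreover have "path_image (g1 +++ g2) = path_image g1 \<union> path_image g2"
        using g1 g2 by (simp add: path_image_join)
      ultimately have "path_image (g1 +++ g2) \<subseteq> (S \<union> T) \<inter> ball x e"
        using g1 g2 AB by blast
      then show ?thesis using g1 g2 by (intro exI[of _ "g1 +++ g2"]) auto
    qed
    have triv: "?Q A x x" if "x \<in> A" for A x
      using that \<open>e > 0\<close> by (intro exI[of _ "\<lambda>_. x"]) (auto simp: path_def path_image_def pathstart_def pathfinish_def)
    show "\<exists>d>0. \<forall>x\<in>S \<union> T. \<forall>y\<in>S \<union> T. dist x y < d \<longrightarrow>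
        (\<exists>g. path g \<and> path_image g \<subseteq> (S \<union> T) \<inter> ball x e \<and> pathstart g = x \<and> pathfinish g = y)"
    proof (intro exI[of _ "min (min d1 d2) d3"] conjI ballI impI)
      fix x y assume xy: "x \<in> S \<union> T" "y \<in> S \<union> T" "dist x y < min (min d1 d2) d3"
      consider "x \<in> S" "y \<in> S" | "x \<in> T" "y \<in> T" | "x \<in> S" "y \<in> T" | "x \<in> T" "y \<in> S"
        using xy by blast
      then show "\<exists>g. path g \<and> path_image g \<subseteq> (S \<union> T) \<inter> ball x e \<and> pathstart g = x \<and> pathfinish g = y"
      proof cases
        case 1 with xy d1(2) triv[of y S] show ?thesis by (intro join[of S x y S y]) auto
      next
        case 2 with xy d2(2) triv[of y T] show ?thesis by (intro join[of T x y T y]) auto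
      next
        case 3
        then obtain z where "z \<in> S" "z \<in> T" "dist x z < d1" "dist y z < d2" using d3(2)[OF 3] xy by auto
        with 3 d1(2) d2(2) show ?thesis by (intro join[of S x z T y]) (auto simp: dist_commute)
      next
        case 4
        then obtain z where "z \<in> S" "z \<in> T" "dist y z < d1" "dist x z < d2"
          using d3(2)[OF 4(2,1)] xy by (auto simp: dist_commute)
        with 4 d1(2) d2(2) show ?thesis by (intro join[of T x z S y]) (auto simp: dist_commute)
      qed
    qed (use d1 d2 d3 in auto)
  qed
qed

subsection \<open>An open interval with two compact ends\<close>

lemma first_hit:
  fixes g :: "real \<Rightarrow> 'b::topological_space"
  assumes "continuous_on {a..b} g" "closed C" "t \<in> {a..b}" "g t \<in> C"
  obtains u where "u \<in> {a..b}" "g u \<in> C" "\<And>s. a \<le> s \<Longrightarrow> s < u \<Longrightarrow> g s \<notin> C"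
proof -
  have "compact ({a..b} \<inter> g -` C)"
    using compact_Int_closed[OF compact_Icc continuous_closed_preimage[OF assms(1) _ assms(2)], of a b]
    by (simp add: Int_absorb1)
  then obtain u where u: "u \<in> {a..b} \<inter> g -` C" "\<And>s. s \<in> {a..b} \<inter> g -` C \<Longrightarrow> u \<le> s"
    using compact_attains_inf[of "{a..b} \<inter> g -` C"] assms(3,4) by blast
  show thesis
    using u by (intro that[of u]) force+
qed

text \<open>A member of the class C seen in a metric space, with a coordinate \<open>k\<close> on
  the free interval. \<open>limit_L\<close> and \<open>limit_R\<close> say that \<open>L\<close> and
  \<open>R\<close> are the remainders of the two tails. \<open>L\<close> and \<open>R\<close> may
  meet, and either may be a point.\<close>

locale two_ended_interval =
  fixes L R :: "'b::metric_space set" and h :: "real \<Rightarrow> 'b" and k :: "'b \<Rightarrow> real"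
  assumes compact_L: "compact L" and L_nonempty: "L \<noteq> {}"
    and compact_R: "compact R" and R_nonempty: "R \<noteq> {}"
    and hk: "homeomorphism {0<..<1} (h ` {0<..<1}) h k"
    and disjoint_L: "L \<inter> h ` {0<..<1} = {}" and disjoint_R: "R \<inter> h ` {0<..<1} = {}"
    and compact_X: "compact (L \<union> h ` {0<..<1} \<union> R)"
    and limit_L: "\<exists>a. 0 < a \<and> a < 1 \<and> closure (h ` {0<..a}) = L \<union> h ` {0<..a}"
    and limit_R: "\<exists>a. 0 < a \<and> a < 1 \<and> closure (h ` {a..<1}) = R \<union> h ` {a..<1}"
begin

abbreviation J where "J \<equiv> h ` {0<..<1}"
abbreviation X where "X \<equiv> L \<union> J \<union> R"

lemma k_h [simp]: "0 < t \<Longrightarrow> t < 1 \<Longrightarrow> k (h t) = t"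
  using hk by (auto simp: homeomorphism_def)

lemma h_k: "x \<in> J \<Longrightarrow> h (k x) = x"
  using hk by (auto simp: homeomorphism_def)

lemma k_in: "x \<in> J \<Longrightarrow> 0 < k x" "x \<in> J \<Longrightarrow> k x < 1"
  using hk by auto

lemma continuous_h: "continuous_on {0<..<1} h" and continuous_k: "continuous_on J k"
  using hk by (auto simp: homeomorphism_def)

lemma h_eq_iff: "0 < s \<Longrightarrow> s < 1 \<Longrightarrow> 0 < t \<Longrightarrow> t < 1 \<Longrightarrow> h s = h t \<longleftrightarrow> s = t"
  by (metis k_h)

lemma h_notin: "0 < t \<Longrightarrow> t < 1 \<Longrightarrow> h t \<notin> L" "0 < t \<Longrightarrow> t < 1 \<Longrightarrow> h t \<notin> R"
  using disjoint_L disjoint_R by auto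

lemma h_mem_image:
  assumes "0 < t" "t < 1" "A \<subseteq> {0<..<1}" shows "h t \<in> h ` A \<longleftrightarrow> t \<in> A"
proof
  assume "h t \<in> h ` A"
  then obtain s where "s \<in> A" "h t = h s" by auto
  then show "t \<in> A" using assms h_eq_iff[of t s] by auto
qed auto

text \<open>Reversing the parameter exchanges the ends, so whatever is proved about \<open>L\<close>
  holds for \<open>R\<close> as well.\<close>

lemma flip: "two_ended_interval R L (\<lambda>t. h (1 - t)) (\<lambda>x. 1 - k x)"
proof -
  have fl: "(\<lambda>t. h (1 - t)) ` A = h ` ((-) 1 ` A)" for A
    by (simp add: image_image)
  have oo: "(-) 1 ` {0<..<1::real} = {0<..<1}"
    and oc: "(-) 1 ` {0<..a} = {1-a..<1::real}" and co: "(-) 1 ` {a..<1} = {0<..1-a}" for a :: real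
    by (auto intro!: image_eqI[of _ "(-) 1" "1 - _"])
  have "homeomorphism {0<..<1} {0<..<1} (\<lambda>t::real. 1 - t) (\<lambda>t. 1 - t)"
    unfolding homeomorphism_def by (auto simp: oo intro!: continuous_intros)
  then have "homeomorphism {0<..<1} J (h \<circ> (\<lambda>t. 1 - t)) ((\<lambda>t. 1 - t) \<circ> k)"
    using hk by (rule homeomorphism_compose)
  then have 1: "homeomorphism {0<..<1} J (\<lambda>t. h (1 - t)) (\<lambda>x. 1 - k x)"
    by (simp add: comp_def)
  obtain a b where a: "0 < a" "a < 1" "closure (h ` {0<..a}) = L \<union> h ` {0<..a}"
    and b: "0 < b" "b < 1" "closure (h ` {b..<1}) = R \<union> h ` {b..<1}"
    using limit_L limit_R by blast
  have eq: "R \<union> J \<union> L = X" by auto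
  show ?thesis
  proof (unfold_locales, unfold fl oo oc co eq)
    show "\<exists>c>0. c < 1 \<and> closure (h ` {1 - c..<1}) = R \<union> h ` {1 - c..<1}"
      using b by (intro exI[of _ "1 - b"]) simp
    show "\<exists>c>0. c < 1 \<and> closure (h ` {0<..1 - c}) = L \<union> h ` {0<..1 - c}"
      using a by (intro exI[of _ "1 - a"]) simp
  qed (fact compact_L L_nonempty compact_R R_nonempty 1 disjoint_L disjoint_R compact_X)+
qed

section \<open>Closures and limit points of the tails of \<open>J\<close>\<close>

lemma closed_LR: "closed L" "closed R" "closed (L \<union> R)"
  using compact_L compact_R by (auto intro: compact_imp_closed)

lemma compact_segment: "0 < a \<Longrightarrow> b < 1 \<Longrightarrow> compact (h ` {a..b})"
  by (rule compact_continuous_image[OF continuous_on_subset[OF continuous_h]]) auto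

lemma closed_segment_image: "0 < a \<Longrightarrow> b < 1 \<Longrightarrow> closed (h ` {a..b})"
  by (simp add: compact_segment compact_imp_closed)

lemma closedin_J_image:
  assumes "closedin (top_of_set {0<..<1}) A" shows "closure (h ` A) \<inter> J = h ` A"
proof -
  have "closedin (top_of_set J) (h ` A)"
    using homeomorphism_imp_closed_map[OF hk assms] .
  then obtain T where T: "closed T" "h ` A = J \<inter> T"
    by (auto simp: closedin_closed)
  then have "closure (h ` A) \<subseteq> T" by (simp add: closure_minimal)
  then show ?thesis using T(2) closure_subset[of "h ` A"] by blast
qed

text \<open>Two tails differ by a compact piece of \<open>J\<close>, which contributes no point of
  \<open>L\<close> to the closure; so the one tail given by \<open>limit_L\<close> determines all of
  them.\<close>

lemma closure_left:
  assumes "0 < a" "a < 1"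
  shows "closure (h ` {0<..a}) = L \<union> h ` {0<..a}"
proof -
  obtain b where b: "0 < b" "b < 1" "closure (h ` {0<..b}) = L \<union> h ` {0<..b}"
    using limit_L by blast
  show ?thesis
  proof (cases "a \<le> b")
    case True
    have "{0<..a} = {0<..<1} \<inter> {..a}" using assms by auto
    then have "closure (h ` {0<..a}) \<inter> J = h ` {0<..a}"
      by (intro closedin_J_image) (auto simp: closedin_closed)
    moreover have "closure (h ` {0<..a}) \<subseteq> closure (h ` {0<..b})"
      using True by (intro closure_mono image_mono) auto
    ultimately have 1: "closure (h ` {0<..a}) \<subseteq> L \<union> h ` {0<..a}"
      using b by (auto simp: subset_iff image_iff) (metis (no_types, lifting) IntI greaterThanLessThan_iff
          imageE imageI greaterThanAtMost_iff le_less_trans)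
    have "{0<..b} = {0<..a} \<union> {a..b}" using True assms by auto
    then have "closure (h ` {0<..b}) = closure (h ` {0<..a}) \<union> h ` {a..b}"
      using closed_segment_image[of a b] assms b by (simp add: image_Un)
    moreover have "h ` {a..b} \<subseteq> J" using assms b by auto
    ultimately have "L \<subseteq> closure (h ` {0<..a})" using b(3) disjoint_L by blast
    then show ?thesis using 1 closure_subset by blast
  next
    case False
    have "{0<..a} = {0<..b} \<union> {b..a}" using False b by auto
    then show ?thesis
      using closed_segment_image[of b a] assms b by (simp add: image_Un Un_assoc)
  qed
qed

lemma closed_left: "0 < a \<Longrightarrow> a < 1 \<Longrightarrow> closed (L \<union> h ` {0<..a})"
  using closure_left by (metis closed_closure)

lemma closure_right:
  assumes "0 < a" "a < 1"
  shows "closure (h ` {a..<1}) = R \<union> h ` {a..<1}"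
proof -
  interpret F: two_ended_interval R L "\<lambda>t. h (1 - t)" "\<lambda>x. 1 - k x" by (rule flip)
  have "(\<lambda>t. h (1 - t)) ` {0<..1-a} = h ` {a..<1}"
    by (auto simp: image_iff intro!: bexI[of _ "1 - _"])
  then show ?thesis using F.closure_left[of "1 - a"] assms by simp
qed

lemma closed_right: "0 < a \<Longrightarrow> a < 1 \<Longrightarrow> closed (R \<union> h ` {a..<1})"
  using closure_right by (metis closed_closure)

text \<open>The limit lies in the closure of every left tail, and these closures intersect in
  \<open>L\<close>.\<close>

lemma limit_left_in_L:
  assumes t: "\<And>n. 0 < t n \<and> t n < 1" "t \<longlonglongrightarrow> 0" and x: "(\<lambda>n. h (t n)) \<longlonglongrightarrow> x"
  shows "x \<in> L"
proof -
  have *: "x \<in> L \<union> h ` {0<..a}" if "0 < a" "a < 1" for a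
  proof (rule Lim_in_closed_set[OF closed_left[OF that] _ _ x])
    have "\<forall>\<^sub>F n in sequentially. t n < a" using t(2) that by (intro order_tendstoD)
    then show "\<forall>\<^sub>F n in sequentially. h (t n) \<in> L \<union> h ` {0<..a}"
      by eventually_elim (use t(1) in \<open>auto intro!: imageI\<close>)
  qed simp
  show ?thesis
  proof (rule ccontr)
    assume "x \<notin> L"
    then obtain s where s: "0 < s" "s \<le> 1/2" "x = h s" using *[of "1/2"] by auto
    then have "h s \<in> h ` {0<..s/2}" using *[of "s/2"] \<open>x \<notin> L\<close> by auto
    moreover have "h s \<in> h ` {0<..s/2} \<longleftrightarrow> s \<in> {0<..s/2}"
      using s by (intro h_mem_image) auto
    ultimately show False using s by auto
  qed
qed

text \<open>Otherwise parameters tending to 0 would give points that stay \<open>\<epsilon>\<close>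
  away from \<open>L\<close>; by compactness of \<open>X\<close> they accumulate somewhere, and that
  must be in \<open>L\<close>.\<close>

lemma near_left:
  assumes "\<epsilon> > 0"
  obtains c where "0 < c" "c < 1" "\<And>t. 0 < t \<Longrightarrow> t < c \<Longrightarrow> \<exists>l\<in>L. dist (h t) l < \<epsilon>"
proof (rule ccontr)
  assume no: "\<not> thesis"
  have "\<exists>t. 0 < t \<and> t < 1 \<and> t < inverse (real (Suc n)) \<and> (\<forall>l\<in>L. \<not> dist (h t) l < \<epsilon>)" for n
  proof -
    have "inverse (real (Suc (Suc n))) < 1" "inverse (real (Suc (Suc n))) < inverse (real (Suc n))"
      by (auto simp: field_simps)
    moreover have "\<exists>t. 0 < t \<and> t < inverse (real (Suc (Suc n))) \<and> (\<forall>l\<in>L. \<not> dist (h t) l < \<epsilon>)"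
      using no that[of "inverse (real (Suc (Suc n)))"] calculation
      by (metis inverse_positive_iff_positive of_nat_0_less_iff zero_less_Suc)
    ultimately show ?thesis by (meson less_trans)
  qed
  then obtain t where t: "\<And>n. 0 < t n \<and> t n < 1" "\<And>n. t n < inverse (real (Suc n))"
      "\<And>n l. l \<in> L \<Longrightarrow> \<not> dist (h (t n)) l < \<epsilon>"
    by metis
  have "h (t n) \<in> X" for n using t(1) by auto
  then obtain x r where r: "strict_mono r" "((\<lambda>n. h (t n)) \<circ> r) \<longlonglongrightarrow> x"
    using compact_X unfolding compact_def by meson
  have "t \<longlonglongrightarrow> 0"
    by (rule tendsto_sandwich[OF _ _ tendsto_const LIMSEQ_inverse_real_of_nat])
      (use t in \<open>auto intro!: always_eventually less_imp_le\<close>)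
  then have "(t \<circ> r) \<longlonglongrightarrow> 0" by (rule LIMSEQ_subseq_LIMSEQ[OF _ r(1)])
  then have "x \<in> L"
    using limit_left_in_L[of "t \<circ> r" x] t(1) r(2) by (simp add: comp_def)
  moreover have "\<forall>\<^sub>F n in sequentially. dist (h (t (r n))) x < \<epsilon>"
    using r(2) assms by (simp add: tendsto_iff)
  ultimately show False using t(3) by (auto simp: eventually_sequentially)
qed

lemma avoid_left:
  assumes "closed C" "C \<inter> L = {}"
  obtains c where "0 < c" "c < 1" "C \<inter> h ` {0<..<c} = {}"
proof -
  \<comment> \<open>A Lebesgue number of the cover by the single open set \<open>- C\<close> is a
    positive lower bound for the distance between \<open>L\<close> and \<open>C\<close>.\<close>
  obtain d where d: "d > 0" "\<And>x. x \<in> L \<Longrightarrow> \<exists>G\<in>{- C}. ball x d \<subseteq> G"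
    by (rule Heine_Borel_lemma[OF compact_L, of "{- C}"]) (use assms in auto)
  obtain c where c: "0 < c" "c < 1" "\<And>t. 0 < t \<Longrightarrow> t < c \<Longrightarrow> \<exists>l\<in>L. dist (h t) l < d"
    using near_left[OF d(1)] by blast
  have "h t \<notin> C" if t: "0 < t" "t < c" for t
  proof -
    obtain l where "l \<in> L" "h t \<in> ball l d" using c(3)[OF t] by (auto simp: dist_commute)
    then show ?thesis using d(2)[of l] by auto
  qed
  with c show thesis by (intro that[of c]) auto
qed

text \<open>If both alternatives fail, the piece of the path is trapped in a compact segment of \<open>J\<close>.\<close>

lemma exit_sweeps_end:
  fixes g :: "real \<Rightarrow> 'b"
  assumes g: "continuous_on {s..u} g" "g ` {s..<u} \<subseteq> J" "g u \<notin> J" and "s < u"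
  shows "h ` {0<..k (g s)} \<subseteq> g ` {s..<u} \<or> h ` {k (g s)..<1} \<subseteq> g ` {s..<u}"
proof (rule ccontr)
  assume "\<not> ?thesis"
  then obtain c b where cb: "0 < c" "c \<le> k (g s)" "h c \<notin> g ` {s..<u}" "k (g s) \<le> b" "b < 1" "h b \<notin> g ` {s..<u}"
    unfolding de_Morgan_disj image_subset_iff by (meson atLeastLessThan_iff greaterThanAtMost_iff)
  let ?K = "k ` g ` {s..<u}"
  have "connected ?K"
    by (intro connected_continuous_image continuous_on_subset[OF g(1)]
        continuous_on_subset[OF continuous_k g(2)]) auto
  have "k (g s) \<in> ?K" using \<open>s < u\<close> by auto
  have out: "h y \<in> g ` {s..<u}" if "y \<in> ?K" for y
    using that g(2) h_k by auto
  have "?K \<subseteq> {c..b}"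
  proof
    fix y assume y: "y \<in> ?K"
    have "c \<le> y" using connected_contains_Icc[OF \<open>connected ?K\<close> y \<open>k (g s) \<in> ?K\<close>] cb out
      by (meson atLeastAtMost_iff linear subsetD)
    moreover have "y \<le> b" using connected_contains_Icc[OF \<open>connected ?K\<close> \<open>k (g s) \<in> ?K\<close> y] cb out
      by (meson atLeastAtMost_iff linear subsetD)
    ultimately show "y \<in> {c..b}" by simp
  qed
  have "g ` {s..<u} \<subseteq> h ` {c..b}"
  proof
    fix x assume x: "x \<in> g ` {s..<u}"
    have "h (k x) = x" by (rule h_k[OF subsetD[OF g(2) x]])
    moreover have "k x \<in> {c..b}"
      by (rule subsetD[OF \<open>?K \<subseteq> {c..b}\<close> imageI[OF x, of k]])
    ultimately show "x \<in> h ` {c..b}" by (metis imageI)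
  qed
  \<comment> \<open>The segment is closed, so the trapped path cannot leave it at the final time
    \<open>u\<close> either.\<close>
  moreover have "closure {s..<u} = {s..u}" using \<open>s < u\<close> by simp
  ultimately have "g ` {s..u} \<subseteq> h ` {c..b}"
    using image_closure_subset[of "{s..<u}" g "h ` {c..b}"] g(1) cb closed_segment_image[of c b] by simp
  then have "g u \<in> h ` {c..b}" using \<open>s < u\<close> by auto
  with g(3) show False using cb by auto
qed

text \<open>By continuity \<open>g\<close> is close to \<open>g u\<close> just before
  \<open>u\<close>, yet its image there still accumulates at every point of \<open>K\<close>.
  Applied to a swept tail, whose closure contains its remainder, this shows that the remainder is a
  point.\<close>

lemma sweeping_forces_point:
  fixes g :: "real \<Rightarrow> 'b"
  assumes g: "continuous_on {s..u} g" and "s < u"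
    and "K \<noteq> {}" "\<And>r. s \<le> r \<Longrightarrow> r < u \<Longrightarrow> K \<subseteq> closure (g ` {r..<u})"
  shows "K = {g u}"
proof -
  have "x = g u" if "x \<in> K" for x
  proof (rule ccontr)
    assume "x \<noteq> g u"
    define e where "e = dist x (g u) / 2"
    have e: "e > 0" using \<open>x \<noteq> g u\<close> by (simp add: e_def)
    with g \<open>s < u\<close> obtain d where d: "d > 0" "\<And>y. y \<in> {s..u} \<Longrightarrow> dist y u < d \<Longrightarrow> dist (g y) (g u) < e"
      unfolding continuous_on_iff by (metis atLeastAtMost_iff less_imp_le order_refl)
    define r where "r = max s (u - d/2)"
    have r: "s \<le> r" "r < u" using d(1) \<open>s < u\<close> by (auto simp: r_def)
    have "dist (g u) (g y) \<le> e" if "y \<in> {r..<u}" for y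
    proof -
      have "dist y u < d" "y \<in> {s..u}" using that d(1) r(1) by (auto simp: r_def dist_real_def)
      then show ?thesis using d(2)[of y] by (simp add: dist_commute)
    qed
    then have "g ` {r..<u} \<subseteq> cball (g u) e" by auto
    then have "closure (g ` {r..<u}) \<subseteq> cball (g u) e" by (simp add: closure_minimal)
    then have "dist (g u) x \<le> e" using assms(4)[OF r] that by auto
    then show False using e by (simp add: e_def dist_commute)
  qed
  with \<open>K \<noteq> {}\<close> show ?thesis by auto
qed

text \<open>For each starting time \<open>r\<close> the path sweeps the left or the right end, but
  \<open>sweeping_forces_point\<close> needs one end for all \<open>r\<close>. Sweeping an end from
  a later time implies sweeping it from an earlier one. So if the left end fails at
  \<open>r0\<close>, the right end is swept from all later times, and hence from all times.\<close>

lemma exit_end: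
  fixes g :: "real \<Rightarrow> 'b"
  assumes g: "continuous_on {s..u} g" "g ` {s..<u} \<subseteq> J" "g u \<notin> J" and "s < u"
  shows "L = {g u} \<and> h ` {0<..k (g s)} \<subseteq> g ` {s..<u} \<or> R = {g u} \<and> h ` {k (g s)..<1} \<subseteq> g ` {s..<u}"
proof -
  let ?A = "\<lambda>r. h ` {0<..k (g r)} \<subseteq> g ` {r..<u}"
  let ?B = "\<lambda>r. h ` {k (g r)..<1} \<subseteq> g ` {r..<u}"
  have AB: "?A r \<or> ?B r" if "s \<le> r" "r < u" for r
    by (rule exit_sweeps_end) (use g that in \<open>auto intro: continuous_on_subset\<close>)
  have kg: "0 < k (g r) \<and> k (g r) < 1 \<and> h (k (g r)) = g r" if "s \<le> r" "r < u" for r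
  proof -
    have "g r \<in> J" using that g(2) by auto
    then show ?thesis using k_in h_k by blast
  qed
  \<comment> \<open>Intermediate values: between times \<open>p\<close> and \<open>q\<close> the
    path passes every point of \<open>J\<close> lying between its two positions.\<close>
  have between: "h y \<in> g ` {p..<u}" if "s \<le> p" "p \<le> q" "q < u"
      "(k (g p) \<le> y \<and> y \<le> k (g q)) \<or> (k (g q) \<le> y \<and> y \<le> k (g p))" for p q y
  proof -
    have sub: "g ` {p..q} \<subseteq> J" using that g(2) by force
    have "connected (k ` g ` {p..q})"
      using continuous_on_subset[OF g(1), of "{p..q}"] continuous_on_subset[OF continuous_k sub] that
      by (intro connected_continuous_image) auto
    moreover have "k (g p) \<in> k ` g ` {p..q}" "k (g q) \<in> k ` g ` {p..q}" using that by auto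
    ultimately have "y \<in> k ` g ` {p..q}"
      using that(4) connected_contains_Icc[of "k ` g ` {p..q}"] by (meson atLeastAtMost_iff subsetD)
    then obtain z where "z \<in> {p..q}" "y = k (g z)" by auto
    then show ?thesis using kg[of z] that by auto
  qed
  have Amono: "?A p" if "s \<le> p" "p \<le> q" "q < u" "?A q" for p q
  proof
    fix x assume "x \<in> h ` {0<..k (g p)}"
    then obtain y where y: "x = h y" "0 < y" "y \<le> k (g p)" by auto
    show "x \<in> g ` {p..<u}"
    proof (cases "y \<le> k (g q)")
      case True
      then have "x \<in> g ` {q..<u}" using that(4) y by auto
      then show ?thesis using that(2) by auto
    next
      case False
      then show ?thesis using between[OF that(1-3)] y by auto
    qed
  qed
  have Bmono: "?B p" if "s \<le> p" "p \<le> q" "q < u" "?B q" for p q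
  proof
    fix x assume "x \<in> h ` {k (g p)..<1}"
    then obtain y where y: "x = h y" "y < 1" "k (g p) \<le> y" by auto
    show "x \<in> g ` {p..<u}"
    proof (cases "k (g q) \<le> y")
      case True
      then have "x \<in> g ` {q..<u}" using that(4) y by auto
      then show ?thesis using that(2) by auto
    next
      case False
      then show ?thesis using between[OF that(1-3)] y by auto
    qed
  qed
  show ?thesis
  proof (cases "\<forall>r. s \<le> r \<and> r < u \<longrightarrow> ?A r")
    case True
    have "L = {g u}"
    proof (rule sweeping_forces_point[OF g(1) \<open>s < u\<close> L_nonempty])
      fix r assume r: "s \<le> r" "r < u"
      then have "closure (h ` {0<..k (g r)}) \<subseteq> closure (g ` {r..<u})"
        using True by (intro closure_mono) auto
      then show "L \<subseteq> closure (g ` {r..<u})" using closure_left kg[OF r] by auto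
    qed
    then show ?thesis using True \<open>s < u\<close> by auto
  next
    case False
    then obtain r0 where r0: "s \<le> r0" "r0 < u" "\<not> ?A r0" by auto
    have B: "?B r" if "s \<le> r" "r < u" for r
    proof (cases "r0 \<le> r")
      case True
      then show ?thesis using AB[OF that] Amono[of r0 r] r0 that by blast
    next
      case False
      then show ?thesis using AB[of r0] Bmono[of r r0] r0 that by auto
    qed
    have "R = {g u}"
    proof (rule sweeping_forces_point[OF g(1) \<open>s < u\<close> R_nonempty])
      fix r assume r: "s \<le> r" "r < u"
      then have "closure (h ` {k (g r)..<1}) \<subseteq> closure (g ` {r..<u})"
        using B by (intro closure_mono) auto
      then show "R \<subseteq> closure (g ` {r..<u})" using closure_right kg[OF r] by auto
    qed
    then show ?thesis using B \<open>s < u\<close> by auto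
  qed
qed

section \<open>Path components of \<open>X\<close> and crossing arguments\<close>

text \<open>Cutting the path at its first hit of the closed set \<open>L \<union> R\<close> leaves a
  piece in \<open>J\<close> to which \<open>exit_end\<close> applies. The swept tail is recorded
  because later arguments ask which points of \<open>J\<close> lie on the path.\<close>

lemma path_leaves_J:
  assumes g: "path g" "path_image g \<subseteq> X" "pathstart g = h t" "0 < t" "t < 1"
    and x: "x \<in> path_image g" "x \<notin> J"
  shows "\<exists>y\<in>path_image g. L = {y} \<and> h ` {0<..t} \<subseteq> path_image g \<or> R = {y} \<and> h ` {t..<1} \<subseteq> path_image g"
proof -
  obtain v where v: "v \<in> {0..1}" "g v = x" using x by (auto simp: path_image_def)
  have gX: "g s \<in> X" if "s \<in> {0..1}" for s
    using subsetD[OF g(2) imageI[OF that, of g, folded path_image_def]] .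
  have "g v \<in> L \<union> R" using gX[OF v(1)] x v by auto
  then obtain u where u: "u \<in> {0..1}" "g u \<in> L \<union> R" "\<And>s. 0 \<le> s \<Longrightarrow> s < u \<Longrightarrow> g s \<notin> L \<union> R"
    using first_hit[of 0 1 g "L \<union> R" v] g(1) closed_LR v(1) unfolding path_def by blast
  have g0: "g 0 = h t" using g(3) by (simp add: pathstart_def)
  have "u \<noteq> 0" using u(2) g0 h_notin g(4,5) by auto
  then have "0 < u" using u(1) by auto
  have "g s \<in> J" if "s \<in> {0..<u}" for s
  proof -
    have "s \<in> {0..1}" "0 \<le> s" "s < u" using u(1) that by auto
    then show ?thesis using u(3)[of s] gX[of s] by blast
  qed
  moreover have "g u \<notin> J" using u(2) disjoint_L disjoint_R by auto
  moreover have "continuous_on {0..u} g"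
    using g(1) u(1) unfolding path_def by (auto intro: continuous_on_subset)
  ultimately have "L = {g u} \<and> h ` {0<..k (g 0)} \<subseteq> g ` {0..<u} \<or> R = {g u} \<and> h ` {k (g 0)..<1} \<subseteq> g ` {0..<u}"
    using \<open>0 < u\<close> by (intro exit_end) auto
  moreover have "g ` {0..<u} \<subseteq> path_image g" "g u \<in> path_image g"
    using u(1) by (auto simp: path_image_def)
  moreover have "k (g 0) = t" using g0 g(4,5) by simp
  ultimately show ?thesis by (metis subset_trans)
qed

lemma path_connected_J_or_ends:
  assumes "nondegenerate L" "nondegenerate R" "path_connected S" "S \<subseteq> X"
  shows "S \<subseteq> J \<or> S \<subseteq> L \<union> R"
proof (rule ccontr)
  assume "\<not> ?thesis"
  then obtain x y where xy: "x \<in> S" "x \<in> J" "y \<in> S" "y \<notin> J" using assms(4) by blast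
  then obtain g where g: "path g" "path_image g \<subseteq> S" "pathstart g = x" "pathfinish g = y"
    using assms(3) unfolding path_connected_def by meson
  from xy obtain t where t: "0 < t" "t < 1" "x = h t" by auto
  have "y \<in> path_image g" using g by auto
  then obtain z where "L = {z} \<or> R = {z}"
    using path_leaves_J[of g t y] g xy t assms(4) by blast
  then show False using assms(1,2) by (auto simp: nondegenerate_def)
qed

text \<open>A path towards \<open>L\<close> may visit \<open>R\<close> before, so its first exit
  from \<open>J\<close> is not informative. Instead the last moments before the first hit of
  \<open>L\<close> are used: \<open>R\<close> is closed and misses that point, so there the path
  runs inside \<open>J\<close>.\<close>

lemma path_connected_avoids_L:
  assumes "nondegenerate L" "L \<inter> R = {}" "path_connected S" "S \<subseteq> X"
  shows "S \<subseteq> L \<or> S \<subseteq> J \<union> R"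
proof (rule ccontr)
  assume "\<not> ?thesis"
  then obtain x y where xy: "x \<in> S" "x \<notin> L" "y \<in> S" "y \<in> L" using assms(4) by blast
  then obtain g where g: "path g" "path_image g \<subseteq> S" "pathstart g = x" "pathfinish g = y"
    using assms(3) unfolding path_connected_def by meson
  have g01: "g 0 = x" "g 1 = y" using g by (auto simp: pathstart_def pathfinish_def)
  have cont: "continuous_on {0..1} g" using g(1) by (simp add: path_def)
  obtain u where u: "u \<in> {0..1}" "g u \<in> L" "\<And>s. 0 \<le> s \<Longrightarrow> s < u \<Longrightarrow> g s \<notin> L"
    using first_hit[OF cont closed_LR(1), of 1] g01 xy by auto
  have "u \<noteq> 0" using u(2) g01 xy by auto
  then have "0 < u" using u(1) by auto
  have "open (- R)" "g u \<in> - R" using closed_LR u(2) assms(2) by auto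
  then obtain d where d: "d > 0" "\<And>s. s \<in> {0..1} \<Longrightarrow> dist s u < d \<Longrightarrow> g s \<in> - R"
    using cont u(1) unfolding continuous_on_iff open_dist by metis
  define s where "s = max 0 (u - d/2)"
  have s: "0 \<le> s" "s < u" using \<open>0 < u\<close> d(1) by (auto simp: s_def)
  have "g r \<in> J" if "r \<in> {s..<u}" for r
  proof -
    have "r \<in> {0..1}" "r < u" "0 \<le> r" using that s u(1) by auto
    moreover have "dist r u < d" using that d(1) by (auto simp: s_def dist_real_def)
    moreover have "g r \<in> X"
      using subsetD[OF g(2) imageI[OF \<open>r \<in> {0..1}\<close>, of g, folded path_image_def]] assms(4) by blast
    ultimately show ?thesis using d(2)[of r] u(3)[of r] by auto
  qed
  moreover have "g u \<notin> J" using u(2) disjoint_L by auto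
  moreover have "continuous_on {s..u} g"
    using s u(1) by (intro continuous_on_subset[OF cont]) auto
  ultimately have "L = {g u} \<or> R = {g u}"
    using exit_end[of s u g] s by blast
  then show False using u(2) assms(1,2) by (auto simp: nondegenerate_def)
qed

text \<open>Inside \<open>J\<close> this is the intermediate value theorem for \<open>k\<close>. A
  path that leaves \<open>J\<close> cannot do so through the nondegenerate left end, so it sweeps
  everything to the right of \<open>h t\<close>, in particular \<open>h c\<close>.\<close>

lemma path_crosses:
  assumes "nondegenerate L" and g: "path g" "path_image g \<subseteq> X" "pathstart g = h t" "0 < t" "t < c" "c < 1"
    and x: "x \<in> path_image g" "x \<notin> h ` {0<..<c}"
  shows "h c \<in> path_image g"
proof (cases "path_image g \<subseteq> J")
  case True
  have "connected (k ` path_image g)"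
    using g(1) continuous_on_subset[OF continuous_k True]
    by (intro connected_continuous_image connected_path_image)
  moreover have "t \<in> k ` path_image g"
    using g by (metis image_eqI k_h less_trans pathstart_in_path_image)
  moreover have "k x \<in> k ` path_image g" using x by auto
  moreover have "c \<le> k x"
  proof (rule ccontr)
    assume "\<not> c \<le> k x"
    moreover have "x \<in> J" using x True by auto
    ultimately show False using x(2) k_in[of x] h_k[of x] by (metis greaterThanLessThan_iff imageI not_le)
  qed
  ultimately have "c \<in> k ` path_image g"
    using connected_contains_Icc[of "k ` path_image g" t "k x"] g(5) by auto
  then obtain z where z: "z \<in> path_image g" "c = k z" by auto
  moreover have "h (k z) = z" using z True by (intro h_k) auto
  ultimately show ?thesis by simp
next
  case False
  then obtain x where "x \<in> path_image g" "x \<notin> J" by auto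
  then obtain y where "L = {y} \<or> h ` {t..<1} \<subseteq> path_image g"
    using path_leaves_J[of g t x] g by auto
  then show ?thesis using assms(1) g by (auto simp: nondegenerate_def)
qed

text \<open>A short path in \<open>K\<close> would be mapped to a short path which runs from deep inside the left end
  of \<open>J\<close> to \<open>L\<close>; but such a path has to cross the segment from \<open>h (1/2)\<close> to \<open>h (3/4)\<close>.\<close>

lemma uniformly_locally_path_connected_image_misses_left_end:
  fixes f :: "'c::metric_space \<Rightarrow> 'b"
  assumes "nondegenerate L" and K: "compact K" "uniformly_locally_path_connected K" and f: "continuous_on K f" "f ` K \<subseteq> X"
  obtains c where "0 < c" "c < 1" "f ` K \<inter> h ` {0<..<c} = {}"
proof (rule ccontr)
  assume no: "\<not> thesis"
  have "\<exists>x t. x \<in> K \<and> 0 < t \<and> t < 1/2 \<and> t < inverse (real (Suc n)) \<and> f x = h t" for n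
  proof -
    have "f ` K \<inter> h ` {0<..<min (1/2) (inverse (real (Suc n)))} \<noteq> {}"
      using no that[of "min (1/2) (inverse (real (Suc n)))"] by force
    then obtain y where "y \<in> f ` K" "y \<in> h ` {0<..<min (1/2) (inverse (real (Suc n)))}" by blast
    then show ?thesis by (auto 4 4)
  qed
  then obtain x t where xt: "\<And>n. x n \<in> K" "\<And>n. 0 < t n" "\<And>n. t n < 1/2" "\<And>n. t n < inverse (real (Suc n))"
      "\<And>n. f (x n) = h (t n)"
    by metis
  obtain z r where r: "z \<in> K" "strict_mono r" "(x \<circ> r) \<longlonglongrightarrow> z"
    using K(1) xt(1) unfolding compact_def by meson
  have "t \<longlonglongrightarrow> 0"
    by (rule tendsto_sandwich[OF _ _ tendsto_const LIMSEQ_inverse_real_of_nat])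
      (use xt in \<open>auto intro!: always_eventually less_imp_le\<close>)
  then have tr: "(t \<circ> r) \<longlonglongrightarrow> 0" by (rule LIMSEQ_subseq_LIMSEQ[OF _ r(2)])
  have "(f \<circ> (x \<circ> r)) \<longlonglongrightarrow> f z"
    using f(1) r xt(1) unfolding continuous_on_sequentially by auto
  then have "(\<lambda>n. h ((t \<circ> r) n)) \<longlonglongrightarrow> f z"
    by (simp add: comp_def xt(5))
  moreover have "0 < (t \<circ> r) n \<and> (t \<circ> r) n < 1" for n
    using xt(2,3)[of "r n"] by auto
  ultimately have "f z \<in> L" using tr by (intro limit_left_in_L[of "t \<circ> r"])
  define e where "e = dist (h (1/2)) (h (3/4))"
  have "e > 0" using h_eq_iff[of "1/2" "3/4"] by (simp add: e_def)
  then obtain d where d: "d > 0" "\<And>y. y \<in> K \<Longrightarrow> dist y z < d \<Longrightarrow> dist (f y) (f z) < e/2"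
    using f(1) r(1) unfolding continuous_on_iff by (meson half_gt_zero)
  obtain \<delta> where \<delta>: "\<delta> > 0" "\<And>y. y \<in> K \<Longrightarrow> dist z y < \<delta> \<Longrightarrow>
      \<exists>g. path g \<and> path_image g \<subseteq> K \<inter> ball z d \<and> pathstart g = z \<and> pathfinish g = y"
    using K(2) d(1) r(1) unfolding uniformly_locally_path_connected_def by meson
  have "\<forall>\<^sub>F n in sequentially. dist ((x \<circ> r) n) z < \<delta>"
    using r(3) \<delta>(1) by (simp add: tendsto_iff)
  then obtain n where "dist z (x (r n)) < \<delta>" by (auto simp: eventually_sequentially dist_commute)
  then obtain g where g: "path g" "path_image g \<subseteq> K \<inter> ball z d" "pathstart g = z" "pathfinish g = x (r n)"
    using \<delta>(2) xt(1) by meson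
  \<comment> \<open>Reversed, the image path starts inside \<open>J\<close>, to the left of
    \<open>h (1/2)\<close>, as \<open>path_crosses\<close> requires.\<close>
  let ?g = "reversepath (f \<circ> g)"
  have "continuous_on (path_image g) f" using g(2) f(1) by (auto intro: continuous_on_subset)
  then have "path ?g" using g(1) by (simp add: path_continuous_image)
  have im: "path_image ?g = f ` path_image g" by (simp add: path_image_compose)
  have "path_image ?g \<subseteq> X" unfolding im using g(2) f(2) by blast
  have "pathstart ?g = h (t (r n))" using g(4) xt(5) by (simp add: pathfinish_compose)
  have "f z \<in> path_image ?g" using g(3) im by (metis imageI pathstart_in_path_image)
  have "f z \<notin> h ` {0<..<c}" if "c \<le> 1" for c using \<open>f z \<in> L\<close> disjoint_L that by auto
  then have cross: "h c \<in> path_image ?g" if "t (r n) < c" "c < 1" for c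
    using path_crosses[of ?g "t (r n)" c "f z"] assms(1) xt(2) that \<open>path ?g\<close> \<open>path_image ?g \<subseteq> X\<close>
      \<open>pathstart ?g = _\<close> \<open>f z \<in> path_image ?g\<close> by auto
  have small: "dist w (f z) < e/2" if w: "w \<in> path_image ?g" for w
  proof -
    obtain x where x: "x \<in> path_image g" "w = f x" using w unfolding im by auto
    then have "x \<in> K" "dist x z < d" using g(2) by (auto simp: dist_commute)
    then show ?thesis using d(2) x(2) by blast
  qed
  have "dist (h (1/2)) (h (3/4)) < e"
    using small[OF cross[of "1/2"]] small[OF cross[of "3/4"]] xt(3)[of "r n"] dist_triangle_half_l[of "h (1/2)" "f z" e "h (3/4)"]
    by (auto simp: dist_commute)
  then show False by (simp add: e_def)
qed

end

subsection \<open>Extending maps over one end\<close>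

text \<open>The intervals between consecutive \<open>u n\<close> tile \<open>(0, u 0]\<close> and
  accumulate only at 0, so continuity can be checked on finitely many at a time. The last conclusion
  lets estimates for late pieces speak about small \<open>t\<close>.\<close>

lemma glue_sequence:
  fixes G :: "nat \<Rightarrow> real \<Rightarrow> 'c::topological_space" and u :: "nat \<Rightarrow> real"
  assumes pos: "\<And>n. 0 < u n" and decr: "\<And>n. u (Suc n) < u n" and lim: "u \<longlonglongrightarrow> 0"
    and cont: "\<And>n. continuous_on {u (Suc n)..u n} (G n)"
    and match: "\<And>n. G n (u (Suc n)) = G (Suc n) (u (Suc n))"
  obtains F where "continuous_on {0<..u 0} F" "\<And>n t. u (Suc n) \<le> t \<Longrightarrow> t \<le> u n \<Longrightarrow> F t = G n t"
    "\<And>n t. 0 < t \<Longrightarrow> t < u n \<Longrightarrow> \<exists>m\<ge>n. u (Suc m) \<le> t \<and> t \<le> u m"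
proof -
  have anti: "u n < u m" if "m < n" for m n
    using lift_Suc_mono_less[of "\<lambda>n. - u n" m n] decr that by simp
  have ex: "\<exists>n. u (Suc n) \<le> t" if "0 < t" for t
  proof -
    have "\<forall>\<^sub>F n in sequentially. u n < t" using lim that by (intro order_tendstoD)
    then obtain n where "u n < t" by (auto simp: eventually_sequentially)
    then show ?thesis using decr[of n] by (intro exI[of _ n]) simp
  qed
  \<comment> \<open>At a common endpoint \<open>u (Suc m)\<close> the least index is
    \<open>m\<close>; by \<open>match\<close> the choice does not matter.\<close>
  define F where "F t = G (LEAST n. u (Suc n) \<le> t) t" for t
  have F: "F t = G n t" if t: "u (Suc n) \<le> t" "t \<le> u n" for n t
  proof -
    define m where "m = (LEAST n. u (Suc n) \<le> t)"
    have m: "m \<le> n" "u (Suc m) \<le> t"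
      unfolding m_def using t by (auto intro: Least_le LeastI)
    show ?thesis
    proof (cases "m = n")
      case False
      then have "Suc m \<le> n" using m by simp
      then have "n = Suc m" using anti[of "Suc m" n] m t by (cases "Suc m = n") auto
      then have "t = u (Suc m)" using m t by simp
      then show ?thesis using match[of m] \<open>n = Suc m\<close> unfolding F_def m_def[symmetric] by simp
    qed (simp add: F_def m_def[symmetric])
  qed
  have loc: "\<exists>m\<ge>n. u (Suc m) \<le> t \<and> t \<le> u m" if t: "0 < t" "t < u n" for n t
  proof -
    define m where "m = (LEAST m. u (Suc m) \<le> t)"
    have m: "u (Suc m) \<le> t" unfolding m_def by (rule LeastI_ex[OF ex[OF t(1)]])
    have "u (Suc m) < u n" using m t by simp
    then have "n \<le> m" using anti[of "Suc m" n] by (cases "Suc m = n"; cases "Suc m < n") auto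
    moreover have "t \<le> u m"
    proof (cases m)
      case 0 then show ?thesis using \<open>n \<le> m\<close> t by simp
    next
      case (Suc j)
      then have "\<not> u (Suc j) \<le> t" using not_less_Least[of j "\<lambda>m. u (Suc m) \<le> t"] by (simp add: m_def)
      then show ?thesis using Suc by simp
    qed
    ultimately show ?thesis using m by blast
  qed
  have contF: "continuous_on {u n..u 0} F" for n
  proof (induction n)
    case (Suc n)
    have "{u (Suc n)..u 0} = {u (Suc n)..u n} \<union> {u n..u 0}"
      using decr[of n] anti[of 0 n] by (cases "n = 0") auto
    moreover have "continuous_on {u (Suc n)..u n} F"
      using cont[of n] by (rule continuous_on_eq) (auto simp: F)
    ultimately show ?case using Suc by (simp add: continuous_on_closed_Un)
  qed simp
  have "continuous (at t within {0<..u 0}) F" if t: "t \<in> {0<..u 0}" for t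
  proof -
    obtain n where n: "u (Suc n) \<le> t" using ex t by auto
    then have "u (Suc (Suc n)) < t" using decr[of "Suc n"] by simp
    moreover have "continuous (at t within {u (Suc (Suc n))..u 0}) F"
      using contF[of "Suc (Suc n)"] t calculation by (simp add: continuous_on_eq_continuous_within)
    moreover have "at t within {0<..u 0} = at t within {u (Suc (Suc n))..u 0}"
      using calculation(1) pos[of "Suc (Suc n)"] by (intro at_within_nhd[of t "{u (Suc (Suc n))<..}"]) auto
    ultimately show ?thesis by simp
  qed
  then show thesis
    using F loc by (intro that[of F]) (auto simp: continuous_on_eq_continuous_within)
qed

lemma homeomorphism_imp_homeomorphic_maps:
  "homeomorphism S T f g \<Longrightarrow> homeomorphic_maps (top_of_set S) (top_of_set T) f g"
  by (auto simp: homeomorphism_def homeomorphic_maps_def)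

context two_ended_interval
begin

text \<open>The nearest point \<open>lam t\<close> need not depend continuously on \<open>t\<close>,
  but near the left end it is close to \<open>h t\<close>; so over a short parameter interval the
  values of \<open>g\<close> at it are close enough to be joined by a short path in
  \<open>P\<close>. One \<open>lam\<close> is passed in from outside, so that pieces built for
  different \<open>\<epsilon>\<close> agree at common endpoints.\<close>

lemma fill_left:
  fixes g :: "'b \<Rightarrow> 'c::metric_space"
  assumes P: "uniformly_locally_path_connected P" and g: "continuous_on L g" "g ` L \<subseteq> P" and "\<epsilon> > 0"
    and lam: "\<And>t. 0 < t \<Longrightarrow> t < 1 \<Longrightarrow> lam t \<in> L"
      "\<And>t l. 0 < t \<Longrightarrow> t < 1 \<Longrightarrow> l \<in> L \<Longrightarrow> dist (h t) (lam t) \<le> dist (h t) l"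
  obtains c where "0 < c" "c < 1" "\<And>a b. 0 < a \<Longrightarrow> a \<le> b \<Longrightarrow> b \<le> c \<Longrightarrow>
    \<exists>G. continuous_on {a..b} G \<and> G a = g (lam a) \<and> G b = g (lam b) \<and>
        (\<forall>t\<in>{a..b}. G t \<in> P \<and> dist (G t) (g (lam t)) < \<epsilon>)"
proof -
  obtain \<delta>1 where \<delta>1: "\<delta>1 > 0" "\<And>x y. x \<in> P \<Longrightarrow> y \<in> P \<Longrightarrow> dist x y < \<delta>1 \<Longrightarrow>
      \<exists>\<gamma>. path \<gamma> \<and> path_image \<gamma> \<subseteq> P \<inter> ball x (\<epsilon>/2) \<and> pathstart \<gamma> = x \<and> pathfinish \<gamma> = y"
    using P[unfolded uniformly_locally_path_connected_def, rule_format, of "\<epsilon>/2"] \<open>\<epsilon> > 0\<close> by auto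
  have "uniformly_continuous_on L g" using compact_uniformly_continuous[OF g(1) compact_L] .
  then obtain \<delta>2 where \<delta>2: "\<delta>2 > 0" "\<And>l m. l \<in> L \<Longrightarrow> m \<in> L \<Longrightarrow> dist l m < \<delta>2 \<Longrightarrow> dist (g l) (g m) < min \<delta>1 (\<epsilon>/2)"
    unfolding uniformly_continuous_on_def using \<delta>1(1) \<open>\<epsilon> > 0\<close>
    by (metis dist_commute half_gt_zero min_less_iff_conj)
  obtain c0 where c0: "0 < c0" "c0 < 1" "\<And>t. 0 < t \<Longrightarrow> t < c0 \<Longrightarrow> \<exists>l\<in>L. dist (h t) l < \<delta>2/4"
    using near_left[of "\<delta>2/4"] \<delta>2(1) by auto
  have near: "dist (h t) (lam t) < \<delta>2/4" if "0 < t" "t < c0" for t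
    using c0(3)[OF that] lam(2)[of t] that c0(2) by force
  let ?Q = "\<lambda>a b. \<exists>G. continuous_on {a..b} G \<and> G a = g (lam a) \<and> G b = g (lam b) \<and>
        (\<forall>t\<in>{a..b}. G t \<in> P \<and> dist (G t) (g (lam t)) < \<epsilon>)"
  have Q: "?Q a b" if ab: "0 < a" "a \<le> b" "b \<le> c0/2" for a b
  proof -
    have "a \<le> a \<and> a \<le> b \<and> b \<le> b \<longrightarrow> ?Q a b"
      using \<open>a \<le> b\<close>
    \<comment> \<open>The bisection principle replaces a choice of partition: fillings can be
      concatenated, and short intervals around any point can be filled.\<close>
    proof (induction rule: Bolzano[where P = "\<lambda>x y. a \<le> x \<and> x \<le> y \<and> y \<le> b \<longrightarrow> ?Q x y"])
      case (trans x y z)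
      show ?case
      proof
        assume "a \<le> x \<and> x \<le> z \<and> z \<le> b"
        then have "?Q x y" "?Q y z" using trans by auto
        then obtain G1 G2 where G1: "continuous_on {x..y} G1" "G1 x = g (lam x)" "G1 y = g (lam y)"
            "\<forall>t\<in>{x..y}. G1 t \<in> P \<and> dist (G1 t) (g (lam t)) < \<epsilon>"
          and G2: "continuous_on {y..z} G2" "G2 y = g (lam y)" "G2 z = g (lam z)"
            "\<forall>t\<in>{y..z}. G2 t \<in> P \<and> dist (G2 t) (g (lam t)) < \<epsilon>"
          by metis
        have "continuous_on ({x..y} \<union> {y..z}) (\<lambda>t. if t \<le> y then G1 t else G2 t)"
          using G1 G2 by (intro continuous_on_cases) (auto simp: order_antisym_conv)
        moreover have "{x..y} \<union> {y..z} = {x..z}" using trans by auto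
        ultimately show "?Q x z"
          using G1 G2 trans by (intro exI[of _ "\<lambda>t. if t \<le> y then G1 t else G2 t"]) auto
      qed
    next
      case (local x)
      then have x: "x \<in> {0<..<1}" "0 < x" "x < c0" using ab c0 by auto
      then obtain d where d: "d > 0" "\<And>t. t \<in> {0<..<1} \<Longrightarrow> dist t x < d \<Longrightarrow> dist (h t) (h x) < \<delta>2/4"
        using continuous_h \<delta>2(1) unfolding continuous_on_iff
        by (metis divide_pos_pos zero_less_numeral)
      show ?case
      proof (intro exI[of _ d] conjI allI impI d(1))
        fix r s assume rs0: "r \<le> x \<and> x \<le> s \<and> s - r < d" "a \<le> r \<and> r \<le> s \<and> s \<le> b"
        then have rs: "0 < r" "s < c0" "s < 1" "r \<le> s" using ab c0 by auto
        have lamd: "dist (lam t) (lam t') < \<delta>2" if "t \<in> {r..s}" "t' \<in> {r..s}" for t t'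
        proof -
          have t: "0 < t" "t < c0" "0 < t'" "t' < c0" "t \<in> {0<..<1}" "t' \<in> {0<..<1}"
            "dist t x < d" "dist t' x < d"
            using that rs rs0 by (auto simp: dist_real_def)
          have "dist (lam t) (lam t') \<le> dist (lam t) (h t) + dist (h t) (h x) + dist (h x) (h t') + dist (h t') (lam t')"
            using dist_triangle[of "lam t" "lam t'" "h t"] dist_triangle[of "h t" "lam t'" "h x"]
              dist_triangle[of "h x" "lam t'" "h t'"] by linarith
          then show ?thesis
            using near[OF t(1,2)] near[OF t(3,4)] d(2)[OF t(5,7)] d(2)[OF t(6,8)] by (simp add: dist_commute)
        qed
        have lamL: "lam t \<in> L" if "t \<in> {r..s}" for t using lam(1)[of t] that rs by auto
        have gg: "dist (g (lam t)) (g (lam t')) < min \<delta>1 (\<epsilon>/2)" if "t \<in> {r..s}" "t' \<in> {r..s}" for t t'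
          using \<delta>2(2)[OF lamL lamL lamd] that by auto
        have "r \<in> {r..s}" "s \<in> {r..s}" using rs by auto
        then obtain \<gamma> where \<gamma>: "path \<gamma>" "path_image \<gamma> \<subseteq> P \<inter> ball (g (lam r)) (\<epsilon>/2)"
            "pathstart \<gamma> = g (lam r)" "pathfinish \<gamma> = g (lam s)"
          using \<delta>1(2)[of "g (lam r)" "g (lam s)"] gg g(2) lamL by (metis image_subset_iff min_less_iff_conj)
        show "?Q r s"
        proof (cases "r = s")
          case True
          then show ?thesis
            using g(2) lamL[of s] \<open>\<epsilon> > 0\<close> by (intro exI[of _ "\<lambda>_. g (lam s)"]) auto
        next
          case False
          then have "r < s" using rs by simp
          let ?G = "\<lambda>t. \<gamma> ((t - r) / (s - r))"
          have in01: "(t - r) / (s - r) \<in> {0..1}" if "t \<in> {r..s}" for t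
            using that \<open>r < s\<close> by (auto simp: field_simps)
          have "continuous_on {r..s} ?G"
          proof (rule continuous_on_compose2[OF \<gamma>(1)[unfolded path_def]])
            show "continuous_on {r..s} (\<lambda>t. (t - r) / (s - r))"
              using \<open>r < s\<close> by (intro continuous_intros) auto
          qed (use in01 in blast)
          moreover have "?G t \<in> P \<and> dist (?G t) (g (lam t)) < \<epsilon>" if t: "t \<in> {r..s}" for t
          proof -
            have "?G t \<in> path_image \<gamma>" using in01[OF t] by (auto simp: path_image_def)
            then have "?G t \<in> P" "dist (g (lam r)) (?G t) < \<epsilon>/2" using \<gamma>(2) by auto
            moreover have "dist (g (lam r)) (g (lam t)) < \<epsilon>/2" using gg[OF \<open>r \<in> _\<close> t] by simp
            ultimately show ?thesis
              using dist_triangle_half_r[of "g (lam r)" "?G t" \<epsilon> "g (lam t)"] by simp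
          qed
          moreover have "?G r = g (lam r)" "?G s = g (lam s)"
            using \<gamma>(3,4) \<open>r < s\<close> by (simp_all add: pathstart_def pathfinish_def)
          ultimately show ?thesis by blast
        qed
      qed
    qed
    then show ?thesis using \<open>a \<le> b\<close> by simp
  qed
  show thesis
    by (rule that[of "c0/2"]) (use c0 Q in auto)
qed

text \<open>Fillings with errors tending to 0 are strung together over parameters tending to 0. Near
  a point \<open>x\<close> of \<open>L\<close> the value at \<open>h t\<close> is then close to
  \<open>g (lam t)\<close>, and \<open>lam t\<close> is close to \<open>x\<close>, being at least as
  near to \<open>h t\<close> as \<open>x\<close> is. Prescribing the value \<open>p\<close> at
  \<open>h a\<close> allows gluing with a map on the other half.\<close>

proposition extend_left:
  fixes g :: "'b \<Rightarrow> 'c::metric_space"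
  assumes P: "uniformly_locally_path_connected P" "path_connected P" and g: "continuous_on L g" "g ` L \<subseteq> P"
    and a: "0 < a" "a < 1" and p: "p \<in> P"
  obtains F where "continuous_on (L \<union> h ` {0<..a}) F" "F ` (L \<union> h ` {0<..a}) \<subseteq> P"
    "\<And>x. x \<in> L \<Longrightarrow> F x = g x" "F (h a) = p"
proof -
  have "\<exists>l\<in>L. \<forall>m\<in>L. dist (h t) l \<le> dist (h t) m" for t
    using compact_L L_nonempty by (intro continuous_attains_inf continuous_intros)
  then obtain lam where lam: "\<And>t. lam t \<in> L" "\<And>t m. m \<in> L \<Longrightarrow> dist (h t) (lam t) \<le> dist (h t) m"
    by metis
  let ?Q = "\<lambda>\<epsilon> a b G. continuous_on {a..b} G \<and> G a = g (lam a) \<and> G b = g (lam b) \<and>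
        (\<forall>t\<in>{a..b}. G t \<in> P \<and> dist (G t) (g (lam t)) < \<epsilon>)"
  have "\<exists>c. 0 < c \<and> c < 1 \<and> (\<forall>x y. 0 < x \<longrightarrow> x \<le> y \<longrightarrow> y \<le> c \<longrightarrow> (\<exists>G. ?Q (inverse (real (Suc n))) x y G))" for n
  proof -
    have "inverse (real (Suc n)) > 0" by simp
    from fill_left[OF P(1) g this lam] show ?thesis by metis
  qed
  then obtain c where c: "\<And>n. 0 < c n" "\<And>n. c n < 1"
      "\<And>n x y. 0 < x \<Longrightarrow> x \<le> y \<Longrightarrow> y \<le> c n \<Longrightarrow> \<exists>G. ?Q (inverse (real (Suc n))) x y G"
    by metis
  \<comment> \<open>Halving forces the limit 0; the bound \<open>c n\<close> lets the piece just
    below \<open>u (Suc n)\<close> be filled with error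
    \<open>inverse (real (Suc n))\<close>.\<close>
  define u where "u = rec_nat a (\<lambda>n x. min (x/2) (c n))"
  have u0: "u 0 = a" and uS: "u (Suc n) = min (u n / 2) (c n)" for n by (simp_all add: u_def)
  have upos: "0 < u n" for n by (induction n) (use a c(1) in \<open>auto simp: u0 uS\<close>)
  have udec: "u (Suc n) < u n" for n using upos[of n] by (auto simp: uS)
  have ub: "u n \<le> a * (1/2)^n" for n
  proof (induction n)
    case (Suc n)
    have "u (Suc n) \<le> u n / 2" by (simp add: uS)
    then show ?case using Suc by simp
  qed (simp add: u0)
  have ulim: "u \<longlonglongrightarrow> 0"
  proof (rule tendsto_sandwich[OF _ _ tendsto_const])
    have "(\<lambda>n. a * (1/2)^n) \<longlonglongrightarrow> a * 0" by (intro tendsto_intros LIMSEQ_power_zero) auto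
    then show "(\<lambda>n. a * (1/2)^n) \<longlonglongrightarrow> 0" by simp
  qed (use ub upos in \<open>auto intro!: always_eventually less_imp_le\<close>)
  \<comment> \<open>The top piece \<open>n = 0\<close> has no error bound: it is any path in
    \<open>P\<close> from the first filled value to \<open>p\<close>.\<close>
  have "\<exists>G. continuous_on {u (Suc n)..u n} G \<and> G (u (Suc n)) = g (lam (u (Suc n))) \<and>
      G (u n) = (if n = 0 then p else g (lam (u n))) \<and> (\<forall>t\<in>{u (Suc n)..u n}. G t \<in> P) \<and>
      (\<forall>m. n = Suc m \<longrightarrow> (\<forall>t\<in>{u (Suc n)..u n}. dist (G t) (g (lam t)) < inverse (real (Suc m))))" for n
  proof (cases n)
    case 0
    obtain \<gamma> where \<gamma>: "path \<gamma>" "path_image \<gamma> \<subseteq> P" "pathstart \<gamma> = g (lam (u 1))" "pathfinish \<gamma> = p"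
      using P(2) g(2) lam(1) p unfolding path_connected_def by (metis image_subset_iff)
    let ?G = "\<lambda>t. \<gamma> ((t - u 1) / (u 0 - u 1))"
    have lt: "u 1 < u 0" using udec[of 0] by simp
    have in01: "(t - u 1) / (u 0 - u 1) \<in> {0..1}" if "t \<in> {u 1..u 0}" for t
      using that lt by (auto simp: field_simps)
    have "continuous_on {u 1..u 0} ?G"
    proof (rule continuous_on_compose2[OF \<gamma>(1)[unfolded path_def]])
      show "continuous_on {u 1..u 0} (\<lambda>t. (t - u 1) / (u 0 - u 1))"
        using lt by (intro continuous_intros) auto
    qed (use in01 in blast)
    moreover have "?G t \<in> P" if "t \<in> {u 1..u 0}" for t
      using in01[OF that] \<gamma>(2) by (auto simp: path_image_def)
    moreover have "?G (u 1) = g (lam (u 1))" "?G (u 0) = p"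
      using \<gamma>(3,4) lt by (simp_all add: pathstart_def pathfinish_def)
    ultimately show ?thesis using 0 by (intro exI[of _ ?G]) auto
  next
    case (Suc m)
    have "u n \<le> c m" using Suc by (simp add: uS)
    with c(3)[of "u (Suc n)" "u n" m] upos udec[of n] obtain G where "?Q (inverse (real (Suc m))) (u (Suc n)) (u n) G"
      by (meson less_imp_le)
    then show ?thesis using Suc by (intro exI[of _ G]) auto
  qed
  then obtain G where G: "\<And>n. continuous_on {u (Suc n)..u n} (G n)" "\<And>n. G n (u (Suc n)) = g (lam (u (Suc n)))"
      "\<And>n. G n (u n) = (if n = 0 then p else g (lam (u n)))" "\<And>n t. t \<in> {u (Suc n)..u n} \<Longrightarrow> G n t \<in> P"
      "\<And>m t. t \<in> {u (Suc (Suc m))..u (Suc m)} \<Longrightarrow> dist (G (Suc m) t) (g (lam t)) < inverse (real (Suc m))"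
    by metis
  obtain F0 where F0: "continuous_on {0<..u 0} F0" "\<And>n t. u (Suc n) \<le> t \<Longrightarrow> t \<le> u n \<Longrightarrow> F0 t = G n t"
      "\<And>n t. 0 < t \<Longrightarrow> t < u n \<Longrightarrow> \<exists>m\<ge>n. u (Suc m) \<le> t \<and> t \<le> u m"
    using glue_sequence[of u G, OF upos udec ulim G(1)] G(2,3) by auto
  have F0a: "F0 a = p" using F0(2)[of 0 a] udec[of 0] G(3)[of 0] by (simp add: u0)
  have F0P: "F0 t \<in> P" if t: "0 < t" "t \<le> a" for t
  proof (cases "t = a")
    case False
    then obtain m where "u (Suc m) \<le> t" "t \<le> u m" using F0(3)[of t 0] t u0 by auto
    then show ?thesis using F0(2) G(4) by auto
  qed (simp add: F0a p)
  have F0near: "\<exists>d>0. \<forall>t. 0 < t \<and> t < d \<longrightarrow> dist (F0 t) (g (lam t)) < \<epsilon>" if "\<epsilon> > 0" for \<epsilon>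
  proof -
    obtain m where m: "inverse (real (Suc m)) < \<epsilon>" using reals_Archimedean[OF \<open>\<epsilon> > 0\<close>] by auto
    show ?thesis
    proof (intro exI[of _ "u (Suc m)"] conjI allI impI upos)
      fix t assume t: "0 < t \<and> t < u (Suc m)"
      then obtain n where n: "n \<ge> Suc m" "u (Suc n) \<le> t" "t \<le> u n" using F0(3)[of t "Suc m"] by auto
      then obtain j where j: "n = Suc j" "j \<ge> m" by (cases n) auto
      have "dist (F0 t) (g (lam t)) < inverse (real (Suc j))" using F0(2)[of n t] G(5)[of t j] n j by auto
      also have "\<dots> \<le> inverse (real (Suc m))" using j by (simp add: field_simps)
      finally show "dist (F0 t) (g (lam t)) < \<epsilon>" using m by simp
    qed
  qed
  let ?S = "L \<union> h ` {0<..a}"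
  let ?F = "\<lambda>x. if x \<in> L then g x else F0 (k x)"
  have sub: "h ` {0<..a} \<subseteq> J" using a by auto
  have F_h: "?F (h t) = F0 t" if "0 < t" "t < 1" for t using h_notin(1)[OF that] that by simp
  have "continuous (at x within ?S) ?F" if x: "x \<in> ?S" for x
  proof (cases "x \<in> L")
    case False
    then have xh: "x \<in> h ` {0<..a}" using x by auto
    have "continuous_on (h ` {0<..a}) (\<lambda>x. F0 (k x))"
      by (rule continuous_on_compose2[OF F0(1) continuous_on_subset[OF continuous_k sub]]) (use a u0 in auto)
    then have "continuous_on (h ` {0<..a}) ?F"
      by (rule continuous_on_eq) (use sub disjoint_L in auto)
    then have "continuous (at x within h ` {0<..a}) ?F"
      using xh unfolding continuous_on_eq_continuous_within by blast
    moreover have "at x within ?S = at x within h ` {0<..a}"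
      using False closed_LR sub disjoint_L by (intro at_within_nhd[of x "- L"]) auto
    ultimately show ?thesis by simp
  next
    case True
    show ?thesis
      unfolding continuous_within_eps_delta
    proof (intro allI impI)
      fix \<epsilon> :: real assume "\<epsilon> > 0"
      obtain d1 where d1: "d1 > 0" "\<And>y. y \<in> L \<Longrightarrow> dist y x < d1 \<Longrightarrow> dist (g y) (g x) < \<epsilon>/2"
        using g(1) True \<open>\<epsilon> > 0\<close> unfolding continuous_on_iff by (meson half_gt_zero)
      obtain d2 where d2: "d2 > 0" "\<And>t. 0 < t \<Longrightarrow> t < d2 \<Longrightarrow> dist (F0 t) (g (lam t)) < \<epsilon>/2"
        using F0near[of "\<epsilon>/2"] \<open>\<epsilon> > 0\<close> by auto
      \<comment> \<open>Points close to \<open>x\<close> avoid this compact part of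
        \<open>J\<close>, which forces their parameter below \<open>d2\<close>.\<close>
      define C where "C = h ` {min d2 a..a}"
      have "closed C" unfolding C_def using d2(1) a by (intro closed_segment_image) auto
      have "C \<subseteq> J" unfolding C_def using d2(1) a by auto
      then have "x \<in> - C" using True disjoint_L by blast
      then obtain d3 where d3: "d3 > 0" "\<And>y. dist y x < d3 \<Longrightarrow> y \<notin> C"
        using \<open>closed C\<close> unfolding closed_def open_dist by auto
      show "\<exists>d>0. \<forall>y\<in>?S. dist y x < d \<longrightarrow> dist (?F y) (?F x) < \<epsilon>"
      \<comment> \<open>Half of \<open>d1\<close>, since \<open>lam t\<close> may be twice as far
        from \<open>x\<close> as \<open>h t\<close> is.\<close>
      proof (intro exI[of _ "min (d1/2) d3"] conjI ballI impI)
        fix y assume y: "y \<in> ?S" "dist y x < min (d1/2) d3"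
        show "dist (?F y) (?F x) < \<epsilon>"
        proof (cases "y \<in> L")
          case False
          then obtain t where t: "y = h t" "0 < t" "t \<le> a" using y by auto
          then have "t < d2" using d3(2)[of y] y(2) by (force simp: C_def)
          have "dist (lam t) x \<le> dist (h t) (lam t) + dist (h t) x"
            by (metis dist_commute dist_triangle)
          also have "\<dots> \<le> 2 * dist (h t) x" using lam(2)[OF True, of t] by simp
          finally have "dist (lam t) x < d1" using y(2) t(1) by simp
          then have "dist (g (lam t)) (g x) < \<epsilon>/2" using d1(2) lam(1) by simp
          moreover have "dist (F0 t) (g (lam t)) < \<epsilon>/2" using d2(2) t \<open>t < d2\<close> by simp
          ultimately have "dist (F0 t) (g x) < \<epsilon>"
            using dist_triangle_half_r[of "g (lam t)" "F0 t" \<epsilon> "g x"] by (simp add: dist_commute)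
          moreover have "?F y = F0 t" unfolding t(1) using t a by (intro F_h) auto
          ultimately show ?thesis using True by simp
        qed (use d1 y True \<open>\<epsilon> > 0\<close> in force)
      qed (use d1 d3 in auto)
    qed
  qed
  then have "continuous_on ?S ?F" by (simp add: continuous_on_eq_continuous_within)
  moreover have "?F ` ?S \<subseteq> P"
  proof
    fix z assume "z \<in> ?F ` ?S"
    then obtain y where y: "y \<in> ?S" "z = ?F y" by (rule imageE)
    show "z \<in> P"
    proof (cases "y \<in> L")
      case False
      then obtain t where t: "y = h t" "0 < t" "t \<le> a" using y by auto
      have "?F y = F0 t" unfolding t(1) using t a by (intro F_h) auto
      then show ?thesis using y F0P[OF t(2,3)] by simp
    qed (use y g(2) in auto)
  qed
  moreover have "?F (h a) = p" using F_h[OF a] F0a by simp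
  ultimately show thesis by (intro that[of ?F]) simp_all
qed

end

subsection \<open>Minimal sets and case (1)\<close>

text \<open>For subsets of a compact \<open>M\<close> in a metric space, being closed in the ambient
  space and being closed in \<open>M\<close> agree; so subspace topologies are avoided here.\<close>

definition minimal_for :: "('b::topological_space \<Rightarrow> 'b) \<Rightarrow> 'b set \<Rightarrow> bool" where
  "minimal_for f M \<longleftrightarrow> f ` M = M \<and> (\<forall>N. closed N \<longrightarrow> N \<noteq> {} \<longrightarrow> N \<subseteq> M \<longrightarrow> f ` N \<subseteq> N \<longrightarrow> N = M)"

definition min_set :: "'b::topological_space set \<Rightarrow> 'b set \<Rightarrow> bool" where
  "min_set S M \<longleftrightarrow> M \<noteq> {} \<and> compact M \<and> M \<subseteq> S \<and>
     (\<exists>f. continuous_on S f \<and> f ` S \<subseteq> S \<and> minimal_for f M)"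

lemma minimal_for_cong:
  assumes "\<And>x. x \<in> M \<Longrightarrow> f x = g x"
  shows "minimal_for f M \<longleftrightarrow> minimal_for g M"
proof -
  have "f ` N = g ` N" if "N \<subseteq> M" for N using assms that by (auto intro!: image_cong)
  then show ?thesis unfolding minimal_for_def by auto
qed

lemma min_setI:
  assumes "M \<noteq> {}" "compact M" "M \<subseteq> S" "minimal_for f M"
    and "continuous_on S g" "g ` S \<subseteq> S" "\<And>x. x \<in> M \<Longrightarrow> g x = f x"
  shows "min_set S M"
  using assms minimal_for_cong[of M g f] unfolding min_set_def by blast

lemma min_setE:
  assumes "min_set S M"
  obtains f where "M \<noteq> {}" "compact M" "M \<subseteq> S" "continuous_on S f" "f ` S \<subseteq> S" "minimal_for f M"
  using assms unfolding min_set_def by blast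

lemma minimal_for_image: "minimal_for f M \<Longrightarrow> f ` M = M"
  by (simp add: minimal_for_def)

text \<open>\<open>M \<inter> N\<close> is closed and, as \<open>f\<close> maps \<open>M\<close>
  onto itself, invariant; minimality makes it all of \<open>M\<close>.\<close>

lemma minimal_for_subset:
  assumes "minimal_for f M" "closed M" "closed N" "M \<inter> N \<noteq> {}" "f ` (M \<inter> N) \<subseteq> N"
  shows "M \<subseteq> N"
proof -
  have "f ` (M \<inter> N) \<subseteq> f ` M" by (rule image_mono) simp
  also have "f ` M = M" using assms(1) by (simp add: minimal_for_def)
  finally have "f ` (M \<inter> N) \<subseteq> M \<inter> N" using assms(5) by simp
  moreover have "closed (M \<inter> N)" using assms(2,3) by (rule closed_Int)
  ultimately have "M \<inter> N = M" using assms(1,4) unfolding minimal_for_def by simp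
  then show ?thesis by blast
qed

lemma min_set_subset:
  assumes "M \<noteq> {}" "compact M" "M \<subseteq> T" "T \<subseteq> S" "minimal_for f M" "continuous_on S f" "f ` T \<subseteq> T"
  shows "min_set T M"
  using assms continuous_on_subset[of S f T] unfolding min_set_def by blast

context two_ended_interval
begin

lemma near_right:
  assumes "\<epsilon> > 0"
  obtains c where "0 < c" "c < 1" "\<And>t. c < t \<Longrightarrow> t < 1 \<Longrightarrow> \<exists>l\<in>R. dist (h t) l < \<epsilon>"
proof -
  interpret F: two_ended_interval R L "\<lambda>t. h (1 - t)" "\<lambda>x. 1 - k x" by (rule flip)
  obtain c where c: "0 < c" "c < 1" "\<And>t. 0 < t \<Longrightarrow> t < c \<Longrightarrow> \<exists>l\<in>R. dist (h (1 - t)) l < \<epsilon>"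
    using F.near_left[OF assms] by blast
  show thesis
    by (rule that[of "1 - c"]) (use c(1,2) c(3)[of "1 - _"] in auto)
qed

lemma continuous_right_point:
  assumes "R = {r}"
  shows "continuous_on {0<..1} (h(1 := r))"
proof -
  have "continuous (at t within {0<..1}) (h(1 := r))" if t: "t \<in> {0<..1}" for t
  proof (cases "t = 1")
    case False
    have "continuous_on {0<..<1} (h(1 := r))"
      by (rule continuous_on_eq[OF continuous_h]) auto
    then have "continuous (at t within {0<..<1}) (h(1 := r))"
      using False t unfolding continuous_on_eq_continuous_within by auto
    moreover have "at t within {0<..1} = at t within {0<..<1}"
      using False t by (intro at_within_nhd[of t "{..<1}"]) auto
    ultimately show ?thesis by simp
  next
    case True
    show ?thesis
      unfolding continuous_within_eps_delta True
    proof (intro allI impI)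
      fix \<epsilon> :: real assume "\<epsilon> > 0"
      then obtain c where c: "0 < c" "c < 1" "\<And>t. c < t \<Longrightarrow> t < 1 \<Longrightarrow> \<exists>l\<in>R. dist (h t) l < \<epsilon>"
        using near_right by blast
      show "\<exists>d>0. \<forall>t\<in>{0<..1}. dist t 1 < d \<longrightarrow> dist ((h(1 := r)) t) ((h(1 := r)) 1) < \<epsilon>"
        by (rule exI[of _ "1 - c"]) (use c assms \<open>\<epsilon> > 0\<close> in \<open>auto simp: dist_real_def\<close>)
    qed
  qed
  then show ?thesis unfolding continuous_on_eq_continuous_within by blast
qed

lemma right_point_image:
  assumes "R = {r}" "a < 1"
  shows "(h(1 := r)) ` {a..1} = R \<union> h ` {a..<1}"
proof -
  have "{a..1} = {a..<1} \<union> {1}" using assms by auto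
  then show ?thesis using assms by (auto simp: image_Un)
qed

lemma right_arc:
  assumes "R = {r}" "0 < a" "a < 1"
  shows "\<exists>g. homeomorphism {a..1} (R \<union> h ` {a..<1}) (h(1 := r)) g"
proof (rule homeomorphism_compact)
  show "continuous_on {a..1} (h(1 := r))"
    using continuous_right_point[OF assms(1)] by (rule continuous_on_subset) (use assms in auto)
  show "(h(1 := r)) ` {a..1} = R \<union> h ` {a..<1}"
    using assms by (intro right_point_image) auto
  have "h t \<noteq> r" if "a \<le> t" "t < 1" for t using h_notin(2)[of t] that assms by auto
  then show "inj_on (h(1 := r)) {a..1}"
    using assms h_eq_iff by (auto simp: inj_on_def) (metis order_less_le less_le_trans)+
qed simp

lemma right_arc_properties:
  assumes "R = {r}" "0 < a" "a < 1"
  shows "compact (R \<union> h ` {a..<1})" "path_connected (R \<union> h ` {a..<1})" "uniformly_locally_path_connected (R \<union> h ` {a..<1})"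
proof -
  obtain g where g: "homeomorphism {a..1} (R \<union> h ` {a..<1}) (h(1 := r)) g"
    using right_arc[OF assms] by blast
  then have *: "continuous_on {a..1} (h(1 := r))" "R \<union> h ` {a..<1} = (h(1 := r)) ` {a..1}"
    by (auto simp: homeomorphism_def)
  show c: "compact (R \<union> h ` {a..<1})"
    unfolding *(2) using *(1) by (intro compact_continuous_image) auto
  show "path_connected (R \<union> h ` {a..<1})"
    unfolding *(2) using *(1) by (intro path_connected_continuous_image convex_imp_path_connected) auto
  have "top_of_set {a..1} homeomorphic_space top_of_set (R \<union> h ` {a..<1})"
    using homeomorphism_imp_homeomorphic_maps[OF g] unfolding homeomorphic_space_def by blast
  then have "locally_connected_space (top_of_set (R \<union> h ` {a..<1}))"
    using homeomorphic_locally_connected_space locally_connected_real_interval(1) by blast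
  then show "uniformly_locally_path_connected (R \<union> h ` {a..<1})"
    using c compact_locally_connected_imp_uniformly_locally_path_connected by blast
qed

lemma path_connected_J: "path_connected J"
  by (intro path_connected_continuous_image[OF continuous_h] convex_imp_path_connected) auto

lemma path_connected_JR:
  assumes "R = {r}" shows "path_connected (J \<union> R)"
proof -
  have "path_connected (J \<union> (R \<union> h ` {1/2..<1}))"
  proof (rule path_connected_Un[OF path_connected_J])
    show "path_connected (R \<union> h ` {1/2..<1})"
      by (rule right_arc_properties(2)[OF assms]) auto
    have "h (1/2) \<in> J \<inter> (R \<union> h ` {1/2..<1})" by auto
    then show "J \<inter> (R \<union> h ` {1/2..<1}) \<noteq> {}" by blast
  qed
  moreover have "J \<union> (R \<union> h ` {1/2..<1}) = J \<union> R" by auto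
  ultimately show ?thesis by simp
qed

lemma X_subset_closure_J: "X \<subseteq> closure J"
proof -
  have "closure (h ` {0<..1/2}) \<subseteq> closure J" "closure (h ` {1/2..<1}) \<subseteq> closure J"
    by (intro closure_mono image_mono; auto)+
  moreover have "J \<subseteq> closure J" by (rule closure_subset)
  ultimately show ?thesis using closure_left[of "1/2"] closure_right[of "1/2"] by auto
qed

lemma closed_X: "closed X"
  using compact_X compact_imp_closed by blast

lemma image_J_closed:
  assumes "continuous_on X f" "closed T" "f ` J \<subseteq> T"
  shows "f ` X \<subseteq> T"
proof -
  have "closure J = X"
  proof (rule subset_antisym[OF _ X_subset_closure_J])
    show "closure J \<subseteq> X" by (rule closure_minimal[OF _ closed_X]) blast
  qed
  then show ?thesis using image_closure_subset[of J f T] assms by simp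
qed

lemma split_X: "0 < a \<Longrightarrow> a < 1 \<Longrightarrow> X = (L \<union> h ` {0<..a}) \<union> (R \<union> h ` {a..<1})"
  using image_Un[of h "{0<..a}" "{a..<1}"] by (auto simp: ivl_disj_un)

lemma left_Int_right:
  assumes "0 < a" "a < 1" "x \<in> h ` {0<..a}" "x \<in> h ` {a..<1}" shows "x = h a"
proof -
  obtain s where s: "x = h s" "0 < s" "s \<le> a" using assms(3) by auto
  obtain t where t: "x = h t" "a \<le> t" "t < 1" using assms(4) by auto
  have "s = t" using h_eq_iff[of s t] s t assms(1,2) by simp
  then show ?thesis using s t by simp
qed

text \<open>The two closed halves of \<open>X\<close> overlap only in \<open>h a\<close> and in
  \<open>L \<inter> R\<close>, so agreement there suffices.\<close>

lemma glue_at: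
  assumes "0 < a" "a < 1" "continuous_on (L \<union> h ` {0<..a}) F" "continuous_on (R \<union> h ` {a..<1}) G"
    and "F (h a) = G (h a)" "\<And>x. x \<in> L \<Longrightarrow> x \<in> R \<Longrightarrow> F x = G x"
  shows "continuous_on X (\<lambda>x. if x \<in> L \<union> h ` {0<..a} then F x else G x)"
  unfolding split_X[OF assms(1,2)]
proof (rule continuous_on_cases[OF closed_left[OF assms(1,2)] closed_right[OF assms(1,2)] assms(3,4)])
  have "F x = G x" if x: "x \<in> L \<union> h ` {0<..a}" "x \<in> R \<union> h ` {a..<1}" for x
  proof -
    have "h ` {0<..a} \<subseteq> J" "h ` {a..<1} \<subseteq> J"
      using assms(1,2) by (intro image_mono; auto)+
    then have "x \<in> L \<inter> R \<or> x \<in> h ` {0<..a} \<and> x \<in> h ` {a..<1}"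
      using x disjoint_L disjoint_R by blast
    then show ?thesis using assms(5,6) left_Int_right[OF assms(1,2), of x] by (metis IntE)
  qed
  then show "\<forall>x. x \<in> L \<union> h ` {0<..a} \<and> x \<notin> L \<union> h ` {0<..a} \<or>
      x \<in> R \<union> h ` {a..<1} \<and> x \<in> L \<union> h ` {0<..a} \<longrightarrow> F x = G x" by blast
qed

text \<open>\<open>c\<close> is chosen below the part of the left end that \<open>f ` L\<close> misses. Some point far to the left
  is mapped far to the left, and \<open>f\<close> cannot take the value \<open>h c\<close> near the left end; so a whole left
  tail of \<open>J\<close> is mapped to the left of \<open>h c\<close>, which forces \<open>f ` L \<subseteq> L\<close>.\<close>

lemma minimal_misses_left_end:
  assumes nd: "nondegenerate L" and r: "R = {r}" and L: "uniformly_locally_path_connected L"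
    and f: "continuous_on X f" "f ` X \<subseteq> X" and M: "compact M" "M \<subseteq> X" "minimal_for f M"
  obtains a where "0 < a" "a < 1" "M \<inter> h ` {0<..<a} = {}"
proof (rule ccontr)
  assume no: "\<not> thesis"
  have meets: "\<forall>a. 0 < a \<longrightarrow> a < 1 \<longrightarrow> M \<inter> h ` {0<..<a} \<noteq> {}"
    using no that by metis
  have closedM: "closed M" using M(1) by (rule compact_imp_closed)
  have fL: "continuous_on L f" "f ` L \<subseteq> X" using f by (auto intro: continuous_on_subset)
  obtain a0 where a0: "0 < a0" "a0 < 1" "f ` L \<inter> h ` {0<..<a0} = {}"
    by (rule uniformly_locally_path_connected_image_misses_left_end[OF nd compact_L L fL])
  \<comment> \<open>With \<open>c\<close> strictly between 0 and \<open>a0\<close>, no point of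
    \<open>L\<close> is mapped to \<open>h c\<close> or to a point of \<open>J\<close> left of
    it.\<close>
  define c where "c = a0 / 2"
  have c: "0 < c" "c < a0" "c < 1" using a0 by (auto simp: c_def)
  define C where "C = X \<inter> f -` {h c}"
  have "closed C" unfolding C_def using f(1) closed_X by (intro continuous_closed_preimage) auto
  moreover have "C \<inter> L = {}" using a0(3) c by (auto simp: C_def)
  ultimately obtain d where d: "0 < d" "d < 1" "C \<inter> h ` {0<..<d} = {}" by (rule avoid_left)
  \<comment> \<open>What remains of \<open>X\<close> outside a short left tail is a union of two
    locally connected compacta, so its image misses a left tail.\<close>
  let ?K = "L \<union> (R \<union> h ` {d/2..<1})"
  have K: "compact ?K" "uniformly_locally_path_connected ?K"
    using right_arc_properties[OF r, of "d/2"] d compact_L L by (auto intro!: uniformly_locally_path_connected_Un)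
  have KX: "?K \<subseteq> X" using d by auto
  have fK: "continuous_on ?K f" by (rule continuous_on_subset[OF f(1) KX])
  have fKX: "f ` ?K \<subseteq> X" by (rule subset_trans[OF image_mono[OF KX] f(2)])
  obtain \<epsilon> where \<epsilon>: "0 < \<epsilon>" "\<epsilon> < 1" "f ` ?K \<inter> h ` {0<..<\<epsilon>} = {}"
    by (rule uniformly_locally_path_connected_image_misses_left_end[OF nd K fK fKX])
  \<comment> \<open>A point of \<open>M\<close> this far left has a preimage in \<open>M\<close>,
    which cannot lie in \<open>?K\<close> and so lies in the tail below \<open>d/2\<close>.\<close>
  have "M \<inter> h ` {0<..<min c \<epsilon>} \<noteq> {}"
    using meets c \<epsilon> by (metis min_less_iff_conj min_less_iff_disj)
  then obtain t where t: "h t \<in> M" "0 < t" "t < c" "t < \<epsilon>" by auto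
  then obtain y where y: "y \<in> M" "f y = h t" using minimal_for_image[OF M(3)] by (metis imageE)
  have "f y \<in> h ` {0<..<\<epsilon>}" using y t by auto
  then have "y \<notin> ?K" using \<epsilon>(3) by blast
  then obtain s where s: "y = h s" "0 < s" "s < d/2" using y(1) M(2) by force
  have "f (h s') \<in> h ` {0<..<c}" if s': "0 < s'" "s' < d" for s'
  proof (rule ccontr)
    assume out: "f (h s') \<notin> h ` {0<..<c}"
    let ?g = "(f \<circ> h) \<circ> linepath s s'"
    have seg: "closed_segment s s' \<subseteq> {0<..<d}"
      using s s' d by (auto simp: closed_segment_eq_real_ivl)
    have "continuous_on {0<..<d} (f \<circ> h)"
      using d by (intro continuous_on_compose continuous_on_subset[OF continuous_h] continuous_on_subset[OF f(1)]) auto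
    then have "path ?g"
      using seg by (intro path_continuous_image) (auto intro: continuous_on_subset)
    have im: "path_image ?g = (f \<circ> h) ` closed_segment s s'" by (simp add: path_image_compose)
    have sub: "path_image ?g \<subseteq> (f \<circ> h) ` {0<..<d}" unfolding im using seg by (rule image_mono)
    also have "\<dots> \<subseteq> f ` X" using d by auto
    finally have "path_image ?g \<subseteq> X" using f(2) by blast
    moreover have "pathstart ?g = h t" using s y by (simp add: pathstart_compose)
    moreover have "f (h s') \<in> path_image ?g" unfolding im by auto
    ultimately have "h c \<in> path_image ?g"
      using path_crosses[OF nd \<open>path ?g\<close> _ _ t(2,3) c(3) _ out] by blast
    then have "h c \<in> (f \<circ> h) ` {0<..<d}" by (rule subsetD[OF sub])
    then obtain w where "w \<in> {0<..<d}" "h c = (f \<circ> h) w" by (rule imageE)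
    then have w: "0 < w" "w < d" "f (h w) = h c" by auto
    then have "h w \<in> C" unfolding C_def using d by auto
    then show False using d(3) w by auto
  qed
  then have "f ` h ` {0<..d/2} \<subseteq> L \<union> h ` {0<..c}" using d by force
  moreover have "closure (h ` {0<..d/2}) = L \<union> h ` {0<..d/2}" using d by (intro closure_left) auto
  moreover have "continuous_on (L \<union> h ` {0<..d/2}) f"
    using d by (intro continuous_on_subset[OF f(1)]) auto
  ultimately have "f ` (L \<union> h ` {0<..d/2}) \<subseteq> L \<union> h ` {0<..c}"
    using image_closure_subset[of "h ` {0<..d/2}" f "L \<union> h ` {0<..c}"] closed_left[of c] c by simp
  moreover have "h ` {0<..c} \<subseteq> h ` {0<..<a0}" using c by auto
  \<comment> \<open>The image of \<open>L\<close> lies in \<open>L\<close> and the tail up to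
    \<open>c\<close>, while it misses the longer tail below \<open>a0\<close>.\<close>
  ultimately have "f ` L \<subseteq> L" using a0(3) by blast
  moreover have "M \<inter> L \<noteq> {}"
  proof
    assume "M \<inter> L = {}"
    then obtain a where "0 < a" "a < 1" "M \<inter> h ` {0<..<a} = {}" by (rule avoid_left[OF closedM])
    then show False using meets by blast
  qed
  ultimately have "M \<subseteq> L" using closed_LR(1) closedM by (intro minimal_for_subset[OF M(3)]) auto
  then show False using t h_notin(1)[of t] c by auto
qed

text \<open>With \<open>f\<close> the identity and \<open>Q\<close> the domain of \<open>f\<close> this is a retraction of \<open>X\<close>.\<close>

lemma extend_to_X:
  fixes f :: "'b \<Rightarrow> 'b"
  assumes r: "R = {r}" "r \<in> L" and a: "0 < a" "a < 1"
    and f: "continuous_on (L \<union> (R \<union> h ` {a..<1})) f" "f ` (L \<union> (R \<union> h ` {a..<1})) \<subseteq> Q"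
    and Q: "uniformly_locally_path_connected Q" "path_connected Q"
  obtains F where "continuous_on X F" "F ` X \<subseteq> Q" "\<And>x. x \<in> L \<union> (R \<union> h ` {a..<1}) \<Longrightarrow> F x = f x"
proof -
  have ha: "h a \<in> L \<union> (R \<union> h ` {a..<1})" using a by auto
  obtain G where G: "continuous_on (L \<union> h ` {0<..a}) G" "G ` (L \<union> h ` {0<..a}) \<subseteq> Q"
    "\<And>x. x \<in> L \<Longrightarrow> G x = f x" "G (h a) = f (h a)"
    using extend_left[OF Q, of f a "f (h a)"] f a ha by (metis (no_types, lifting) continuous_on_subset
        image_subset_iff sup_ge1 UnI1)
  let ?F = "\<lambda>x. if x \<in> L \<union> h ` {0<..a} then G x else f x"
  have "continuous_on X ?F"
    using G f(1) by (intro glue_at a) (auto intro: continuous_on_subset)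
  moreover have "?F ` X \<subseteq> Q"
    unfolding split_X[OF a] using G(2) f(2) by auto
  moreover have "?F x = f x" if "x \<in> L \<union> (R \<union> h ` {a..<1})" for x
  proof (cases "x \<in> L \<union> h ` {0<..a}")
    case True
    then have "x \<in> L \<or> x = h a" using that left_Int_right[of a x] a r by auto
    then show ?thesis using True G by auto
  qed simp
  ultimately show thesis by (rule that)
qed

lemma arc_union_properties:
  assumes "R = {r}" "r \<in> L" "0 < a" "a < 1" "uniformly_locally_path_connected L" "path_connected L"
  shows "uniformly_locally_path_connected (L \<union> (R \<union> h ` {a..<1}))" "path_connected (L \<union> (R \<union> h ` {a..<1}))"
proof -
  note arc = right_arc_properties[OF assms(1,3,4)]
  show "uniformly_locally_path_connected (L \<union> (R \<union> h ` {a..<1}))"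
    by (rule uniformly_locally_path_connected_Un[OF compact_L assms(5) arc(1,3)])
  show "path_connected (L \<union> (R \<union> h ` {a..<1}))"
    by (rule path_connected_Un[OF assms(6) arc(2)]) (use assms(1,2) in auto)
qed

text \<open>\<open>f\<close> may move points of \<open>L\<close> and the arc off this set, so it is
  followed by a retraction; on \<open>M\<close> this changes nothing because \<open>M\<close> is
  mapped onto itself. The converse extends the given map over the missing left tail.\<close>

lemma min_set_right_point_in_L:
  assumes nd: "nondegenerate L" and r: "R = {r}" "r \<in> L" and L: "uniformly_locally_path_connected L" "path_connected L"
  shows "min_set X M \<longleftrightarrow> (\<exists>a. 0 < a \<and> a < 1 \<and> min_set (L \<union> (R \<union> h ` {a..<1})) M)"
proof
  assume "min_set X M"
  then obtain f where f: "M \<noteq> {}" "compact M" "M \<subseteq> X" "continuous_on X f" "f ` X \<subseteq> X" "minimal_for f M"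
    by (rule min_setE)
  obtain a where a: "0 < a" "a < 1" "M \<inter> h ` {0<..<a} = {}"
    by (rule minimal_misses_left_end[OF nd r(1) L(1) f(4,5,2,3,6)])
  let ?P = "L \<union> (R \<union> h ` {a..<1})"
  have "{0<..<1} = {0<..<a} \<union> {a..<1}" using a by auto
  then have "J = h ` {0<..<a} \<union> h ` {a..<1}" by (simp only: image_Un)
  with f(3) have "M \<subseteq> L \<union> (h ` {0<..<a} \<union> h ` {a..<1}) \<union> R" by (simp only:)
  then have MP: "M \<subseteq> ?P" using a(3) by blast
  obtain \<rho> where \<rho>: "continuous_on X \<rho>" "\<rho> ` X \<subseteq> ?P" "\<And>x. x \<in> ?P \<Longrightarrow> \<rho> x = x"
    by (rule extend_to_X[OF r a(1,2) continuous_on_id _ arc_union_properties[OF r a(1,2) L]]) auto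
  have PX: "?P \<subseteq> X" using a by auto
  have "min_set ?P M"
  proof (rule min_setI[OF f(1,2) MP f(6)])
    have fP: "f ` ?P \<subseteq> X" by (rule subset_trans[OF image_mono[OF PX] f(5)])
    show "continuous_on ?P (\<rho> \<circ> f)"
      using continuous_on_subset[OF f(4) PX] continuous_on_subset[OF \<rho>(1) fP]
      by (rule continuous_on_compose)
    show "(\<rho> \<circ> f) ` ?P \<subseteq> ?P"
      unfolding image_comp[symmetric] by (rule subset_trans[OF image_mono[OF fP] \<rho>(2)])
    show "(\<rho> \<circ> f) x = f x" if "x \<in> M" for x
    proof -
      have "f x \<in> M" using that minimal_for_image[OF f(6)] by blast
      then show ?thesis using MP \<rho>(3) by auto
    qed
  qed
  with a show "\<exists>a. 0 < a \<and> a < 1 \<and> min_set (L \<union> (R \<union> h ` {a..<1})) M" by blast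
next
  assume "\<exists>a. 0 < a \<and> a < 1 \<and> min_set (L \<union> (R \<union> h ` {a..<1})) M"
  then obtain a where a: "0 < a" "a < 1" "min_set (L \<union> (R \<union> h ` {a..<1})) M" by blast
  let ?P = "L \<union> (R \<union> h ` {a..<1})"
  obtain f where f: "M \<noteq> {}" "compact M" "M \<subseteq> ?P" "continuous_on ?P f" "f ` ?P \<subseteq> ?P" "minimal_for f M"
    using a(3) by (rule min_setE)
  obtain F where F: "continuous_on X F" "F ` X \<subseteq> ?P" "\<And>x. x \<in> ?P \<Longrightarrow> F x = f x"
    using extend_to_X[OF r a(1,2) f(4,5) arc_union_properties[OF r a(1,2) L]] by blast
  have PX: "?P \<subseteq> X" using a by auto
  show "min_set X M"
    by (rule min_setI[OF f(1,2) _ f(6) F(1)]) (use f(3) F PX in blast)+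
qed

end

subsection \<open>Cases (2) to (4)\<close>

lemma subset_image_target: "f ` M = M \<Longrightarrow> M \<subseteq> S \<Longrightarrow> f ` S \<subseteq> T \<Longrightarrow> M \<subseteq> T"
  by blast

context two_ended_interval
begin

section \<open>Minimal sets of the parts are minimal sets of \<open>X\<close>\<close>

text \<open>The extension takes the value \<open>l\<close> at \<open>h (1/2)\<close> and is constant
  on the right half and on \<open>R\<close>. Disjointness keeps this constant from clashing with
  \<open>f\<close> on \<open>L \<inter> R\<close>.\<close>

lemma min_set_left:
  assumes "L \<inter> R = {}" and L: "uniformly_locally_path_connected L" "path_connected L" and "min_set L M"
  shows "min_set X M"
proof -
  obtain f where f: "M \<noteq> {}" "compact M" "M \<subseteq> L" "continuous_on L f" "f ` L \<subseteq> L" "minimal_for f M"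
    using assms(4) by (rule min_setE)
  obtain l where l: "l \<in> L" using L_nonempty by blast
  obtain F where F: "continuous_on (L \<union> h ` {0<..1/2}) F" "F ` (L \<union> h ` {0<..1/2}) \<subseteq> L"
    "\<And>x. x \<in> L \<Longrightarrow> F x = f x" "F (h (1/2)) = l"
    by (rule extend_left[OF L f(4,5) _ _ l, of "1/2"]) auto
  let ?F = "\<lambda>x. if x \<in> L \<union> h ` {0<..1/2} then F x else l"
  have "continuous_on X ?F"
    using F(4) assms(1) by (intro glue_at F(1) continuous_on_const) auto
  moreover have "?F ` X \<subseteq> X" using F(2) l by auto
  moreover have "?F x = f x" if "x \<in> M" for x using that f(3) F(3) by auto
  moreover have "M \<subseteq> X" using f(3) by blast
  ultimately show ?thesis
    using min_setI[OF f(1,2) _ f(6)] by blast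
qed

text \<open>A compact \<open>M\<close> away from \<open>L\<close> misses a left tail, so
  \<open>f\<close> can be preceded by the retraction of \<open>X\<close> that collapses
  \<open>L\<close> and that tail to \<open>h a\<close>.\<close>

lemma min_set_J_R:
  assumes "L \<inter> R = {}" "min_set (J \<union> R) M"
  shows "min_set X M"
proof -
  obtain f where f: "M \<noteq> {}" "compact M" "M \<subseteq> J \<union> R" "continuous_on (J \<union> R) f" "f ` (J \<union> R) \<subseteq> J \<union> R"
      "minimal_for f M"
    using assms(2) by (rule min_setE)
  have "M \<inter> L = {}" using f(3) assms(1) disjoint_L by blast
  then obtain a where a: "0 < a" "a < 1" "M \<inter> h ` {0<..<a} = {}"
    by (rule avoid_left[OF compact_imp_closed[OF f(2)]])
  define \<rho> where "\<rho> x = (if x \<in> L \<union> h ` {0<..a} then h a else x)" for x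
  have \<rho>: "continuous_on X \<rho>" unfolding \<rho>_def
    using assms(1) a by (intro glue_at continuous_on_const continuous_on_id) auto
  have \<rho>X: "\<rho> ` X \<subseteq> J \<union> R" using a by (auto simp: \<rho>_def)
  show ?thesis
  proof (rule min_setI[OF f(1,2) _ f(6)])
    show "continuous_on X (f \<circ> \<rho>)"
      by (rule continuous_on_compose[OF \<rho> continuous_on_subset[OF f(4) \<rho>X]])
    have "f ` \<rho> ` X \<subseteq> J \<union> R" by (rule subset_trans[OF image_mono[OF \<rho>X] f(5)])
    then show "(f \<circ> \<rho>) ` X \<subseteq> X" unfolding image_comp by blast
    show "(f \<circ> \<rho>) x = f x" if "x \<in> M" for x
    proof -
      have "x \<notin> L" "x \<notin> h ` {0<..<a}" using that \<open>M \<inter> L = {}\<close> a(3) by auto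
      moreover have "{0<..a} = insert a {0<..<a}" using a by auto
      then have "x \<in> h ` {0<..a} \<Longrightarrow> x \<in> h ` {0<..<a} \<or> x = h a" by (simp only: image_insert insert_iff) blast
      ultimately show ?thesis by (auto simp: \<rho>_def)
    qed
  qed (use f(3) in auto)
qed

text \<open>\<open>M\<close> lies in the segment from \<open>h a\<close> to \<open>h b\<close>,
  where \<open>f\<close> is kept. To the left and on \<open>L\<close> the map is frozen at
  \<open>f (h a)\<close>. As \<open>L\<close> and \<open>R\<close> may meet, \<open>R\<close> gets
  the same constant; so between \<open>b\<close> and \<open>b'\<close> the map returns inside
  \<open>J\<close> from \<open>f (h b)\<close> to \<open>f (h a)\<close>.\<close>

lemma min_set_J:
  assumes "min_set J M"
  shows "min_set X M"
proof -
  obtain f where f: "M \<noteq> {}" "compact M" "M \<subseteq> J" "continuous_on J f" "f ` J \<subseteq> J" "minimal_for f M"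
    using assms by (rule min_setE)
  have "compact (k ` M)"
    using f(2,3) by (intro compact_continuous_image continuous_on_subset[OF continuous_k])
  moreover have "k ` M \<noteq> {}" using f(1) by simp
  ultimately obtain a b where ab: "a \<in> k ` M" "b \<in> k ` M" "\<And>y. y \<in> k ` M \<Longrightarrow> a \<le> y \<and> y \<le> b"
    by (meson compact_attains_inf compact_attains_sup)
  have k01: "0 < y \<and> y < 1" if "y \<in> k ` M" for y using that f(3) k_in by blast
  have a: "0 < a" "a \<le> b" "b < 1" using ab k01 by auto
  define b' where "b' = (b + 1) / 2"
  have b': "b < b'" "b' < 1" using a by (auto simp: b'_def)
  define p q where "p = k (f (h b))" and "q = k (f (h a))"
  have fJ: "f x \<in> J" if "x \<in> J" for x using f(5) that by blast
  have pq: "0 < p" "p < 1" "0 < q" "q < 1" "h p = f (h b)" "h q = f (h a)"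
    using k_in[OF fJ[of "h a"]] k_in[OF fJ[of "h b"]] h_k[OF fJ[of "h a"]] h_k[OF fJ[of "h b"]] a
    by (auto simp: p_def q_def)
  define \<psi> where "\<psi> t = h (p + (q - p) * ((t - b) / (b' - b)))" for t
  have lin: "p + (q - p) * ((t - b) / (b' - b)) \<in> {0<..<1}" if "t \<in> {b..b'}" for t
  proof -
    define w where "w = (t - b) / (b' - b)"
    have "0 \<le> w" "w \<le> 1" using that b' by (auto simp: w_def field_simps)
    then have "(1 - w) * p + w * q \<in> {0<..<1}"
      using convexD_alt[of "{0<..<1::real}" p q w] pq by simp
    moreover have "(1 - w) * p + w * q = p + (q - p) * w" by (simp add: algebra_simps)
    ultimately show ?thesis by (simp add: w_def)
  qed
  have \<psi>c: "continuous_on {b..b'} \<psi>"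
    unfolding \<psi>_def
  proof (rule continuous_on_compose2[OF continuous_h])
    show "continuous_on {b..b'} (\<lambda>t. p + (q - p) * ((t - b) / (b' - b)))"
      using b' by (intro continuous_intros) auto
  qed (use lin in blast)
  have \<psi>J: "\<psi> t \<in> J" if "t \<in> {b..b'}" for t unfolding \<psi>_def using lin[OF that] by (rule imageI)
  have \<psi>b: "\<psi> b = f (h b)" "\<psi> b' = f (h a)" using b' pq by (simp_all add: \<psi>_def)
  define E where "E = (L \<union> h ` {0<..a}) \<union> (R \<union> h ` {b'..<1})"
  define S where "S = h ` {a..b}"
  define T where "T = h ` {b..b'}"
  have clo: "closed E" "closed S" "closed T"
    unfolding E_def S_def T_def using a b'
    by (auto intro!: closed_Un closed_segment_image closed_left closed_right simp del: Un_assoc)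
  have SJ: "S \<subseteq> J" "T \<subseteq> J" unfolding S_def T_def using a b' by auto
  have "{0<..<1} = {0<..a} \<union> {a..b} \<union> {b..b'} \<union> {b'..<1}" using a b' by auto
  then have Jeq: "J = h ` {0<..a} \<union> S \<union> T \<union> h ` {b'..<1}" unfolding S_def T_def by (simp only: image_Un)
  then have Xeq: "X = (S \<union> T) \<union> E" unfolding E_def by blast
  have E_iff: "h t \<in> E \<longleftrightarrow> t \<le> a \<or> b' \<le> t" if "0 < t" "t < 1" for t
  proof -
    have "h t \<in> h ` {0<..a} \<longleftrightarrow> t \<in> {0<..a}" "h t \<in> h ` {b'..<1} \<longleftrightarrow> t \<in> {b'..<1}"
      using that a b' by (intro h_mem_image; auto)+
    then show ?thesis using that h_notin[of t] by (auto simp: E_def)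
  qed
  have S_iff: "h t \<in> S \<longleftrightarrow> a \<le> t \<and> t \<le> b" if "0 < t" "t < 1" for t
  proof -
    have "h t \<in> h ` {a..b} \<longleftrightarrow> t \<in> {a..b}" using that a by (intro h_mem_image) auto
    then show ?thesis by (simp add: S_def)
  qed
  define F1 where "F1 x = (if x \<in> S then f x else \<psi> (k x))" for x
  define F where "F x = (if x \<in> S \<union> T then F1 x else f (h a))" for x
  have "continuous_on T (\<lambda>x. \<psi> (k x))"
    using SJ by (intro continuous_on_compose2[OF \<psi>c] continuous_on_subset[OF continuous_k])
      (use a b' in \<open>auto simp: T_def\<close>)
  moreover have "f x = \<psi> (k x)" if x: "x \<in> S" "x \<in> T" for x
  proof -
    obtain t where t: "x = h t" "b \<le> t" "t \<le> b'" using x(2) by (auto simp: T_def)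
    then have "t = b" using x(1) S_iff[of t] a b' by auto
    then show ?thesis using t \<psi>b a by simp
  qed
  ultimately have "continuous_on (S \<union> T) F1"
    unfolding F1_def using SJ continuous_on_subset[OF f(4)] clo
    by (intro continuous_on_cases) auto
  moreover have "F1 x = f (h a)" if x: "x \<in> S \<union> T" "x \<in> E" for x
  proof -
    obtain t where t: "x = h t" "a \<le> t" "t \<le> b'"
      using x(1) a b' by (auto simp: S_def T_def)
    then have "t = a \<or> t = b'" using x(2) E_iff[of t] a b' by auto
    then show ?thesis
      using t S_iff[of t] a b' \<psi>b by (auto simp: F1_def)
  qed
  ultimately have "continuous_on ((S \<union> T) \<union> E) F"
    unfolding F_def using clo by (intro continuous_on_cases) auto
  then have "continuous_on X F" by (simp only: Xeq)
  moreover have "F x \<in> J" for x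
  proof -
    have "\<psi> (k x) \<in> J" if "x \<in> T"
    proof -
      obtain t where "x = h t" "t \<in> {b..b'}" using \<open>x \<in> T\<close> unfolding T_def by blast
      then show ?thesis using \<psi>J[of t] a b' by simp
    qed
    moreover have "f x \<in> J" if "x \<in> S" using fJ SJ(1) that by blast
    moreover have "f (h a) \<in> J" using a by (intro fJ) auto
    ultimately show ?thesis by (auto simp: F_def F1_def)
  qed
  then have "F ` X \<subseteq> X" by blast
  moreover have "F x = f x" if "x \<in> M" for x
  proof -
    have "h (k x) = x" "k x \<in> {a..b}" using that f(3) ab(3) h_k by auto
    then have "x \<in> S" unfolding S_def by (metis imageI)
    then show ?thesis by (simp add: F_def F1_def)
  qed
  ultimately show ?thesis
    by (intro min_setI[OF f(1,2) _ f(6)]) (use f(3) in blast)+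
qed

text \<open>As the ends meet, \<open>L \<union> R\<close> is a Peano continuum. So \<open>f\<close>
  extends over each half of \<open>J\<close> with values in it and a common value \<open>l\<close>
  at the middle; on \<open>L \<inter> R\<close> both extensions equal \<open>f\<close>.\<close>

lemma min_set_ends_meet:
  assumes "L \<inter> R \<noteq> {}" and L: "uniformly_locally_path_connected L" "path_connected L" and R: "uniformly_locally_path_connected R" "path_connected R"
    and "min_set (L \<union> R) M"
  shows "min_set X M"
proof -
  interpret F: two_ended_interval R L "\<lambda>t. h (1 - t)" "\<lambda>x. 1 - k x" by (rule flip)
  obtain f where f: "M \<noteq> {}" "compact M" "M \<subseteq> L \<union> R" "continuous_on (L \<union> R) f" "f ` (L \<union> R) \<subseteq> L \<union> R"
      "minimal_for f M"
    using assms(6) by (rule min_setE)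
  have P: "uniformly_locally_path_connected (L \<union> R)" "path_connected (L \<union> R)"
    using uniformly_locally_path_connected_Un[OF compact_L L(1) compact_R R(1)] path_connected_Un[OF L(2) R(2) assms(1)] by auto
  obtain l where l: "l \<in> L \<union> R" using L_nonempty by blast
  have fL: "continuous_on L f" "f ` L \<subseteq> L \<union> R" and fR: "continuous_on R f" "f ` R \<subseteq> L \<union> R"
    using f(5) by (auto intro: continuous_on_subset[OF f(4)])
  obtain F where F: "continuous_on (L \<union> h ` {0<..1/2}) F" "F ` (L \<union> h ` {0<..1/2}) \<subseteq> L \<union> R"
    "\<And>x. x \<in> L \<Longrightarrow> F x = f x" "F (h (1/2)) = l"
    by (rule extend_left[OF P fL _ _ l, of "1/2"]) auto
  have eq: "(\<lambda>t. h (1 - t)) ` {0<..1/2} = h ` {1/2..<1}"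
    by (auto simp: image_iff intro!: bexI[of _ "1 - _"])
  have "\<exists>G. continuous_on (R \<union> (\<lambda>t. h (1 - t)) ` {0<..1/2}) G \<and>
      G ` (R \<union> (\<lambda>t. h (1 - t)) ` {0<..1/2}) \<subseteq> L \<union> R \<and>
      (\<forall>x\<in>R. G x = f x) \<and> G (h (1 - 1/2)) = l"
    by (rule F.extend_left[OF P fR _ _ l, of "1/2"]) auto
  then obtain G where G: "continuous_on (R \<union> h ` {1/2..<1}) G" "G ` (R \<union> h ` {1/2..<1}) \<subseteq> L \<union> R"
    "\<And>x. x \<in> R \<Longrightarrow> G x = f x" "G (h (1/2)) = l"
    unfolding eq by auto
  let ?F = "\<lambda>x. if x \<in> L \<union> h ` {0<..1/2} then F x else G x"
  have "continuous_on X ?F"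
    by (rule glue_at[OF _ _ F(1) G(1)]) (use F(3,4) G(3,4) in auto)
  moreover have "?F ` X \<subseteq> L \<union> R"
  proof -
    have "?F x \<in> L \<union> R" if x: "x \<in> X" for x
    proof (cases "x \<in> L \<union> h ` {0<..1/2}")
      case True
      then have "F x \<in> L \<union> R" by (rule subsetD[OF F(2) imageI])
      then show ?thesis using True by simp
    next
      case False
      then have "x \<in> R \<union> h ` {1/2..<1}" using x split_X[of "1/2"] by auto
      then have "G x \<in> L \<union> R" by (rule subsetD[OF G(2) imageI])
      then show ?thesis using False by simp
    qed
    then show ?thesis by blast
  qed
  moreover have "?F x = f x" if "x \<in> M" for x
  proof (cases "x \<in> L")
    case False
    then have "x \<in> R" using that f(3) by auto
    moreover have "x \<notin> h ` {0<..1/2}" using \<open>x \<in> R\<close> disjoint_R by auto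
    ultimately show ?thesis using False G(3) by simp
  qed (simp add: F(3))
  ultimately show ?thesis
    by (intro min_setI[OF f(1,2) _ f(6)]) (use f(3) in blast)+
qed

section \<open>Locating a minimal set by path components\<close>

text \<open>If the dense component \<open>J \<union> R\<close> is sent into the closed set
  \<open>L\<close>, so is all of \<open>X\<close>. If both components are kept, \<open>M\<close>
  misses \<open>L\<close> or is absorbed by it. If \<open>L\<close> is sent into
  \<open>J \<union> R\<close> and \<open>J \<union> R\<close> is kept, the image of \<open>X\<close>
  lies in \<open>J \<union> R\<close>.\<close>

lemma min_set_cases_point:
  assumes nd: "nondegenerate L" and r: "R = {r}" "L \<inter> R = {}" and L: "path_connected L"
    and "min_set X M"
  shows "min_set L M \<or> min_set (J \<union> R) M"
proof -
  obtain f where f: "M \<noteq> {}" "compact M" "M \<subseteq> X" "continuous_on X f" "f ` X \<subseteq> X" "minimal_for f M"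
    using assms(5) by (rule min_setE)
  have fM: "f ` M = M" using f(6) by (rule minimal_for_image)
  have comp: "f ` S \<subseteq> L \<or> f ` S \<subseteq> J \<union> R" if "path_connected S" "S \<subseteq> X" for S
  proof (rule path_connected_avoids_L[OF nd r(2)])
    show "path_connected (f ` S)"
      by (rule path_connected_continuous_image[OF continuous_on_subset[OF f(4) that(2)] that(1)])
    show "f ` S \<subseteq> X" by (rule subset_trans[OF image_mono[OF that(2)] f(5)])
  qed
  have LX: "L \<subseteq> X" and JRX: "J \<union> R \<subseteq> X" by auto
  note toL = min_set_subset[OF f(1,2) _ LX f(6,4)] and toJR = min_set_subset[OF f(1,2) _ JRX f(6,4)]
  from comp[OF path_connected_JR[OF r(1)] JRX] show ?thesis
  proof
    assume "f ` (J \<union> R) \<subseteq> L"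
    then have "f ` J \<subseteq> L" by (simp add: image_Un)
    then have *: "f ` X \<subseteq> L" by (rule image_J_closed[OF f(4) closed_LR(1)])
    have "M \<subseteq> L" by (rule subset_image_target[OF fM f(3) *])
    moreover have "f ` L \<subseteq> L" by (rule subset_trans[OF image_mono *]) blast
    ultimately show ?thesis using toL by blast
  next
    assume JR: "f ` (J \<union> R) \<subseteq> J \<union> R"
    from comp[OF L LX] show ?thesis
    proof
      assume fL: "f ` L \<subseteq> L"
      show ?thesis
      proof (cases "M \<inter> L = {}")
        case True
        then have "M \<subseteq> J \<union> R" using f(3) by blast
        then show ?thesis using toJR JR by blast
      next
        case False
        then have "M \<subseteq> L"
          using fL by (intro minimal_for_subset[OF f(6) compact_imp_closed[OF f(2)] closed_LR(1)]) auto
        then show ?thesis using toL fL by blast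
      qed
    next
      assume fL: "f ` L \<subseteq> J \<union> R"
      have "f ` X \<subseteq> J \<union> R" using fL JR by (simp add: image_Un)
      then have "M \<subseteq> J \<union> R" by (rule subset_image_target[OF fM f(3)])
      then show ?thesis using toJR JR by blast
    qed
  qed
qed

lemma min_set_cases_meet:
  assumes nd: "nondegenerate L" "nondegenerate R" and "L \<inter> R \<noteq> {}" "path_connected L" "path_connected R"
    and "min_set X M"
  shows "min_set (L \<union> R) M \<or> min_set J M"
proof -
  obtain f where f: "M \<noteq> {}" "compact M" "M \<subseteq> X" "continuous_on X f" "f ` X \<subseteq> X" "minimal_for f M"
    using assms(6) by (rule min_setE)
  have fM: "f ` M = M" using f(6) by (rule minimal_for_image)
  have comp: "f ` S \<subseteq> J \<or> f ` S \<subseteq> L \<union> R" if "path_connected S" "S \<subseteq> X" for S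
  proof (rule path_connected_J_or_ends[OF nd])
    show "path_connected (f ` S)"
      by (rule path_connected_continuous_image[OF continuous_on_subset[OF f(4) that(2)] that(1)])
    show "f ` S \<subseteq> X" by (rule subset_trans[OF image_mono[OF that(2)] f(5)])
  qed
  have LRX: "L \<union> R \<subseteq> X" and JX: "J \<subseteq> X" by auto
  have LR: "path_connected (L \<union> R)" using assms by (intro path_connected_Un)
  note toLR = min_set_subset[OF f(1,2) _ LRX f(6,4)] and toJ = min_set_subset[OF f(1,2) _ JX f(6,4)]
  from comp[OF path_connected_J JX] show ?thesis
  proof
    assume "f ` J \<subseteq> L \<union> R"
    then have *: "f ` X \<subseteq> L \<union> R" by (rule image_J_closed[OF f(4) closed_LR(3)])
    have "M \<subseteq> L \<union> R" by (rule subset_image_target[OF fM f(3) *])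
    moreover have "f ` (L \<union> R) \<subseteq> L \<union> R" by (rule subset_trans[OF image_mono *]) blast
    ultimately show ?thesis using toLR by blast
  next
    assume J: "f ` J \<subseteq> J"
    from comp[OF LR LRX] show ?thesis
    proof
      assume "f ` (L \<union> R) \<subseteq> J"
      then have "f ` X \<subseteq> J" using J by (simp add: image_Un)
      then have "M \<subseteq> J" by (rule subset_image_target[OF fM f(3)])
      then show ?thesis using toJ J by blast
    next
      assume fLR: "f ` (L \<union> R) \<subseteq> L \<union> R"
      show ?thesis
      proof (cases "M \<inter> (L \<union> R) = {}")
        case True
        then have "M \<subseteq> J" using f(3) by blast
        then show ?thesis using toJ J by blast
      next
        case False
        then have "M \<subseteq> L \<union> R"
          using fLR by (intro minimal_for_subset[OF f(6) compact_imp_closed[OF f(2)] closed_LR(3)]) auto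
        then show ?thesis using toLR fLR by blast
      qed
    qed
  qed
qed

text \<open>Now \<open>J\<close>, \<open>L\<close> and \<open>R\<close> are three path components.
  Suppose \<open>f\<close> keeps \<open>J\<close>. If \<open>M\<close> meets \<open>J\<close>, every
  point of \<open>M\<close> is in \<open>J\<close> after two steps; if \<open>M\<close> misses
  \<open>J\<close> but meets both ends, these are exchanged.\<close>

lemma min_set_cases_disjoint:
  assumes nd: "nondegenerate L" "nondegenerate R" and "L \<inter> R = {}" "path_connected L" "path_connected R"
    and "min_set X M"
  shows "min_set J M \<or> min_set L M \<or> min_set R M \<or> (min_set (L \<union> R) M \<and> M \<inter> L \<approx> M \<inter> R)"
proof -
  interpret F: two_ended_interval R L "\<lambda>t. h (1 - t)" "\<lambda>x. 1 - k x" by (rule flip)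
  have FJ: "(\<lambda>t. h (1 - t)) ` {0<..<1} = J"
    by (auto simp: image_iff intro!: bexI[of _ "1 - _"])
  obtain f where f: "M \<noteq> {}" "compact M" "M \<subseteq> X" "continuous_on X f" "f ` X \<subseteq> X" "minimal_for f M"
    using assms(6) by (rule min_setE)
  have fM: "f ` M = M" using f(6) by (rule minimal_for_image)
  have closedM: "closed M" using f(2) by (rule compact_imp_closed)
  have comp: "f ` S \<subseteq> J \<or> f ` S \<subseteq> L \<or> f ` S \<subseteq> R" if S: "path_connected S" "S \<subseteq> X" for S
  proof -
    have pc: "path_connected (f ` S)"
      by (rule path_connected_continuous_image[OF continuous_on_subset[OF f(4) that(2)] that(1)])
    have sub: "f ` S \<subseteq> X" by (rule subset_trans[OF image_mono[OF that(2)] f(5)])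
    have "f ` S \<subseteq> J \<or> f ` S \<subseteq> L \<union> R" by (rule path_connected_J_or_ends[OF nd pc sub])
    moreover have "f ` S \<subseteq> L \<or> f ` S \<subseteq> J \<union> R" by (rule path_connected_avoids_L[OF nd(1) assms(3) pc sub])
    ultimately show ?thesis using disjoint_L disjoint_R assms(3) by blast
  qed
  have LX: "L \<subseteq> X" and RX: "R \<subseteq> X" and LRX: "L \<union> R \<subseteq> X" and JX: "J \<subseteq> X" by auto
  note toL = min_set_subset[OF f(1,2) _ LX f(6,4)] and toR = min_set_subset[OF f(1,2) _ RX f(6,4)]
    and toLR = min_set_subset[OF f(1,2) _ LRX f(6,4)] and toJ = min_set_subset[OF f(1,2) _ JX f(6,4)]
  have inv: "M \<subseteq> T" if "closed T" "M \<inter> T \<noteq> {}" "f ` T \<subseteq> T" for T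
    by (rule minimal_for_subset[OF f(6) closedM that(1,2)]) (use that(3) in blast)
  consider (J) "f ` J \<subseteq> J" | (L) "f ` J \<subseteq> L" | (R) "f ` J \<subseteq> R"
    using comp[OF path_connected_J JX] by blast
  then show ?thesis
  proof cases
    case L
    then have *: "f ` X \<subseteq> L" by (rule image_J_closed[OF f(4) closed_LR(1)])
    have "M \<subseteq> L" by (rule subset_image_target[OF fM f(3) *])
    moreover have "f ` L \<subseteq> L" by (rule subset_trans[OF image_mono *]) blast
    ultimately show ?thesis using toL by blast
  next
    case R
    then have *: "f ` X \<subseteq> R" by (rule image_J_closed[OF f(4) closed_LR(2)])
    have "M \<subseteq> R" by (rule subset_image_target[OF fM f(3) *])
    moreover have "f ` R \<subseteq> R" by (rule subset_trans[OF image_mono *]) blast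
    ultimately show ?thesis using toR by blast
  next
    case J
    note cL = comp[OF assms(4) LX] and cR = comp[OF assms(5) RX]
    show ?thesis
    proof (cases "M \<inter> J = {}")
      case False
      have noL: "M \<inter> L = {}" if "f ` L \<subseteq> L"
        using inv[OF closed_LR(1) _ that] False disjoint_L by blast
      have noR: "M \<inter> R = {}" if "f ` R \<subseteq> R"
        using inv[OF closed_LR(2) _ that] False disjoint_R by blast
      have noLR: "M \<inter> (L \<union> R) = {}" if "f ` L \<subseteq> R" "f ` R \<subseteq> L"
      proof (rule ccontr)
        assume "M \<inter> (L \<union> R) \<noteq> {}"
        then have "M \<subseteq> L \<union> R" by (rule inv[OF closed_LR(3)]) (use that in blast)
        then show False using False disjoint_L disjoint_R by blast
      qed
      have JJ: "f w \<in> J" if "w \<in> J" for w by (rule subsetD[OF J imageI[OF that]])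
      have fMM: "f w \<in> M" if "w \<in> M" for w using imageI[OF that, of f] by (simp only: fM)
      have LL: "f w \<in> J \<or> f w \<in> R \<and> f ` L \<subseteq> R" if w: "w \<in> M" "w \<in> L" for w
        using cL noL w by blast
      have RR: "f w \<in> J \<or> f w \<in> L \<and> f ` R \<subseteq> L" if w: "w \<in> M" "w \<in> R" for w
        using cR noR w by blast
      \<comment> \<open>A point of \<open>M\<close> in \<open>L\<close> can move to
        \<open>R\<close>, but not back to \<open>L\<close> in the next step: the ends would then be
        exchanged and trap \<open>M\<close> in \<open>L \<union> R\<close>.\<close>
      have ff: "f (f w) \<in> J" if w: "w \<in> M" for w
      proof -
        have "w \<in> J \<or> w \<in> L \<or> w \<in> R" using w f(3) by blast
        moreover have ?thesis if wL: "w \<in> L"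
          using LL[OF w wL] RR[OF fMM[OF w]] JJ noLR w wL by blast
        moreover have ?thesis if wR: "w \<in> R"
          using RR[OF w wR] LL[OF fMM[OF w]] JJ noLR w wR by blast
        ultimately show ?thesis using JJ by blast
      qed
      have "M \<subseteq> J"
      proof
        fix x assume "x \<in> M"
        then obtain y where y: "y \<in> M" "x = f y" using fM by (metis imageE)
        then obtain z where "z \<in> M" "y = f z" using fM by (metis imageE)
        then show "x \<in> J" using ff y by simp
      qed
      then show ?thesis using toJ J by blast
    next
      case True
      then have MLR: "M \<subseteq> L \<union> R" using f(3) by blast
      have img: "f x \<in> L \<union> R" if "x \<in> M" for x using that fM MLR by blast
      show ?thesis
      proof (cases "M \<inter> R = {} \<or> M \<inter> L = {}")
        case True
        then show ?thesis
        proof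
          assume "M \<inter> R = {}"
          then have "M \<subseteq> L" using MLR by blast
          moreover obtain x where "x \<in> M" using f(1) by blast
          ultimately have "f x \<in> L" "x \<in> L" using fM by blast+
          then have "f ` L \<subseteq> L" using cL disjoint_L assms(3) by blast
          then show ?thesis using toL \<open>M \<subseteq> L\<close> by blast
        next
          assume "M \<inter> L = {}"
          then have "M \<subseteq> R" using MLR by blast
          moreover obtain x where "x \<in> M" using f(1) by blast
          ultimately have "f x \<in> R" "x \<in> R" using fM by blast+
          then have "f ` R \<subseteq> R" using cR disjoint_R assms(3) by blast
          then show ?thesis using toR \<open>M \<subseteq> R\<close> by blast
        qed
      next
        case False
        then obtain x y where xy: "x \<in> M" "x \<in> L" "y \<in> M" "y \<in> R" by blast
        have "\<not> f ` L \<subseteq> L"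
          using inv[OF closed_LR(1)] False assms(3) by blast
        moreover have "\<not> f ` L \<subseteq> J" using img[OF xy(1)] xy(2) disjoint_L disjoint_R by blast
        ultimately have fL: "f ` L \<subseteq> R" using cL by blast
        have "\<not> f ` R \<subseteq> R"
          using inv[OF closed_LR(2)] False assms(3) by blast
        moreover have "\<not> f ` R \<subseteq> J" using img[OF xy(3)] xy(4) disjoint_L disjoint_R by blast
        ultimately have fR: "f ` R \<subseteq> L" using cR by blast
        have "f ` (L \<union> R) \<subseteq> L \<union> R" using fL fR by blast
        then have "min_set (L \<union> R) M" using toLR MLR by blast
        \<comment> \<open>Points of \<open>M\<close> in \<open>R\<close> come only from
          \<open>L\<close>, and vice versa; surjectivity of \<open>f\<close> on \<open>M\<close>
          gives the two inclusions behind Schroeder-Bernstein.\<close>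
        moreover have "M \<inter> R \<subseteq> f ` (M \<inter> L)"
        proof
          fix y assume y: "y \<in> M \<inter> R"
          then have "y \<in> f ` M" using fM by blast
          then obtain x where "x \<in> M" "y = f x" by blast
          then show "y \<in> f ` (M \<inter> L)" using y MLR fR assms(3) by blast
        qed
        moreover have "M \<inter> L \<subseteq> f ` (M \<inter> R)"
        proof
          fix y assume y: "y \<in> M \<inter> L"
          then have "y \<in> f ` M" using fM by blast
          then obtain x where "x \<in> M" "y = f x" by blast
          then show "y \<in> f ` (M \<inter> R)" using y MLR fL assms(3) by blast
        qed
        ultimately have "M \<inter> R \<lesssim> M \<inter> L" "M \<inter> L \<lesssim> M \<inter> R"
          using lepoll_trans[OF subset_imp_lepoll image_lepoll] by blast+
        then have "M \<inter> L \<approx> M \<inter> R" by (intro lepoll_antisym)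
        with \<open>min_set (L \<union> R) M\<close> show ?thesis by blast
      qed
    qed
  qed
qed

text \<open>A path inside \<open>A\<close> from \<open>h t\<close> to \<open>r\<close> cannot use
  the nondegenerate left end, so it sweeps everything right of \<open>h t\<close>. Hence
  \<open>A\<close> is determined by its least parameter, which exists by compactness once a point
  missed by \<open>A\<close> gives a lower bound.\<close>

lemma arc_through_right_point:
  assumes nd: "nondegenerate L" and r: "R = {r}"
    and A: "R \<subseteq> A" "A \<subset> R \<union> J" "compact A" "path_connected A" "A \<noteq> R"
  obtains a where "0 < a" "a < 1" "A = R \<union> h ` {a..<1}"
proof -
  have up: "h ` {t..<1} \<subseteq> A" if t: "0 < t" "t < 1" "h t \<in> A" for t
  proof -
    obtain g where g: "path g" "path_image g \<subseteq> A" "pathstart g = h t" "pathfinish g = r"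
      using A(1,4) r t(3) unfolding path_connected_def by blast
    have gX: "path_image g \<subseteq> X" using g(2) A(2) by blast
    have rg: "r \<in> path_image g" "r \<notin> J" using g(4) disjoint_R r by auto
    obtain y where "L = {y} \<and> h ` {0<..t} \<subseteq> path_image g \<or> R = {y} \<and> h ` {t..<1} \<subseteq> path_image g"
      using path_leaves_J[OF g(1) gX g(3) t(1,2) rg] by metis
    moreover have "L \<noteq> {y}" using nd by (auto simp: nondegenerate_def)
    ultimately have "h ` {t..<1} \<subseteq> path_image g" by metis
    then show ?thesis using g(2) by (rule subset_trans)
  qed
  obtain z where z: "z \<in> R \<union> J" "z \<notin> A" using A(2) by blast
  then obtain s where s: "0 < s" "s < 1" "h s \<notin> A" using A(1) by auto
  have low: "s < t" if "0 < t" "t < 1" "h t \<in> A" for t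
    using up[OF that] s by (metis atLeastLessThan_iff imageI not_le subsetD)
  obtain x where "x \<in> A" "x \<in> J" using A by blast
  then obtain t0 where t0: "0 < t0" "t0 < 1" "h t0 \<in> A" by auto
  \<comment> \<open>\<open>k\<close> is a coordinate only on \<open>J\<close>, so the minimum is
    taken over a compact segment that avoids \<open>R\<close>.\<close>
  have "compact (A \<inter> h ` {s..t0})"
    using A(3) s t0 by (intro compact_Int_closed closed_segment_image) auto
  moreover have sJ: "h ` {s..t0} \<subseteq> J" using s t0 by auto
  ultimately have "compact (k ` (A \<inter> h ` {s..t0}))"
    by (intro compact_continuous_image continuous_on_subset[OF continuous_k]) auto
  moreover have "h t0 \<in> A \<inter> h ` {s..t0}" using t0 low[OF t0] by auto
  ultimately obtain a where a: "a \<in> k ` (A \<inter> h ` {s..t0})" "\<And>y. y \<in> k ` (A \<inter> h ` {s..t0}) \<Longrightarrow> a \<le> y"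
    using compact_attains_inf[of "k ` (A \<inter> h ` {s..t0})"] by blast
  then obtain w where w: "w \<in> A" "w \<in> h ` {s..t0}" "a = k w" by blast
  have wJ: "w \<in> J" using w(2) sJ by blast
  have a01: "0 < a" "a < 1" "h a \<in> A" using k_in[OF wJ] h_k[OF wJ] w by auto
  have "a \<le> t0" using a(2)[of "k (h t0)"] \<open>h t0 \<in> A \<inter> _\<close> t0 by (metis imageI k_h)
  have "A \<subseteq> R \<union> h ` {a..<1}"
  proof
    fix x assume "x \<in> A"
    then have "x \<in> R \<or> x \<in> J" using A(2) by blast
    then consider "x \<in> R" | t where "0 < t" "t < 1" "x = h t" by auto
    then show "x \<in> R \<union> h ` {a..<1}"
    proof cases
      case 2
      have "a \<le> t"
      proof (cases "t \<le> t0")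
        case True
        have "s < t" using low 2 \<open>x \<in> A\<close> by blast
        then have "h t \<in> A \<inter> h ` {s..t0}" using True 2 \<open>x \<in> A\<close> by auto
        then have "k (h t) \<in> k ` (A \<inter> h ` {s..t0})" by (rule imageI)
        then show ?thesis using a(2)[of t] 2 by simp
      qed (use \<open>a \<le> t0\<close> in simp)
      then show ?thesis using 2 by auto
    qed simp
  qed
  then have "A = R \<union> h ` {a..<1}" using up[OF a01] A(1) by blast
  then show thesis using that a01 by blast
qed

end

subsection \<open>Embedding into a metric space\<close>

text \<open>The coordinates are the distances to the points of a countable dense set; they separate
  points, and a continuous injection from a compact space into a Hausdorff space is an
  embedding.\<close>

lemma compact_metrizable_embedding:
  assumes "compact_space X" "metrizable_space X" "topspace X \<noteq> {}"
  obtains \<phi> :: "'a \<Rightarrow> nat \<Rightarrow> real" where "homeomorphic_map X (top_of_set (\<phi> ` topspace X)) \<phi>"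
proof -
  obtain M d where M: "Metric_space M d" "X = Metric_space.mtopology M d"
    using assms(2) unfolding metrizable_space_def by blast
  interpret Metric_space M d by (rule M(1))
  have ts: "topspace X = M" by (simp add: M(2))
  have "mtotally_bounded M"
    using assms(1) by (simp add: M(2) compact_space_eq_mcomplete_mtotally_bounded)
  then have "\<exists>K. finite K \<and> K \<subseteq> M \<and> M \<subseteq> (\<Union>x\<in>K. mball x (inverse (real (Suc n))))" for n
    unfolding mtotally_bounded_def by simp
  then obtain K where K: "\<And>n. finite (K n)" "\<And>n. K n \<subseteq> M" "\<And>n. M \<subseteq> (\<Union>x\<in>K n. mball x (inverse (real (Suc n))))"
    by metis
  define D where "D = (\<Union>n. K n)"
  have "countable D" unfolding D_def using K(1) by (auto intro: countable_finite)
  have DM: "D \<subseteq> M" using K(2) by (auto simp: D_def)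
  have dense: "\<exists>a\<in>D. d a x < \<epsilon>" if x: "x \<in> M" "\<epsilon> > 0" for x \<epsilon>
  proof -
    obtain n where n: "inverse (real (Suc n)) < \<epsilon>" using reals_Archimedean[OF x(2)] by auto
    obtain a where "a \<in> K n" "x \<in> mball a (inverse (real (Suc n)))" using K(3)[of n] x(1) by blast
    then show ?thesis using n by (auto simp: D_def in_mball intro!: bexI[of _ a])
  qed
  have "D \<noteq> {}" using dense[of _ 1] assms(3) ts by fastforce
  define s where "s = from_nat_into D"
  have s: "range s = D" unfolding s_def using range_from_nat_into[OF \<open>D \<noteq> {}\<close> \<open>countable D\<close>] .
  define \<phi> where "\<phi> x = (\<lambda>n. d (s n) x)" for x
  have sM: "s n \<in> M" for n using s DM by blast
  have "continuous_map X euclidean (\<lambda>x. d (s n) x)" for n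
  proof -
    have "continuous_map mtopology (Met_TC.mtopology) (\<lambda>x. d (s n) x)"
      unfolding metric_continuous_map[OF Met_TC.Metric_space_axioms]
    proof (intro conjI ballI allI impI)
      fix a \<epsilon> :: real and x assume a: "x \<in> M" "0 < \<epsilon>"
      show "\<exists>\<delta>>0. \<forall>y. y \<in> M \<and> d x y < \<delta> \<longrightarrow> dist (d (s n) x) (d (s n) y) < \<epsilon>"
      proof (intro exI[of _ \<epsilon>] conjI allI impI a(2))
        fix y assume y: "y \<in> M \<and> d x y < \<epsilon>"
        then show "dist (d (s n) x) (d (s n) y) < \<epsilon>"
          using triangle[of "s n" x y] triangle[of "s n" y x] a(1) sM[of n] commute[of x y]
          by (auto simp: dist_real_def)
      qed
    qed simp
    then show ?thesis by (simp add: M(2))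
  qed
  then have "continuous_map X (product_topology (\<lambda>i. euclidean) UNIV) \<phi>"
    unfolding \<phi>_def by (simp add: continuous_map_componentwise_UNIV)
  then have "continuous_map X euclidean \<phi>"
    by (simp add: euclidean_product_topology)
  then have cont: "continuous_map X (top_of_set (\<phi> ` topspace X)) \<phi>"
    by (simp add: continuous_map_in_subtopology image_subset_iff)
  have inj: "inj_on \<phi> (topspace X)"
  proof (rule inj_onI)
    fix x y assume xy: "x \<in> topspace X" "y \<in> topspace X" "\<phi> x = \<phi> y"
    show "x = y"
    proof (rule ccontr)
      assume "x \<noteq> y"
      then have "d x y > 0" using xy ts by simp
      then obtain a where a: "a \<in> D" "d a x < d x y / 2" using dense[of x "d x y / 2"] xy ts by auto
      then obtain n where "a = s n" using s by blast
      then have "d a x = d a y" using fun_cong[OF xy(3), of n] by (simp add: \<phi>_def)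
      then show False using triangle[of x a y] a DM xy ts commute[of a x] by auto
    qed
  qed
  have "homeomorphic_map X (top_of_set (\<phi> ` topspace X)) \<phi>"
    by (rule continuous_imp_homeomorphic_map[OF cont assms(1) _ _ inj])
      (auto intro: Hausdorff_space_subtopology)
  then show thesis by (rule that)
qed

lemma minimal_sets_nonempty_subset:
  assumes "M \<in> minimal_sets Y" shows "M \<noteq> {}" "M \<subseteq> topspace Y"
  using assms compactin_subset_topspace unfolding minimal_sets_def by blast+

lemma minimal_sets_iff:
  assumes "metrizable_space Y"
  shows "M \<in> minimal_sets Y \<longleftrightarrow> M \<noteq> {} \<and> compactin Y M \<and>
    (\<exists>f. continuous_map Y Y f \<and> f ` M = M \<and>
      (\<forall>N. closedin Y N \<longrightarrow> N \<noteq> {} \<longrightarrow> N \<subseteq> M \<longrightarrow> f ` N \<subseteq> N \<longrightarrow> N = M))"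
proof -
  have "minimal_system (subtopology Y M) f \<longleftrightarrow>
      (\<forall>N. closedin Y N \<longrightarrow> N \<noteq> {} \<longrightarrow> N \<subseteq> M \<longrightarrow> f ` N \<subseteq> N \<longrightarrow> N = M)"
    if M: "M \<noteq> {}" "compactin Y M" and f: "continuous_map Y Y f" "f ` M = M" for f
  proof -
    have MY: "M \<subseteq> topspace Y" using M(2) by (rule compactin_subset_topspace)
    then have ts: "topspace (subtopology Y M) = M" by (simp add: Int_absorb1)
    have cl: "closedin Y M"
      using M(2) metrizable_imp_Hausdorff_space[OF assms] by (rule compactin_imp_closedin[rotated])
    have "continuous_map (subtopology Y M) (subtopology Y M) f"
      using continuous_map_from_subtopology[OF f(1)] f(2) ts
      by (auto simp: continuous_map_in_subtopology)
    then show ?thesis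
      unfolding minimal_system_def ts closedin_closed_subtopology[OF cl]
      using M metrizable_space_subtopology[OF assms] compact_space_subtopology[OF M(2)] by blast
  qed
  then show ?thesis unfolding minimal_sets_def mem_Collect_eq by (metis (no_types, lifting))
qed

lemma minimal_sets_top_of_set:
  fixes S :: "'b::metric_space set"
  shows "M \<in> minimal_sets (top_of_set S) \<longleftrightarrow> min_set S M"
proof -
  have met: "metrizable_space (top_of_set S)"
    by (simp add: metrizable_space_subtopology metrizable_space_euclidean)
  have cl: "closedin (top_of_set S) N \<longleftrightarrow> closed N" if "compact M" "M \<subseteq> S" "N \<subseteq> M" for N
  proof
    assume "closedin (top_of_set S) N"
    then have "closedin (top_of_set M) N"
      using that by (meson closedin_subset_trans)
    then show "closed N" using that(1) compact_imp_closed closedin_closed_trans by blast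
  next
    assume "closed N"
    then show "closedin (top_of_set S) N" using that closed_subset by blast
  qed
  have "(\<forall>N. closedin (top_of_set S) N \<longrightarrow> N \<noteq> {} \<longrightarrow> N \<subseteq> M \<longrightarrow> f ` N \<subseteq> N \<longrightarrow> N = M) \<longleftrightarrow>
      (\<forall>N. closed N \<longrightarrow> N \<noteq> {} \<longrightarrow> N \<subseteq> M \<longrightarrow> f ` N \<subseteq> N \<longrightarrow> N = M)" if "compact M" "M \<subseteq> S" for f
    using cl[OF that] by blast
  moreover have "continuous_map (top_of_set S) (top_of_set S) f \<longleftrightarrow> continuous_on S f \<and> f ` S \<subseteq> S" for f
    by (auto simp: continuous_map_in_subtopology image_subset_iff_funcset)
  ultimately show ?thesis
    unfolding minimal_sets_iff[OF met] min_set_def minimal_for_def compactin_subtopology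
    by (auto simp: compactin_euclidean_iff)
qed

lemma homeomorphic_maps_minimal_sets:
  assumes "metrizable_space Y" "metrizable_space Y'" and hm: "homeomorphic_maps Y Y' \<phi> \<psi>"
    and "M \<in> minimal_sets Y"
  shows "\<phi> ` M \<in> minimal_sets Y'"
proof -
  obtain f where M: "M \<noteq> {}" "compactin Y M" and f: "continuous_map Y Y f" "f ` M = M"
     "\<And>N. closedin Y N \<Longrightarrow> N \<noteq> {} \<Longrightarrow> N \<subseteq> M \<Longrightarrow> f ` N \<subseteq> N \<Longrightarrow> N = M"
    using assms(4) unfolding minimal_sets_iff[OF assms(1)] by blast
  have MY: "M \<subseteq> topspace Y" using M(2) by (rule compactin_subset_topspace)
  have c: "continuous_map Y Y' \<phi>" "continuous_map Y' Y \<psi>"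
    and inv: "\<And>x. x \<in> topspace Y \<Longrightarrow> \<psi> (\<phi> x) = x" "\<And>y. y \<in> topspace Y' \<Longrightarrow> \<phi> (\<psi> y) = y"
    using hm by (auto simp: homeomorphic_maps_def)
  let ?f = "\<phi> \<circ> f \<circ> \<psi>"
  have "homeomorphic_map Y' Y \<psi>" using hm homeomorphic_maps_sym homeomorphic_maps_map by blast
  have "continuous_map Y' Y' ?f" using c f(1) by (metis continuous_map_compose)
  moreover have "?f ` \<phi> ` M = \<phi> ` M"
  proof -
    have "(f \<circ> \<psi>) ` \<phi> ` M = f ` M" unfolding image_image
      by (rule image_cong) (use MY inv in auto)
    then show ?thesis using f(2) by (metis image_comp)
  qed
  moreover have "N = \<phi> ` M"
    if N: "closedin Y' N" "N \<noteq> {}" "N \<subseteq> \<phi> ` M" "?f ` N \<subseteq> N" for N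
  proof -
    have NY: "N \<subseteq> topspace Y'" using N(1) by (rule closedin_subset)
    have \<phi>\<psi>: "\<phi> ` \<psi> ` N = N"
      unfolding image_image using inv NY by force
    have "\<psi> ` \<phi> ` M = M" using inv(1) MY by (simp add: image_image subset_iff)
    then have sub: "\<psi> ` N \<subseteq> M" using image_mono[OF N(3), of \<psi>] by simp
    have "closedin Y (\<psi> ` N)"
      using homeomorphic_map_closedness[OF \<open>homeomorphic_map Y' Y \<psi>\<close> NY] N(1) by blast
    moreover have "f ` \<psi> ` N \<subseteq> \<psi> ` N"
    proof
      fix z assume "z \<in> f ` \<psi> ` N"
      then obtain n where n: "n \<in> N" "z = f (\<psi> n)" by auto
      then have "z \<in> topspace Y" using sub f(2) MY by blast
      moreover have "\<phi> z \<in> N" using N(4) n by auto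
      ultimately show "z \<in> \<psi> ` N" using inv(1) by (metis imageI)
    qed
    ultimately have "\<psi> ` N = M" using N(2) sub by (intro f(3)) auto
    then show ?thesis using \<phi>\<psi> by simp
  qed
  moreover have "compactin Y' (\<phi> ` M)" using M(2) c(1) by (rule image_compactin)
  ultimately show ?thesis
    unfolding minimal_sets_iff[OF assms(2)] using M(1) by (intro conjI exI[of _ ?f]) auto
qed

text \<open>\<open>M \<subseteq> topspace X\<close> appears on the right because
  \<open>\<phi>\<close> is known to be injective only on \<open>topspace X\<close>: points outside
  could share images with points of \<open>S\<close>.\<close>

lemma minimal_sets_subtopology_embedded:
  fixes \<phi> :: "'a \<Rightarrow> 'b::metric_space"
  assumes met: "metrizable_space X" and hm: "homeomorphic_map X (top_of_set (\<phi> ` topspace X)) \<phi>"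
    and S: "S \<subseteq> topspace X"
  shows "M \<in> minimal_sets (subtopology X S) \<longleftrightarrow> M \<subseteq> topspace X \<and> min_set (\<phi> ` S) (\<phi> ` M)"
proof -
  have "homeomorphic_map (subtopology X S) (subtopology (top_of_set (\<phi> ` topspace X)) (\<phi> ` S)) \<phi>"
    using S by (intro homeomorphic_map_subtopologies[OF hm]) (auto simp: Int_absorb1)
  then have "homeomorphic_map (subtopology X S) (top_of_set (\<phi> ` S)) \<phi>"
    using S by (simp add: subtopology_subtopology Int_absorb1 image_mono)
  then obtain \<psi> where \<psi>: "homeomorphic_maps (subtopology X S) (top_of_set (\<phi> ` S)) \<phi> \<psi>"
    by (auto simp: homeomorphic_map_maps)
  have met': "metrizable_space (subtopology X S)" "metrizable_space (top_of_set (\<phi> ` S))"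
    by (simp_all add: met metrizable_space_subtopology metrizable_space_euclidean)
  have inj: "inj_on \<phi> (topspace X)" using hm homeomorphic_imp_injective_map by blast
  show ?thesis
    unfolding minimal_sets_top_of_set[symmetric]
  proof
    assume M: "M \<in> minimal_sets (subtopology X S)"
    then have "M \<subseteq> topspace X"
      using minimal_sets_nonempty_subset(2)[OF M] by simp
    with homeomorphic_maps_minimal_sets[OF met' \<psi> M]
    show "M \<subseteq> topspace X \<and> \<phi> ` M \<in> minimal_sets (top_of_set (\<phi> ` S))" by simp
  next
    assume M: "M \<subseteq> topspace X \<and> \<phi> ` M \<in> minimal_sets (top_of_set (\<phi> ` S))"
    then have "\<psi> ` \<phi> ` M \<in> minimal_sets (subtopology X S)"
      using homeomorphic_maps_minimal_sets[OF met'(2,1)] \<psi> homeomorphic_maps_sym by blast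
    moreover have "\<phi> ` M \<subseteq> \<phi> ` S"
      using minimal_sets_nonempty_subset(2)[OF conjunct2[OF M]] by simp
    then have "M \<subseteq> S" using M S inj by (simp add: inj_on_image_subset_iff)
    have "\<psi> (\<phi> x) = x" if "x \<in> S" for x
      using \<psi> S that by (auto simp: homeomorphic_maps_def)
    then have "\<psi> ` \<phi> ` M = M"
      using \<open>M \<subseteq> S\<close> by (simp add: image_image subset_iff)
    ultimately show "M \<in> minimal_sets (subtopology X S)" by simp
  qed
qed

text \<open>\<open>I\<close> is connected with least element \<open>r 0\<close> and has no largest
  one. A supremum below 1 would belong to \<open>I\<close>, which is closed in the open interval; so
  the supremum is 1.\<close>

lemma increasing_ray_in_open_interval:
  fixes r :: "real \<Rightarrow> real"
  assumes I: "I \<subseteq> {0<..<1}" "closedin (top_of_set {0<..<1}) I"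
    and r: "continuous_on {0..} r" "strict_mono_on {0..} r" "r ` {0..} = I"
  obtains a where "0 < a" "a < 1" "I = {a..<1}"
proof -
  have conn: "connected I" unfolding r(3)[symmetric] by (intro connected_continuous_image r(1)) auto
  define a where "a = r 0"
  have a: "a \<in> I" unfolding a_def r(3)[symmetric] by auto
  have ge: "a \<le> x" if x: "x \<in> I" for x
  proof -
    obtain y where "y \<ge> 0" "x = r y" using x r(3) by auto
    then show ?thesis
      using strict_mono_onD[OF r(2), of 0 y] by (cases "y = 0") (auto simp: a_def)
  qed
  have "t \<in> I" if t: "a < t" "t < 1" for t
  proof (rule ccontr)
    assume "t \<notin> I"
    have lt: "x < t" if "x \<in> I" for x
      using connected_contains_Icc[OF conn a that] \<open>t \<notin> I\<close> t(1)
      by (meson atLeastAtMost_iff less_imp_le not_le subsetD)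
    then have bdd: "bdd_above I" by (meson bdd_aboveI less_imp_le)
    define s where "s = Sup I"
    have "s \<in> closure I" unfolding s_def using a bdd by (intro closure_contains_Sup) auto
    moreover have "s \<le> t" unfolding s_def using a lt by (intro cSup_least) (auto intro: less_imp_le)
    moreover have "a \<le> s" unfolding s_def using a bdd by (rule cSup_upper)
    moreover obtain T where "closed T" "I = {0<..<1} \<inter> T" using I(2) by (auto simp: closedin_closed)
    moreover have "closure I \<subseteq> T" using calculation by (intro closure_minimal) auto
    moreover have "0 < a" using a I(1) by auto
    ultimately have "s \<in> I" using t by auto
    then obtain x where x: "x \<ge> 0" "s = r x" using r(3) by auto
    have "r (x + 1) \<in> I" using x r(3) by auto
    then have "r (x + 1) \<le> s" unfolding s_def using bdd by (rule cSup_upper)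
    then show False using strict_mono_onD[OF r(2), of x "x + 1"] x by auto
  qed
  then have "I = {a..<1}" using ge a I(1) by (auto simp: order_le_less)
  moreover have "0 < a" "a < 1" using a I(1) by auto
  ultimately show thesis using that by blast
qed

lemma ray_in_open_interval:
  assumes I: "I \<subseteq> {0<..<1}" "closedin (top_of_set {0<..<1}) I"
    and rs: "homeomorphism {0::real..} I r s"
  obtains a :: real where "0 < a" "a < 1" "I = {a..<1} \<or> I = {0<..a}"
proof -
  have r: "continuous_on {0..} r" "r ` {0..} = I" "inj_on r {0..}"
    using rs unfolding homeomorphism_def by (auto intro: inj_on_inverseI)
  have "is_interval {0::real..}" by (simp add: is_interval_ci)
  then consider "strict_mono_on {0..} r" | "strict_antimono_on {0..} r"
    using injective_eq_monotone_map[of "{0..}" r] r by blast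
  then show thesis
  proof cases
    case 1
    then show thesis
      using increasing_ray_in_open_interval[OF I r(1) _ r(2)] that by metis
  next
    case 2
    let ?I = "(-) 1 ` I"
    have "homeomorphism {0<..<1} {0<..<1} (\<lambda>t::real. 1 - t) (\<lambda>t. 1 - t)"
      unfolding homeomorphism_def by (auto intro!: continuous_intros image_eqI[of _ "(-) 1" "1 - _"])
    then have "closedin (top_of_set {0<..<1}) ?I"
      using homeomorphism_imp_closed_map I(2) by fastforce
    moreover have "?I \<subseteq> {0<..<1}" using I(1) by auto
    moreover have "continuous_on {0..} (\<lambda>t. 1 - r t)" by (intro continuous_intros r(1))
    moreover have "strict_mono_on {0..} (\<lambda>t. 1 - r t)"
      using 2 by (auto simp: monotone_on_def)
    moreover have "(\<lambda>t. 1 - r t) ` {0..} = ?I" using r(2) by (auto simp: image_image)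
    ultimately obtain a where a: "0 < a" "a < 1" "?I = {a..<1}"
      using increasing_ray_in_open_interval[of ?I "\<lambda>t. 1 - r t"] by metis
    have "I = (-) 1 ` ?I" by (simp add: image_image)
    also have "\<dots> = {0<..1 - a}" unfolding a(3) by (auto intro!: image_eqI[of _ "(-) 1" "1 - _"])
    finally show thesis using that[of "1 - a"] a by auto
  qed
qed

lemma (in two_ended_interval) flip_image: "(\<lambda>t. h (1 - t)) ` {0<..<1} = J"
  by (auto simp: image_iff intro!: bexI[of _ "1 - _"])

lemma homeomorphic_space_imp_homeomorphism:
  assumes "top_of_set S homeomorphic_space top_of_set T"
  obtains f g where "homeomorphism S T f g"
proof -
  obtain f g where fg: "continuous_map (top_of_set S) (top_of_set T) f"
      "continuous_map (top_of_set T) (top_of_set S) g" "\<And>x. x \<in> S \<Longrightarrow> g (f x) = x" "\<And>y. y \<in> T \<Longrightarrow> f (g y) = y"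
    using assms unfolding homeomorphic_space_def homeomorphic_maps_def by auto
  have "continuous_on S f" "continuous_on T g" "f ` S \<subseteq> T" "g ` T \<subseteq> S"
    using fg(1,2) by (auto simp: continuous_map_in_subtopology image_subset_iff)
  then show thesis
    using fg(3,4) by (intro that[of f g] homeomorphismI) auto
qed

text \<open>Each ray is the trace on \<open>J\<close> of a compact set, hence closed in
  \<open>J\<close> and, in the coordinate, a tail. The coordinate is arbitrary, so \<open>JL\<close>
  may turn out to be the right tail; then the parameter is reversed.\<close>

lemma class_C_embedded:
  fixes \<phi> :: "'a \<Rightarrow> 'b::metric_space"
  assumes C: "class_C X L J R" and hm: "homeomorphic_map X (top_of_set (\<phi> ` topspace X)) \<phi>"
  obtains h k where "two_ended_interval (\<phi> ` L) (\<phi> ` R) h k" "h ` {0<..<1} = \<phi> ` J"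
proof -
  have TX: "topspace X = L \<union> J \<union> R" and disj: "L \<inter> J = {}" "R \<inter> J = {}"
    and cont: "continuum X" "continuum (subtopology X L)" "continuum (subtopology X R)"
    and J: "subtopology X J homeomorphic_space top_of_set {0<..<1::real}"
    using C by (auto simp: class_C_def disjnt_def free_interval_def)
  obtain JL JR where ray: "ray_in X JL" "ray_in X JR" "J = JL \<union> JR"
      "compactification_with_remainder (subtopology X (L \<union> JL)) JL L"
      "compactification_with_remainder (subtopology X (R \<union> JR)) JR R"
    using C by (auto simp: class_C_def)
  have inj: "inj_on \<phi> (topspace X)" using hm homeomorphic_imp_injective_map by blast
  have hmS: "homeomorphic_map (subtopology X S) (top_of_set (\<phi> ` S)) \<phi>" if "S \<subseteq> topspace X" for S
  proof -
    have "homeomorphic_map (subtopology X S) (subtopology (top_of_set (\<phi> ` topspace X)) (\<phi> ` S)) \<phi>"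
      using that by (intro homeomorphic_map_subtopologies[OF hm]) (auto simp: Int_absorb1)
    then show ?thesis
      using that by (simp add: subtopology_subtopology Int_absorb1 image_mono)
  qed
  have comp: "compact (\<phi> ` S)" if "S \<subseteq> topspace X" "compact_space (subtopology X S)" for S
  proof -
    have "compactin (subtopology X S) S"
      using that by (simp add: compact_space_def Int_absorb1)
    then have "compactin (top_of_set (\<phi> ` S)) (\<phi> ` S)"
      using homeomorphic_map_compactness_eq[OF hmS[OF that(1)]] by blast
    then show ?thesis by (simp add: compactin_subtopology)
  qed
  have hom: "top_of_set (\<phi> ` S) homeomorphic_space U"
    if "S \<subseteq> topspace X" "subtopology X S homeomorphic_space U" for S and U :: "real topology"
    using hmS[OF that(1)] that(2) by (meson homeomorphic_space homeomorphic_space_sym homeomorphic_space_trans)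
  have dj: "\<phi> ` A \<inter> \<phi> ` B = {}" if "A \<inter> B = {}" "A \<subseteq> topspace X" "B \<subseteq> topspace X" for A B
    using inj_on_image_Int[OF inj that(2,3)] that(1) by simp
  have sub: "L \<subseteq> topspace X" "R \<subseteq> topspace X" "J \<subseteq> topspace X" "JL \<subseteq> J" "JR \<subseteq> J"
    using TX ray(3) by auto
  obtain k h where "homeomorphism (\<phi> ` J) {0<..<1::real} k h"
    by (rule homeomorphic_space_imp_homeomorphism[OF hom[OF sub(3) J]])
  then have hk: "homeomorphism {0<..<1} (\<phi> ` J) h k" by (rule homeomorphism_symD)
  then have hJ: "h ` {0<..<1} = \<phi> ` J" and kJ: "k ` \<phi> ` J = {0<..<1}" by (auto simp: homeomorphism_def)
  have ends: "\<exists>a I. 0 < a \<and> a < 1 \<and> (I = {a..<1} \<or> I = {0<..a}) \<and> h ` I = \<phi> ` A \<and> k ` \<phi> ` A = I \<and>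
      closure (h ` I) = \<phi> ` K \<union> h ` I"
    if A: "ray_in X A" "compactification_with_remainder (subtopology X (K \<union> A)) A K" and AJ: "A \<subseteq> J"
      and K: "K \<subseteq> topspace X" "K \<inter> J = {}" for A K
  proof -
    have AX: "A \<subseteq> topspace X" and KA: "K \<union> A \<subseteq> topspace X" using AJ sub(3) K(1) by auto
    have cl: "closed (\<phi> ` (K \<union> A))"
      using comp[OF KA] A(2) by (auto simp: compactification_with_remainder_def intro!: compact_imp_closed)
    have "subtopology X (K \<union> A) closure_of A = K \<union> A"
      using A(2) KA by (auto simp: compactification_with_remainder_def dense_in_def Int_absorb1)
    then have "top_of_set (\<phi> ` (K \<union> A)) closure_of (\<phi> ` A) = \<phi> ` (K \<union> A)"
      using homeomorphic_map_closure_of[OF hmS[OF KA], of A] KA by (simp add: Int_absorb1)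
    then have "\<phi> ` (K \<union> A) \<subseteq> closure (\<phi> ` A)"
      by (metis Int_lower2 closure_of_subtopology euclidean_closure_of image_mono inf.absorb_iff2 le_supI2 order_refl)
    moreover have "closure (\<phi> ` A) \<subseteq> \<phi> ` (K \<union> A)" by (intro closure_minimal cl) auto
    ultimately have cA: "closure (\<phi> ` A) = \<phi> ` K \<union> \<phi> ` A" by auto
    have "\<phi> ` K \<inter> \<phi> ` J = {}" using dj K sub(3) by blast
    then have "\<phi> ` A = \<phi> ` J \<inter> \<phi> ` (K \<union> A)" using AJ by auto
    then have "closedin (top_of_set (\<phi> ` J)) (\<phi> ` A)"
      unfolding closedin_closed using cl by blast
    then have "closedin (top_of_set {0<..<1}) (k ` \<phi> ` A)"
      using homeomorphism_imp_closed_map homeomorphism_symD[OF hk] by blast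
    moreover have kA: "k ` \<phi> ` A \<subseteq> {0<..<1}" using AJ kJ by blast
    moreover obtain r s where rs: "homeomorphism {0::real..} (k ` \<phi> ` A) r s"
    proof -
      have "subtopology X A homeomorphic_space top_of_set {0::real..}"
        using A(1) by (simp add: ray_in_def)
      then obtain p q where "homeomorphism (\<phi> ` A) {0::real..} p q"
        by (rule homeomorphic_space_imp_homeomorphism[OF hom[OF AX]])
      moreover have "homeomorphism (\<phi> ` A) (k ` \<phi> ` A) k h"
        by (rule homeomorphism_of_subsets[OF homeomorphism_symD[OF hk]]) (use AJ in auto)
      ultimately have "homeomorphism {0::real..} (k ` \<phi> ` A) (k \<circ> q) (p \<circ> h)"
        by (meson homeomorphism_compose homeomorphism_symD)
      then show ?thesis by (rule that)
    qed
    ultimately obtain a where a: "0 < a" "a < 1" "k ` \<phi> ` A = {a..<1} \<or> k ` \<phi> ` A = {0<..a}"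
      using ray_in_open_interval by metis
    have "h (k x) = x" if "x \<in> \<phi> ` A" for x
      using homeomorphism_apply2[OF hk] that AJ by blast
    then have "h ` k ` \<phi> ` A = \<phi> ` A" by (simp add: image_image)
    then show ?thesis using a cA by (intro exI[of _ a] exI[of _ "k ` \<phi> ` A"]) auto
  qed
  obtain a I where a: "0 < a" "a < 1" "I = {a..<1} \<or> I = {0<..a}" "k ` \<phi> ` JL = I"
      "closure (h ` I) = \<phi> ` L \<union> h ` I"
    using ends[OF ray(1,4) sub(4,1) disj(1)] by auto
  obtain b I' where b: "0 < b" "b < 1" "I' = {b..<1} \<or> I' = {0<..b}" "k ` \<phi> ` JR = I'"
      "closure (h ` I') = \<phi> ` R \<union> h ` I'"
    using ends[OF ray(2,5) sub(5,2) disj(2)] by auto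
  have un: "I \<union> I' = {0<..<1}" using a(4) b(4) kJ ray(3) by (simp add: image_Un)
  have cpt: "compact (\<phi> ` L)" "compact (\<phi> ` R)" "compact (\<phi> ` topspace X)"
    using comp[of L] comp[of R] comp[of "topspace X"] cont sub by (auto simp: continuum_def)
  have ne: "\<phi> ` L \<noteq> {}" "\<phi> ` R \<noteq> {}"
    using cont(2,3) by (auto simp: continuum_def)
  have dj': "\<phi> ` L \<inter> h ` {0<..<1} = {}" "\<phi> ` R \<inter> h ` {0<..<1} = {}"
    unfolding hJ using dj sub disj by blast+
  have cX: "compact (\<phi> ` L \<union> h ` {0<..<1} \<union> \<phi> ` R)"
    using cpt(3) unfolding hJ TX by (simp add: image_Un)
  then have cX': "compact (\<phi> ` R \<union> h ` {0<..<1} \<union> \<phi> ` L)" by (simp add: Un_ac)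
  consider "I = {0<..a}" "I' = {b..<1}" | "I = {a..<1}" "I' = {0<..b}"
  proof -
    \<comment> \<open>One parameter beyond both \<open>a\<close> and \<open>b\<close> and one before
      them must be covered, so the rays cannot be tails at the same end.\<close>
    have "(1 + max a b) / 2 \<in> I \<union> I'" "min a b / 2 \<in> I \<union> I'"
      unfolding un using a(1,2) b(1,2) by (auto simp: max_def min_def)
    then show ?thesis using a(1-3) b(1-3) that by (auto simp: max_def min_def split: if_splits)
  qed
  then show thesis
  proof cases
    case 1
    have "two_ended_interval (\<phi> ` L) (\<phi> ` R) h k"
      by unfold_locales (use cpt ne dj' cX hk hJ 1 a b in auto)
    then show thesis using hJ that by blast
  next
    case 2
    have "two_ended_interval (\<phi> ` R) (\<phi> ` L) h k"
      by unfold_locales (use cpt ne dj' cX' hk hJ 2 a b in auto)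
    then interpret F: two_ended_interval "\<phi> ` R" "\<phi> ` L" h k .
    show thesis using that[OF F.flip] F.flip_image hJ by simp
  qed
qed

subsection \<open>The theorem\<close>

lemma homeomorphic_space_top_of_set:
  "S homeomorphic T \<Longrightarrow> top_of_set S homeomorphic_space top_of_set T"
  unfolding homeomorphic_def homeomorphic_space_def using homeomorphism_imp_homeomorphic_maps by blast

lemma nondegenerate_image: "inj_on \<phi> S \<Longrightarrow> nondegenerate S \<Longrightarrow> nondegenerate (\<phi> ` S)"
  unfolding nondegenerate_def inj_on_def by blast

lemma disjnt_minimal_sets:
  assumes "topspace Y \<inter> topspace Z = {}"
  shows "disjnt (minimal_sets Y) (minimal_sets Z)"
proof -
  have False if M: "M \<in> minimal_sets Y" "M \<in> minimal_sets Z" for M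
  proof -
    have "M \<subseteq> topspace Y \<inter> topspace Z"
      using minimal_sets_nonempty_subset(2)[OF M(1)] minimal_sets_nonempty_subset(2)[OF M(2)] by simp
    then show False using assms minimal_sets_nonempty_subset(1)[OF M(1)] by simp
  qed
  then show ?thesis unfolding disjnt_iff by blast
qed

text \<open>In the image, every admissible arc is a closed right tail with the point of
  \<open>R\<close> added. Conversely such a set pulls back to an arc, properly contained because
  \<open>a > 0\<close> leaves points of \<open>J\<close> uncovered. \<open>Q\<close> will be the
  statement about minimal sets in (1).\<close>

lemma (in two_ended_interval) right_end_arcs:
  fixes \<phi> :: "'a \<Rightarrow> 'b"
  assumes hm: "homeomorphic_map Y (top_of_set (\<phi> ` topspace Y)) \<phi>"
    and nd: "nondegenerate L" and r: "R = {\<phi> r}" "r \<in> topspace Y"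
    and J': "J = \<phi> ` J'" "J' \<subseteq> topspace Y"
  shows "(\<exists>A. arc_in Y A \<and> {r} \<subseteq> A \<and> A \<subset> {r} \<union> J' \<and> Q (\<phi> ` A)) \<longleftrightarrow>
    (\<exists>a. 0 < a \<and> a < 1 \<and> Q (R \<union> h ` {a..<1}))"
proof -
  have inj: "inj_on \<phi> (topspace Y)" using hm homeomorphic_imp_injective_map by blast
  have hom: "subtopology Y A homeomorphic_space top_of_set (\<phi> ` A)" if "A \<subseteq> topspace Y" for A
  proof -
    have "homeomorphic_map (subtopology Y A) (subtopology (top_of_set (\<phi> ` topspace Y)) (\<phi> ` A)) \<phi>"
      using that by (intro homeomorphic_map_subtopologies[OF hm]) (auto simp: Int_absorb1)
    then show ?thesis
      using that by (auto simp: subtopology_subtopology Int_absorb1 image_mono homeomorphic_space)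
  qed
  show ?thesis
  proof
    assume "\<exists>A. arc_in Y A \<and> {r} \<subseteq> A \<and> A \<subset> {r} \<union> J' \<and> Q (\<phi> ` A)"
    then obtain A where A: "arc_in Y A" "{r} \<subseteq> A" "A \<subset> {r} \<union> J'" "Q (\<phi> ` A)" by blast
    have AY: "A \<subseteq> topspace Y" using A(1) by (simp add: arc_in_def)
    have "top_of_set (\<phi> ` A) homeomorphic_space top_of_set {0..1::real}"
      using hom[OF AY] A(1) unfolding arc_in_def by (meson homeomorphic_space_sym homeomorphic_space_trans)
    then obtain p q where pq: "homeomorphism (\<phi> ` A) {0..1::real} p q"
      by (rule homeomorphic_space_imp_homeomorphism)
    then have q: "continuous_on {0..1} q" "\<phi> ` A = q ` {0..1}" by (auto simp: homeomorphism_def)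
    have "compact (\<phi> ` A)" unfolding q(2) by (rule compact_continuous_image[OF q(1)]) simp
    moreover have "path_connected (\<phi> ` A)"
      unfolding q(2) by (rule path_connected_continuous_image[OF q(1)]) simp
    moreover have "\<phi> ` A \<noteq> R"
    proof
      assume "\<phi> ` A = R"
      then have "q ` {0..1} = {\<phi> r}" using q(2) r(1) by simp
      moreover have "q 0 \<in> q ` {0..1}" "q 1 \<in> q ` {0..1}" by (intro imageI; simp)+
      ultimately have "q 0 = q 1" by simp
      moreover have "p (q 0) = 0" "p (q 1) = 1" using pq by (auto simp: homeomorphism_def)
      ultimately show False by simp
    qed
    moreover have "R \<subseteq> \<phi> ` A" using A(2) r(1) by auto
    moreover have "\<phi> ` A \<subset> R \<union> J"
    proof -
      have "\<phi> ` A \<subset> \<phi> ` ({r} \<union> J')"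
        by (rule image_strict_mono[OF inj_on_subset[OF inj] A(3)]) (use J'(2) r(2) in auto)
      then show ?thesis by (simp add: J'(1) r(1))
    qed
    ultimately obtain a where "0 < a" "a < 1" "\<phi> ` A = R \<union> h ` {a..<1}"
      using arc_through_right_point[OF nd r(1), of "\<phi> ` A"] by metis
    then show "\<exists>a. 0 < a \<and> a < 1 \<and> Q (R \<union> h ` {a..<1})" using A(4) by metis
  next
    assume "\<exists>a. 0 < a \<and> a < 1 \<and> Q (R \<union> h ` {a..<1})"
    then obtain a where a: "0 < a" "a < 1" "Q (R \<union> h ` {a..<1})" by blast
    define A where "A = {r} \<union> {x \<in> J'. \<phi> x \<in> h ` {a..<1}}"
    have sub: "h ` {a..<1} \<subseteq> \<phi> ` J'" using a(1) unfolding J'(1)[symmetric] by (intro image_mono) auto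
    then have "h ` {a..<1} \<inter> \<phi> ` J' = h ` {a..<1}" by (rule Int_absorb2)
    moreover have "\<phi> ` {x \<in> J'. \<phi> x \<in> B} = B \<inter> \<phi> ` J'" for B by blast
    ultimately have "\<phi> ` {x \<in> J'. \<phi> x \<in> h ` {a..<1}} = h ` {a..<1}" by simp
    then have \<phi>A: "\<phi> ` A = R \<union> h ` {a..<1}" by (simp add: A_def r(1))
    have AY: "A \<subseteq> topspace Y" using r(2) J'(2) by (auto simp: A_def)
    obtain g where "homeomorphism {a..1} (R \<union> h ` {a..<1}) (h(1 := \<phi> r)) g"
      using right_arc[OF r(1) a(1,2)] by blast
    then have "(R \<union> h ` {a..<1}) homeomorphic {a..1}"
      unfolding homeomorphic_def using homeomorphism_symD by blast
    moreover have "{a..1} homeomorphic {0..1::real}"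
      using a by (intro homeomorphic_closed_intervals_real) auto
    ultimately have "top_of_set (\<phi> ` A) homeomorphic_space top_of_set {0..1::real}"
      unfolding \<phi>A by (intro homeomorphic_space_top_of_set) (rule homeomorphic_trans)
    then have "arc_in Y A"
      using AY hom[OF AY] unfolding arc_in_def by (meson homeomorphic_space_trans)
    moreover have "A \<noteq> {r} \<union> J'"
    proof
      assume "A = {r} \<union> J'"
      then have "\<phi> ` A = R \<union> J" by (simp add: J'(1) r(1))
      moreover have "h (a/2) \<in> J" using a by (intro imageI) auto
      ultimately have "h (a/2) \<in> R \<union> h ` {a..<1}" using \<phi>A by simp
      moreover have "h (a/2) \<notin> R" using a by (intro h_notin) auto
      moreover have "h (a/2) \<in> h ` {a..<1} \<longleftrightarrow> a/2 \<in> {a..<1}" using a by (intro h_mem_image) auto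
      ultimately show False using a by auto
    qed
    moreover have "{r} \<subseteq> A" "A \<subseteq> {r} \<union> J'" by (auto simp: A_def)
    ultimately show "\<exists>A. arc_in Y A \<and> {r} \<subseteq> A \<and> A \<subset> {r} \<union> J' \<and> Q (\<phi> ` A)"
      using a(3) \<phi>A by (intro exI[of _ A]) auto
  qed
qed

theorem theoremA:
  fixes X :: "'a topology" and L J R :: "'a set"
  assumes "class_C X L J R"
  shows
    "(is_singleton R \<and> nondegenerate L \<and> R \<subset> L \<longrightarrow>
        minimal_sets X =
          (\<Union>A\<in>{A. arc_in X A \<and> R \<subseteq> A \<and> A \<subset> R \<union> J}. minimal_sets (subtopology X (L \<union> A))))
     \<and>
     (is_singleton R \<and> nondegenerate L \<and> L \<inter> R = {} \<longrightarrow>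
        minimal_sets X = minimal_sets (subtopology X L) \<union> minimal_sets (subtopology X (J \<union> R)) \<and>
        disjnt (minimal_sets (subtopology X L)) (minimal_sets (subtopology X (J \<union> R))))
     \<and>
     (nondegenerate L \<and> nondegenerate R \<and> L \<inter> R \<noteq> {} \<longrightarrow>
        minimal_sets X = minimal_sets (subtopology X (L \<union> R)) \<union> minimal_sets (subtopology X J) \<and>
        disjnt (minimal_sets (subtopology X (L \<union> R))) (minimal_sets (subtopology X J)))
     \<and>
     (nondegenerate L \<and> nondegenerate R \<and> L \<inter> R = {} \<longrightarrow>
        sorted_wrt disjnt
          [minimal_sets (subtopology X J), minimal_sets (subtopology X L),
           minimal_sets (subtopology X R),
           minimal_sets_star (subtopology X L) (subtopology X R)] \<and>
        minimal_sets X \<subseteq>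
          minimal_sets (subtopology X J) \<union> minimal_sets (subtopology X L) \<union>
          minimal_sets (subtopology X R) \<union>
          minimal_sets_star (subtopology X L) (subtopology X R) \<and>
        minimal_sets (subtopology X J) \<union> minimal_sets (subtopology X L) \<union>
          minimal_sets (subtopology X R) \<subseteq> minimal_sets X)"
proof -
  note C = assms[unfolded class_C_def]
  have TX: "topspace X = L \<union> J \<union> R" and cont: "continuum X"
    and lc: "locally_connected_space (subtopology X L)" "locally_connected_space (subtopology X R)"
    and cLR: "continuum (subtopology X L)" "continuum (subtopology X R)"
    and disj: "L \<inter> J = {}" "R \<inter> J = {}"
    using C by (auto simp: disjnt_def)
  have met: "metrizable_space X" using cont by (simp add: continuum_def)
  obtain \<phi> :: "'a \<Rightarrow> nat \<Rightarrow> real" where hm: "homeomorphic_map X (top_of_set (\<phi> ` topspace X)) \<phi>"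
    using cont compact_metrizable_embedding unfolding continuum_def by blast
  obtain h k where int: "two_ended_interval (\<phi> ` L) (\<phi> ` R) h k" and hJ: "h ` {0<..<1} = \<phi> ` J"
    by (rule class_C_embedded[OF assms hm])
  interpret I: two_ended_interval "\<phi> ` L" "\<phi> ` R" h k by (rule int)
  interpret F: two_ended_interval "\<phi> ` R" "\<phi> ` L" "\<lambda>t. h (1 - t)" "\<lambda>x. 1 - k x" by (rule I.flip)
  have inj: "inj_on \<phi> (topspace X)" using hm homeomorphic_imp_injective_map by blast
  have sub: "L \<subseteq> topspace X" "J \<subseteq> topspace X" "R \<subseteq> topspace X" using TX by auto
  have ms: "M \<in> minimal_sets (subtopology X S) \<longleftrightarrow> M \<subseteq> topspace X \<and> min_set (\<phi> ` S) (\<phi> ` M)"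
    if "S \<subseteq> topspace X" for M S
    by (rule minimal_sets_subtopology_embedded[OF met hm that])
  have msX: "M \<in> minimal_sets X \<longleftrightarrow> M \<subseteq> topspace X \<and> min_set (\<phi> ` L \<union> \<phi> ` J \<union> \<phi> ` R) (\<phi> ` M)" for M
  proof -
    have "\<phi> ` topspace X = \<phi> ` L \<union> \<phi> ` J \<union> \<phi> ` R" by (simp add: TX image_Un)
    then show ?thesis using ms[OF order_refl, of M] by simp
  qed
  have locally: "uniformly_locally_path_connected (\<phi> ` S) \<and> path_connected (\<phi> ` S)"
    if "S \<subseteq> topspace X" "locally_connected_space (subtopology X S)" "continuum (subtopology X S)"
      "compact (\<phi> ` S)" for S
  proof -
    have "homeomorphic_map (subtopology X S) (subtopology (top_of_set (\<phi> ` topspace X)) (\<phi> ` S)) \<phi>"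
      using that(1) by (intro homeomorphic_map_subtopologies[OF hm]) (auto simp: Int_absorb1)
    then have hom: "subtopology X S homeomorphic_space top_of_set (\<phi> ` S)"
      using that(1) by (auto simp: subtopology_subtopology Int_absorb1 image_mono homeomorphic_space)
    then have "locally_connected_space (top_of_set (\<phi> ` S))" "connected_space (top_of_set (\<phi> ` S))"
      using homeomorphic_locally_connected_space[OF hom] homeomorphic_connected_space[OF hom] that
      by (auto simp: continuum_def)
    then show ?thesis
      using compact_locally_connected_imp_uniformly_locally_path_connected[OF that(4)] uniformly_locally_path_connected_connected_imp_path_connected
      by (metis connectedin_absolute connectedin_iff_connected connectedin_subtopology topspace_euclidean_subtopology
          connectedin_topspace)
  qed
  have L: "uniformly_locally_path_connected (\<phi> ` L)" "path_connected (\<phi> ` L)" and R: "uniformly_locally_path_connected (\<phi> ` R)" "path_connected (\<phi> ` R)"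
    using locally[OF sub(1) lc(1) cLR(1) I.compact_L] locally[OF sub(3) lc(2) cLR(2) I.compact_R] by auto
  have ndL: "nondegenerate (\<phi> ` L)" if "nondegenerate L"
    using nondegenerate_image[OF inj_on_subset[OF inj sub(1)] that] .
  have ndR: "nondegenerate (\<phi> ` R)" if "nondegenerate R"
    using nondegenerate_image[OF inj_on_subset[OF inj sub(3)] that] .
  have LR_Int: "\<phi> ` L \<inter> \<phi> ` R = \<phi> ` (L \<inter> R)"
    using inj_on_image_Int[OF inj sub(1,3)] by simp
  have flipX: "\<phi> ` R \<union> \<phi> ` J \<union> \<phi> ` L = \<phi> ` L \<union> \<phi> ` J \<union> \<phi> ` R" by auto
  have c1: "minimal_sets X =
      (\<Union>A\<in>{A. arc_in X A \<and> R \<subseteq> A \<and> A \<subset> R \<union> J}. minimal_sets (subtopology X (L \<union> A)))"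
    if R1: "is_singleton R" and nd: "nondegenerate L" and RL: "R \<subset> L"
  proof -
    obtain r where r: "R = {r}" using R1 by (auto simp: is_singleton_def)
    have \<phi>r: "\<phi> ` R = {\<phi> r}" "\<phi> r \<in> \<phi> ` L" "r \<in> topspace X" using r RL sub by auto
    have "M \<in> minimal_sets X \<longleftrightarrow>
        (\<exists>A. arc_in X A \<and> R \<subseteq> A \<and> A \<subset> R \<union> J \<and> M \<in> minimal_sets (subtopology X (L \<union> A)))" for M
    proof -
      have "M \<in> minimal_sets X \<longleftrightarrow> M \<subseteq> topspace X \<and>
          (\<exists>a. 0 < a \<and> a < 1 \<and> min_set (\<phi> ` L \<union> (\<phi> ` R \<union> h ` {a..<1})) (\<phi> ` M))"
        using I.min_set_right_point_in_L[OF ndL[OF nd] \<phi>r(1,2) L, of "\<phi> ` M"] msX unfolding hJ by simp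
      also have "\<dots> \<longleftrightarrow> M \<subseteq> topspace X \<and> (\<exists>A. arc_in X A \<and> {r} \<subseteq> A \<and> A \<subset> {r} \<union> J \<and>
          min_set (\<phi> ` L \<union> \<phi> ` A) (\<phi> ` M))"
        using I.right_end_arcs[OF hm ndL[OF nd] \<phi>r(1,3) hJ sub(2), of "\<lambda>B. min_set (\<phi> ` L \<union> B) (\<phi> ` M)"]
        by simp
      also have "\<dots> \<longleftrightarrow> (\<exists>A. arc_in X A \<and> R \<subseteq> A \<and> A \<subset> R \<union> J \<and> M \<in> minimal_sets (subtopology X (L \<union> A)))"
      proof -
        have "M \<in> minimal_sets (subtopology X (L \<union> A)) \<longleftrightarrow>
            M \<subseteq> topspace X \<and> min_set (\<phi> ` L \<union> \<phi> ` A) (\<phi> ` M)" if "arc_in X A" for A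
          using ms[of "L \<union> A" M] that sub(1) by (simp add: arc_in_def image_Un)
        then show ?thesis unfolding r by blast
      qed
      finally show ?thesis .
    qed
    then show ?thesis by blast
  qed
  have c2: "minimal_sets X = minimal_sets (subtopology X L) \<union> minimal_sets (subtopology X (J \<union> R))"
    if R1: "is_singleton R" and nd: "nondegenerate L" and LR: "L \<inter> R = {}"
  proof -
    obtain r where r: "\<phi> ` R = {\<phi> r}" using R1 by (auto simp: is_singleton_def)
    have LR': "\<phi> ` L \<inter> \<phi> ` R = {}" using LR LR_Int by simp
    have "min_set (\<phi> ` L \<union> \<phi> ` J \<union> \<phi> ` R) N \<longleftrightarrow> min_set (\<phi> ` L) N \<or> min_set (\<phi> ` J \<union> \<phi> ` R) N" for N
      using I.min_set_cases_point[OF ndL[OF nd] r LR' L(2), of N] I.min_set_left[OF LR' L, of N]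
        I.min_set_J_R[OF LR', of N]
      unfolding hJ by blast
    then show ?thesis
      using sub by (auto simp: msX ms image_Un)
  qed
  have c3: "minimal_sets X = minimal_sets (subtopology X (L \<union> R)) \<union> minimal_sets (subtopology X J)"
    if nd: "nondegenerate L" "nondegenerate R" and LR: "L \<inter> R \<noteq> {}"
  proof -
    have LR': "\<phi> ` L \<inter> \<phi> ` R \<noteq> {}" using LR LR_Int by simp
    have "min_set (\<phi> ` L \<union> \<phi> ` J \<union> \<phi> ` R) N \<longleftrightarrow> min_set (\<phi> ` L \<union> \<phi> ` R) N \<or> min_set (\<phi> ` J) N" for N
      using I.min_set_cases_meet[OF ndL[OF nd(1)] ndR[OF nd(2)] LR' L(2) R(2), of N]
        I.min_set_ends_meet[OF LR' L R, of N] I.min_set_J[of N]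
      unfolding hJ by blast
    then show ?thesis
      using sub by (auto simp: msX ms image_Un)
  qed
  \<comment> \<open>The ends are closed and disjoint, so the disjoint union in the definition is the
    subspace \<open>L \<union> R\<close>.\<close>
  have star: "minimal_sets_star (subtopology X L) (subtopology X R) =
      {M \<in> minimal_sets (subtopology X (L \<union> R)). M \<inter> L \<approx> M \<inter> R}" if LR: "L \<inter> R = {}"
  proof -
    have cl: "closedin X K" if "K \<subseteq> topspace X" "continuum (subtopology X K)" for K
    proof -
      have "compactin X K"
        using that by (simp add: continuum_def compactin_subspace)
      then show ?thesis using metrizable_imp_Hausdorff_space[OF met] compactin_imp_closedin by blast
    qed
    show ?thesis
      unfolding minimal_sets_star_def
        disjoint_union_topology_subtopology[OF cl[OF sub(1) cLR(1)] cl[OF sub(3) cLR(2)] LR[folded disjnt_def]]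
      using sub by (simp add: Int_absorb1)
  qed
  have c4a: "minimal_sets X \<subseteq> minimal_sets (subtopology X J) \<union> minimal_sets (subtopology X L) \<union>
      minimal_sets (subtopology X R) \<union> minimal_sets_star (subtopology X L) (subtopology X R)"
    if nd: "nondegenerate L" "nondegenerate R" and LR: "L \<inter> R = {}"
  proof
    fix M assume "M \<in> minimal_sets X"
    then have M: "M \<subseteq> topspace X" "min_set (\<phi> ` L \<union> \<phi> ` J \<union> \<phi> ` R) (\<phi> ` M)" by (auto simp: msX)
    have LR': "\<phi> ` L \<inter> \<phi> ` R = {}" using LR LR_Int by simp
    have eq: "\<phi> ` M \<inter> \<phi> ` K = \<phi> ` (M \<inter> K)" "\<phi> ` (M \<inter> K) \<approx> M \<inter> K" if "K \<subseteq> topspace X" for K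
      using inj_on_image_Int[OF inj M(1) that] inj_on_image_eqpoll_self[OF inj_on_subset[OF inj]] M(1)
      by (simp, meson inf.coboundedI1)
    have "\<phi> ` M \<inter> \<phi> ` L \<approx> \<phi> ` M \<inter> \<phi> ` R \<Longrightarrow> M \<inter> L \<approx> M \<inter> R"
      unfolding eq(1)[OF sub(1)] eq(1)[OF sub(3)]
      using eq(2)[OF sub(1)] eq(2)[OF sub(3)] by (meson eqpoll_sym eqpoll_trans)
    then have "min_set (\<phi> ` J) (\<phi> ` M) \<or> min_set (\<phi> ` L) (\<phi> ` M) \<or> min_set (\<phi> ` R) (\<phi> ` M) \<or>
        min_set (\<phi> ` (L \<union> R)) (\<phi> ` M) \<and> M \<inter> L \<approx> M \<inter> R"
      using I.min_set_cases_disjoint[OF ndL[OF nd(1)] ndR[OF nd(2)] LR' L(2) R(2)] M(2)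
      unfolding hJ image_Un by blast
    then show "M \<in> minimal_sets (subtopology X J) \<union> minimal_sets (subtopology X L) \<union>
        minimal_sets (subtopology X R) \<union> minimal_sets_star (subtopology X L) (subtopology X R)"
      using M(1) sub ms[of "L \<union> R" M] ms[of L M] ms[of R M] ms[of J M] unfolding star[OF LR] by auto
  qed
  have c4b: "minimal_sets (subtopology X J) \<union> minimal_sets (subtopology X L) \<union>
      minimal_sets (subtopology X R) \<subseteq> minimal_sets X" if LR: "L \<inter> R = {}"
  proof -
    have LR': "\<phi> ` L \<inter> \<phi> ` R = {}" "\<phi> ` R \<inter> \<phi> ` L = {}" using LR LR_Int by auto
    show ?thesis
      using I.min_set_J I.min_set_left[OF LR'(1) L] F.min_set_left[OF LR'(2) R] sub
      unfolding hJ I.flip_image flipX by (auto simp: msX ms)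
  qed
  have d4: "sorted_wrt disjnt
      [minimal_sets (subtopology X J), minimal_sets (subtopology X L), minimal_sets (subtopology X R),
       minimal_sets_star (subtopology X L) (subtopology X R)]" if LR: "L \<inter> R = {}"
  proof -
    \<comment> \<open>A nonempty \<open>M\<close> in \<open>L \<union> R\<close> with equinumerous
      traces meets both ends, so it fits into no set that misses one of them. This covers
      \<open>J\<close>, \<open>L\<close> and \<open>R\<close>.\<close>
    have *: "disjnt (minimal_sets (subtopology X K)) (minimal_sets_star (subtopology X L) (subtopology X R))"
      if "K \<inter> L = {} \<or> K \<inter> R = {}" for K
    proof -
      have False if M: "M \<in> minimal_sets (subtopology X K)" "M \<in> minimal_sets (subtopology X (L \<union> R))"
        "M \<inter> L \<approx> M \<inter> R" for M
      proof -
        have "M \<noteq> {}" "M \<subseteq> K" "M \<subseteq> L \<union> R"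
          using minimal_sets_nonempty_subset[OF M(1)] minimal_sets_nonempty_subset[OF M(2)] by auto
        moreover have "M \<inter> L = {} \<longleftrightarrow> M \<inter> R = {}" using M(3) by (metis eqpoll_empty_iff_empty eqpoll_sym)
        ultimately show False using \<open>K \<inter> L = {} \<or> K \<inter> R = {}\<close> by blast
      qed
      then show ?thesis unfolding star[OF LR] disjnt_iff by blast
    qed
    have "disjnt (minimal_sets (subtopology X A)) (minimal_sets (subtopology X B))" if "A \<inter> B = {}" for A B
      by (rule disjnt_minimal_sets) (use that in auto)
    then show ?thesis using * disj LR by (simp add: Int_commute)
  qed
  have dj: "disjnt (minimal_sets (subtopology X A)) (minimal_sets (subtopology X B))" if "A \<inter> B = {}" for A B
    by (rule disjnt_minimal_sets) (use that in auto)
  have "L \<inter> (J \<union> R) = {}" if "L \<inter> R = {}" using that disj by blast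
  moreover have "(L \<union> R) \<inter> J = {}" using disj by blast
  ultimately show ?thesis using c1 c2 c3 c4a c4b d4 dj by (intro conjI impI; elim conjE; metis)
qed

end
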